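(* Let $S_n$ be a centred random walk with positive finite variance $\sigma^2$. Then for any $d>0$ and any $x\in M$, $$p_n(x)\sim \frac{\sqrt{2}\,V_d(x)}{\sigma\sqrt{\pi n}},\qquad n\to\infty. \qquad ( * )$$ The function $V_d$ is harmonic for the walk killed as it enters $(-d,d)$, that is, $V_d(x)=\mathbb{E}_x V_d(S_1)$ for all $x \in M$ with $|x|\ge d$. It satisfies $0<U_d(x)\le V_d(x)<\infty$ for all $x\in M$ with $|x|\ge d$; $V_d(x)\sim |x|$ as $|x|\to\infty$ ($x\in M$); and, for any fixed $y\ge 0$ and either choice of sign, $V_d(\pm(d+y))-U_d(\pm(d+y))\to 0$ as $d\to\infty$ (along $d$ with $d+y\in M$). Moreover, $( * )$ holds uniformly for $x=o(\sqrt n)$, that is, uniformly over $x\in[-a_n\sqrt n,a_n\sqrt n]\cap M$ for any fixed sequence $a_n\to0$ such that $a_n\sqrt n\to\infty$.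
   Context: $S_n=x+X_1+\dots+X_n$, $n \ge 0$, is a random walk on the real line with i.i.d. increments $X_i$; centred means $\mathbb{E}X_1=0$, and $\sigma^2=\mathrm{Var}(X_1)\in(0,\infty)$. $\mathbb{P}_x,\mathbb{E}_x$ denote probability and expectation for the walk started at $S_0=x$. The distribution of $X_1$ is $\lambda$-arithmetic if $\lambda>0$ is the maximal number such that $\mathbb{P}(X_1\in\lambda\mathbb{Z})=1$, and non-arithmetic if no such number exists. The state space is $M=\lambda\mathbb{Z}$ in the $\lambda$-arithmetic case and $M=\mathbb{R}$ in the non-arithmetic case; only starting points in $M$ are considered. For $d>0$ let $\tau_{(-d,d)}=\min\{k\ge0: S_k\in(-d,d)\}$ and $p_n(x)=\mathbb{P}_x(\tau_{(-d,d)}>n)$. For starting points with $|x|\ge d$ put $T_0=0$ and, for $k\ge 0$, $$T_{k+1}=\min\{n>T_k: S_{n-1}\ge d,\ S_n<d\}\wedge\min\{n>T_k: S_{n-1}\le -d,\ S_n>-d\},$$ $H_k=S_{T_k}$, and $\kappa=\min\{k\ge1: |H_k|<d\}$ (so $\tau_{(-d,d)}=T_\kappa$). For $|x|\ge d$ define $$U_d(x)=|x-\mathbb{E}_xS_{T_1}|,\qquad V_d(x)=\mathbb{E}_x\sum_{i=1}^{\kappa}|H_i-H_{i-1}|,$$ and set $V_d(x)=0$ for $|x|<d$. The notation $f_n\sim g_n$ means $f_n/g_n\to1$, and uniformity means uniform convergence of this ratio to $1$; for $|x|<d$ both sides of $( * )$ are identically $0$ and the relation is understood as the trivial equality $0=0$.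 *)

theory Defs
  imports "HOL-Probability.Probability" "HOL-Library.Landau_Symbols"
begin

definition int_multiples :: "real \<Rightarrow> real set" where
  "int_multiples l = range (\<lambda>k::int. l * of_int k)"

definition arithmetic_dist :: "real measure \<Rightarrow> real \<Rightarrow> bool" where
  "arithmetic_dist \<mu> l \<longleftrightarrow>
     l > 0 \<and> measure \<mu> (int_multiples l) = 1 \<and> (\<forall>l'>0. measure \<mu> (int_multiples l') = 1 \<longrightarrow> l' \<le> l)"

definition state_space :: "real measure \<Rightarrow> real set" where
  "state_space \<mu> =
     (if \<exists>l. arithmetic_dist \<mu> l then int_multiples (THE l. arithmetic_dist \<mu> l) else UNIV)"

text \<open>
  The increments are indexed from 0: \<open>X i\<close> is the \<open>(i+1)\<close>-st increment. All the laws
  \<open>P\<^sub>x\<close> are realised on one probability space, the starting point being a parameter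
  of the path.
\<close>

definition walk :: "(nat \<Rightarrow> 'a \<Rightarrow> real) \<Rightarrow> real \<Rightarrow> 'a \<Rightarrow> nat \<Rightarrow> real" where
  "walk X x \<omega> n = x + (\<Sum>i<n. X i \<omega>)"

text \<open>Minimum with the convention that the minimum of the empty set is \<open>\<infinity>\<close>.\<close>

definition first_time :: "(nat \<Rightarrow> bool) \<Rightarrow> enat" where
  "first_time A = Inf (enat ` {n. A n})"

definition hit_time :: "real \<Rightarrow> (nat \<Rightarrow> real) \<Rightarrow> enat" where
  "hit_time d s = first_time (\<lambda>k. s k \<in> {-d<..<d})"

definition tail_prob :: "'a measure \<Rightarrow> (nat \<Rightarrow> 'a \<Rightarrow> real) \<Rightarrow> real \<Rightarrow> real \<Rightarrow> nat \<Rightarrow> real" where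
  "tail_prob P X d x n = measure P {\<omega> \<in> space P. hit_time d (walk X x \<omega>) > enat n}"

primrec cross_time :: "real \<Rightarrow> (nat \<Rightarrow> real) \<Rightarrow> nat \<Rightarrow> enat" where
  "cross_time d s 0 = 0"
| "cross_time d s (Suc k) =
     min (first_time (\<lambda>n. enat n > cross_time d s k \<and> s (n - 1) \<ge> d \<and> s n < d))
         (first_time (\<lambda>n. enat n > cross_time d s k \<and> s (n - 1) \<le> -d \<and> s n > -d))"

text \<open>
  The value 0 at an infinite crossing time is arbitrary. For the walks considered below
  the crossing times are almost surely finite.
\<close>

definition cross_pos :: "real \<Rightarrow> (nat \<Rightarrow> real) \<Rightarrow> nat \<Rightarrow> real" where
  "cross_pos d s k = (case cross_time d s k of enat n \<Rightarrow> s n | \<infinity> \<Rightarrow> 0)"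

definition kappa :: "real \<Rightarrow> (nat \<Rightarrow> real) \<Rightarrow> enat" where
  "kappa d s = first_time (\<lambda>k. k \<ge> 1 \<and> cross_time d s k \<noteq> \<infinity> \<and> \<bar>cross_pos d s k\<bar> < d)"

definition U :: "'a measure \<Rightarrow> (nat \<Rightarrow> 'a \<Rightarrow> real) \<Rightarrow> real \<Rightarrow> real \<Rightarrow> real" where
  "U P X d x = \<bar>x - (\<integral>\<omega>. cross_pos d (walk X x \<omega>) 1 \<partial>P)\<bar>"

text \<open>
  \<open>V_ext\<close> takes values in \<open>[0,\<infinity>]\<close>, so that its finiteness is a genuine assertion; \<open>V\<close> is
  its real version, which agrees with it wherever it is finite.
\<close>

definition V_ext :: "'a measure \<Rightarrow> (nat \<Rightarrow> 'a \<Rightarrow> real) \<Rightarrow> real \<Rightarrow> real \<Rightarrow> ennreal" where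
  "V_ext P X d x =
     (if \<bar>x\<bar> < d then 0
      else \<integral>\<^sup>+\<omega>. (\<Sum>i. if 1 \<le> i \<and> enat i \<le> kappa d (walk X x \<omega>)
                      then ennreal \<bar>cross_pos d (walk X x \<omega>) i - cross_pos d (walk X x \<omega>) (i - 1)\<bar>
                      else 0) \<partial>P)"

definition V :: "'a measure \<Rightarrow> (nat \<Rightarrow> 'a \<Rightarrow> real) \<Rightarrow> real \<Rightarrow> real \<Rightarrow> real" where
  "V P X d x = enn2real (V_ext P X d x)"

text \<open>
  The quotient with \<open>0/0\<close> read as 1, which is the convention built into
  \<^const>\<open>asymp_equiv\<close>; it is needed here to state uniformity.
\<close>

definition ratio :: "real \<Rightarrow> real \<Rightarrow> real" where
  "ratio a b = (if a = 0 \<and> b = 0 then 1 else a / b)"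

end

theory Submission
  imports Defs "HOL-Analysis.Kronecker_Approximation_Theorem"
begin

text \<open>
  Write \<open>\<phi>(r) = \<E> (\<bar>X\<^sub>1\<bar> - r)\<^sup>+\<close>, which is decreasing and integrable because \<open>X\<^sub>1\<close> has a
  second moment. Mixing the concave functions \<open>min \<bar>x\<bar> s\<close> over \<open>s\<close> gives a function \<open>F\<close> with
  \<open>F(x) = o(\<bar>x\<bar>)\<close> and \<open>\<E> F(x + X\<^sub>1) \<le> F(x) - \<phi>(\<bar>x\<bar>)\<close> outside a bounded set. As the points
  accessible from \<open>0\<close> form a closed group containing \<open>M\<close>, the walk started in this bounded set
  enters \<open>(-d, d)\<close> within bounded time with probability bounded below. Hence the sum of
  \<open>\<phi>(\<bar>S\<^sub>j\<bar>)\<close> up to the entrance has expectation \<open>o(\<bar>x\<bar>)\<close>. The sum of \<open>\<bar>H\<^sub>i - H\<^sub>i\<^sub>-\<^sub>1\<bar>\<close>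
  differs from \<open>\<bar>x\<bar> - \<bar>S\<^sub>\<tau>\<bar>\<close> by twice the sum of \<open>\<bar>S\<^sub>j\<bar>\<close> over the sign changes, so that \<open>V\<close> is
  finite and equivalent to \<open>\<bar>x\<bar>\<close>.

  The bound on \<open>\<E>\<^sub>x (\<bar>S\<^sub>n\<bar>; \<tau> > n)\<close> and the concentration of \<open>S\<^sub>n\<close> given by the central limit
  theorem yield \<open>p\<^sub>n(x) \<le> C (1 + \<bar>x\<bar>) / \<surd>n\<close>. For starting points of order \<open>\<surd>n\<close> the
  probability \<open>p\<^sub>n\<close> is close to the mean of the sign of \<open>S\<^sub>n\<close>, as the sign is balanced after
  \<open>\<tau>\<close>. For smaller starting points, apply this after a short initial time, when \<open>p\<close> is
  approximately proportional to \<open>V\<close>, and use that \<open>V\<close> is harmonic.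
\<close>

section \<open>Killed transition operators\<close>

text \<open>The sum over the crossings is awkward for a Markov chain, so it is rewritten as a sum
  over single steps: between crossings the sign is constant and the signed steps telescope.
  Harmonicity and finiteness of \<open>V\<close> then become one-step computations. With only a
  second moment, overshoots are controlled by no more than the integrability of
  \<open>excess\<close>. Error terms are therefore \<open>o(\<bar>x\<bar>)\<close> rather than
  bounded, and they enter everywhere through bounds of the form
  \<open>\<epsilon> * \<bar>x\<bar> + C\<close>. The factor in the theorem comes from
  \<open>2 * \<Phi> t - 1\<close>, the mean sign of a normal variable displaced by \<open>t\<close>
  standard deviations, whose slope at \<open>0\<close> is \<open>sqrt (2 / pi)\<close>; here
  \<open>t = \<bar>z\<bar> / (\<sigma> * sqrt n)\<close>. Expectations of the killed walk are values
  of iterated operators, so the Markov property is additivity of iteration and most inductions run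
  over the number of steps. Measures on path space enter where a functional depends on the path as a
  whole.\<close>

definition wpath :: "real \<Rightarrow> (nat \<Rightarrow> real) \<Rightarrow> nat \<Rightarrow> real" where
  "wpath x s n = x + (\<Sum>i<n. s i)"

lemma wpath_0 [simp]: "wpath x s 0 = x"
  by (simp add: wpath_def)

lemma wpath_case_nat: "wpath x (case_nat y s) = case_nat x (wpath (x + y) s)"
proof
  fix n show "wpath x (case_nat y s) n = case_nat x (wpath (x + y) s) n"
    by (cases n) (simp_all add: wpath_def sum.lessThan_Suc_shift del: sum.lessThan_Suc)
qed

lemma walk_eq_wpath: "walk X x \<omega> = wpath x (\<lambda>i. X i \<omega>)"
  by (simp add: walk_def wpath_def fun_eq_iff)

text \<open>Quadratic growth is what a step with a finite second moment can integrate. The class is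
  stable under averaging over a step, so integrability conditions reduce to membership in
  it.\<close>

definition quad_bdd :: "(real \<Rightarrow> real) \<Rightarrow> bool" where
  "quad_bdd f \<longleftrightarrow> f \<in> borel_measurable borel \<and> (\<exists>c. \<forall>x. \<bar>f x\<bar> \<le> c * (1 + x\<^sup>2))"

lemma quad_bddI:
  assumes "f \<in> borel_measurable borel" "\<And>x. \<bar>f x\<bar> \<le> c * (1 + x\<^sup>2)"
  shows "quad_bdd f"
  using assms by (auto simp: quad_bdd_def)

lemma quad_bdd_measurable: "quad_bdd f \<Longrightarrow> f \<in> borel_measurable borel"
  by (simp add: quad_bdd_def)

lemma quad_bddE:
  assumes "quad_bdd f" obtains c where "c \<ge> 0" "\<And>x. \<bar>f x\<bar> \<le> c * (1 + x\<^sup>2)"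
proof -
  from assms obtain c where c: "\<And>x. \<bar>f x\<bar> \<le> c * (1 + x\<^sup>2)" by (auto simp: quad_bdd_def)
  have "0 \<le> c" using c[of 0] by auto
  with c that show ?thesis by blast
qed

lemma quad_bdd_add [intro!]: assumes "quad_bdd f" "quad_bdd g" shows "quad_bdd (\<lambda>x. f x + g x)"
proof -
  obtain a where a: "\<And>x. \<bar>f x\<bar> \<le> a * (1 + x\<^sup>2)" using assms(1) quad_bddE by blast
  obtain b where b: "\<And>x. \<bar>g x\<bar> \<le> b * (1 + x\<^sup>2)" using assms(2) quad_bddE by blast
  have [measurable]: "f \<in> borel_measurable borel" "g \<in> borel_measurable borel"
    using assms by (auto simp: quad_bdd_def)
  show ?thesis
  proof (rule quad_bddI[where c="a+b"])
    fix x show "\<bar>f x + g x\<bar> \<le> (a + b) * (1 + x\<^sup>2)"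
      using a[of x] b[of x] by (simp add: algebra_simps)
  qed measurable
qed

lemma quad_bdd_mult_bdd:
  assumes "quad_bdd f" "g \<in> borel_measurable borel" "\<And>x. \<bar>g x\<bar> \<le> C"
  shows "quad_bdd (\<lambda>x. g x * f x)"
proof -
  obtain a where a: "a \<ge> 0" "\<And>x. \<bar>f x\<bar> \<le> a * (1 + x\<^sup>2)" using assms(1) quad_bddE by blast
  have [measurable]: "f \<in> borel_measurable borel" "g \<in> borel_measurable borel"
    using assms by (auto simp: quad_bdd_def)
  show ?thesis
  proof (rule quad_bddI[where c="C*a"])
    fix x show "\<bar>g x * f x\<bar> \<le> (C * a) * (1 + x\<^sup>2)"
      using mult_mono[OF assms(3)[of x] a(2)[of x]] assms(3)[of x]
      by (simp add: abs_mult mult.assoc)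
  qed measurable
qed

lemma quad_bdd_cmult [intro!]: "quad_bdd f \<Longrightarrow> quad_bdd (\<lambda>x. c * f x)"
  using quad_bdd_mult_bdd[of f "\<lambda>_. c" "\<bar>c\<bar>"] by simp

lemma quad_bdd_indicator [intro!]:
  assumes "quad_bdd f" "A \<in> sets borel" shows "quad_bdd (\<lambda>x. indicator A x * f x)"
proof -
  have [measurable]: "A \<in> sets borel" by fact
  show ?thesis
    by (rule quad_bdd_mult_bdd[OF assms(1), where C=1]) (auto simp: indicator_def)
qed

lemma quad_bdd_bounded:
  assumes "f \<in> borel_measurable borel" "\<And>x. \<bar>f x\<bar> \<le> c"
  shows "quad_bdd f"
proof (rule quad_bddI[where c=c])
  fix x :: real
  have "0 \<le> c" using assms(2)[of 0] by linarith
  hence "c * 1 \<le> c * (1 + x\<^sup>2)" by (intro mult_left_mono) auto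
  thus "\<bar>f x\<bar> \<le> c * (1 + x\<^sup>2)" using assms(2)[of x] by linarith
qed fact

lemma quad_bdd_const [intro!, simp]: "quad_bdd (\<lambda>_. c)"
  by (rule quad_bdd_bounded[where c="\<bar>c\<bar>"]) auto

lemma abs_le_one_plus_sq: "\<bar>x::real\<bar> \<le> 1 + x\<^sup>2"
proof -
  have "0 \<le> (\<bar>x\<bar> - 1)\<^sup>2 + \<bar>x\<bar>" by (intro add_nonneg_nonneg) auto
  also have "\<dots> = 1 + x\<^sup>2 - \<bar>x\<bar>" by (simp add: power2_diff)
  finally show ?thesis by simp
qed

lemma quad_bdd_linear:
  assumes "f \<in> borel_measurable borel" "\<And>x. \<bar>f x\<bar> \<le> a + b * \<bar>x\<bar>" "b \<ge> 0"
  shows "quad_bdd f"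
proof (rule quad_bddI[where c="\<bar>a\<bar> + b"])
  fix x :: real
  have "\<bar>a\<bar> * 1 \<le> \<bar>a\<bar> * (1 + x\<^sup>2)" by (intro mult_left_mono) auto
  moreover have "b * \<bar>x\<bar> \<le> b * (1 + x\<^sup>2)"
    using abs_le_one_plus_sq assms(3) by (intro mult_left_mono) auto
  ultimately show "\<bar>f x\<bar> \<le> (\<bar>a\<bar> + b) * (1 + x\<^sup>2)"
    using assms(2)[of x] by (simp add: distrib_right)
qed fact

lemma quad_bdd_simps [intro!, simp]:
  "quad_bdd (\<lambda>x. x)" "quad_bdd abs" "quad_bdd (\<lambda>x. x\<^sup>2)"
  by (rule quad_bdd_linear[where a=0 and b=1], simp_all)
     (rule quad_bdd_linear[where a=0 and b=1], simp_all,
      rule quad_bddI[where c=1], simp_all)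

lemma quad_bdd_uminus [intro!]: "quad_bdd f \<Longrightarrow> quad_bdd (\<lambda>x. - f x)"
  using quad_bdd_cmult[of f "-1"] by simp

lemma quad_bdd_diff [intro!]: "quad_bdd f \<Longrightarrow> quad_bdd g \<Longrightarrow> quad_bdd (\<lambda>x. f x - g x)"
  using quad_bdd_add[of f "\<lambda>x. - g x"] by auto

lemma quad_bdd_sum [intro!]: "(\<And>i. i \<in> I \<Longrightarrow> quad_bdd (f i)) \<Longrightarrow> quad_bdd (\<lambda>x. \<Sum>i\<in>I. f i x)"
  by (induction I rule: infinite_finite_induct) auto

text \<open>The data are the law of one increment. The starting point stays a free argument of the
  operators, so that inductions on time can generalise over it.\<close>

locale centred_walk = prob_space \<mu> for \<mu> :: "real measure" +
  fixes \<sigma> :: real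
  assumes sets_mu [measurable_cong]: "sets \<mu> = sets borel"
    and sq_int: "integrable \<mu> (\<lambda>y. y\<^sup>2)"
    and mean_zero: "(\<integral>y. y \<partial>\<mu>) = 0"
    and second_moment: "(\<integral>y. y\<^sup>2 \<partial>\<mu>) = \<sigma>\<^sup>2"
    and sigma_pos: "\<sigma> > 0"
begin

lemma space_mu [simp]: "space \<mu> = UNIV"
  using sets_eq_imp_space_eq[OF sets_mu] by simp

lemma int_y [simp]: "integrable \<mu> (\<lambda>y. y)"
  by (rule square_integrable_imp_integrable[OF _ sq_int]) measurable

lemma quad_bdd_integrable: assumes "quad_bdd f" shows "integrable \<mu> (\<lambda>y. f (x + y))"
proof -
  obtain c where c: "c \<ge> 0" "\<And>x. \<bar>f x\<bar> \<le> c * (1 + x\<^sup>2)" using assms quad_bddE by blast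
  have [measurable]: "f \<in> borel_measurable borel" using assms by (simp add: quad_bdd_def)
  show ?thesis
  proof (rule Bochner_Integration.integrable_bound)
    show "integrable \<mu> (\<lambda>y. c * (1 + (2 * x\<^sup>2 + 2 * y\<^sup>2)))"
      using sq_int by auto
    have "(x + y)\<^sup>2 \<le> 2 * x\<^sup>2 + 2 * y\<^sup>2" for y
      using sum_squares_ge_zero[of "x - y" 0] by (simp add: power2_eq_square algebra_simps)
    hence "norm (f (x + y)) \<le> norm (c * (1 + (2 * x\<^sup>2 + 2 * y\<^sup>2)))" for y
      using order_trans[OF c(2)[of "x+y"] mult_left_mono[OF _ c(1)]] c(1) by (simp add: abs_mult)
    thus "AE y in \<mu>. norm (f (x + y)) \<le> norm (c * (1 + (2 * x\<^sup>2 + 2 * y\<^sup>2)))" by simp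
  qed measurable
qed

definition step_op :: "real set \<Rightarrow> (real \<Rightarrow> real) \<Rightarrow> real \<Rightarrow> real" where
  "step_op A f x = indicator A x * (\<integral>y. f (x + y) \<partial>\<mu>)"

text \<open>\<open>killed A n f x\<close> is \<open>\<E>\<^sub>x (f S\<^sub>n; S\<^sub>0, \<dots>, S\<^sub>n \<in> A)\<close>.\<close>

definition killed :: "real set \<Rightarrow> nat \<Rightarrow> (real \<Rightarrow> real) \<Rightarrow> real \<Rightarrow> real" where
  "killed A n f = (step_op A ^^ n) (\<lambda>x. indicator A x * f x)"

lemma killed_0: "killed A 0 f x = indicator A x * f x"
  by (simp add: killed_def)

lemma killed_Suc: "killed A (Suc n) f = step_op A (killed A n f)"
  by (simp add: killed_def)

lemma killed_outside: "x \<notin> A \<Longrightarrow> killed A n f x = 0"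
  by (cases n) (simp_all add: killed_0 killed_Suc step_op_def)

lemma killed_supp: "indicator A x * killed A n f x = killed A n f x"
  by (cases "x \<in> A") (simp_all add: killed_outside)

text \<open>The Markov property at time \<open>m\<close>. The position at that time is tested twice,
  once by each factor, which is harmless because \<open>killed A n f\<close> already vanishes off
  \<open>A\<close>.\<close>

lemma killed_add: "killed A (m + n) f = killed A m (killed A n f)"
proof -
  have "killed A (m + n) f = (step_op A ^^ m) (killed A n f)"
    by (simp add: killed_def funpow_add)
  thus ?thesis by (simp add: killed_def[of A m] killed_supp)
qed

lemma quad_bdd_step_op [intro]:
  assumes f: "quad_bdd f" and [measurable]: "A \<in> sets borel" shows "quad_bdd (step_op A f)"
proof -
  obtain c where c: "c \<ge> 0" "\<And>x. \<bar>f x\<bar> \<le> c * (1 + x\<^sup>2)" using assms quad_bddE by blast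
  have [measurable]: "f \<in> borel_measurable borel" using f by (simp add: quad_bdd_def)
  have "\<bar>\<integral>y. f (x + y) \<partial>\<mu>\<bar> \<le> (c * (1 + \<sigma>\<^sup>2)) * (1 + x\<^sup>2)" for x
  proof -
    have "\<bar>\<integral>y. f (x + y) \<partial>\<mu>\<bar> \<le> (\<integral>y. \<bar>f (x + y)\<bar> \<partial>\<mu>)" by (rule integral_abs_bound)
    also have "\<dots> \<le> (\<integral>y. c * (1 + x\<^sup>2 + 2 * x * y + y\<^sup>2) \<partial>\<mu>)"
    proof (rule integral_mono)
      show "integrable \<mu> (\<lambda>y. \<bar>f (x + y)\<bar>)"
        using quad_bdd_integrable[OF f] by simp
      show "integrable \<mu> (\<lambda>y. c * (1 + x\<^sup>2 + 2 * x * y + y\<^sup>2))"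
        using sq_int by simp
      show "\<bar>f (x + y)\<bar> \<le> c * (1 + x\<^sup>2 + 2 * x * y + y\<^sup>2)" for y
        using c(2)[of "x + y"] by (simp add: power2_sum algebra_simps)
    qed
    also have "\<dots> = c * (1 + x\<^sup>2 + \<sigma>\<^sup>2)"
      using sq_int prob_space by (simp add: mean_zero second_moment)
    also have "\<dots> \<le> c * ((1 + \<sigma>\<^sup>2) * (1 + x\<^sup>2))"
      using c(1) by (intro mult_left_mono) (auto simp: algebra_simps)
    finally show ?thesis by (simp add: mult.assoc)
  qed
  hence "quad_bdd (\<lambda>x. \<integral>y. f (x + y) \<partial>\<mu>)"
    by (intro quad_bddI) measurable
  thus ?thesis unfolding step_op_def by (rule quad_bdd_indicator) fact
qed

lemma quad_bdd_killed [intro]: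
  assumes "quad_bdd f" "A \<in> sets borel" shows "quad_bdd (killed A n f)"
proof (induction n)
  case 0 show ?case using assms by (simp add: killed_def quad_bdd_indicator)
next
  case (Suc n) thus ?case using assms by (auto simp: killed_Suc)
qed

lemma step_op_mono:
  assumes "quad_bdd f" "quad_bdd g" "\<And>y. f y \<le> g y"
  shows "step_op A f x \<le> step_op A g x"
  unfolding step_op_def using assms quad_bdd_integrable
  by (intro mult_left_mono integral_mono) auto

lemma killed_mono:
  assumes "quad_bdd f" "quad_bdd g" "A \<in> sets borel" "\<And>y. y \<in> A \<Longrightarrow> f y \<le> g y"
  shows "killed A n f x \<le> killed A n g x"
proof (induction n arbitrary: x)
  case 0 show ?case using assms(4) by (auto simp: killed_0 indicator_def)
next
  case (Suc n) thus ?case unfolding killed_Suc using assms by (intro step_op_mono) auto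
qed

lemma killed_cong:
  assumes "\<And>y. y \<in> A \<Longrightarrow> f y = g y" shows "killed A n f x = killed A n g x"
proof -
  have "(\<lambda>x. indicator A x * f x) = (\<lambda>x. indicator A x * g x)"
    using assms by (auto simp: indicator_def)
  thus ?thesis by (simp add: killed_def)
qed

lemma killed_zero [simp]: "killed A n (\<lambda>_. 0) x = 0"
proof (induction n arbitrary: x)
  case (Suc n)
  have "killed A n (\<lambda>_. 0) = (\<lambda>_. 0)" using Suc by auto
  thus ?case by (simp add: killed_Suc step_op_def)
qed (simp add: killed_0)

lemma killed_nonneg:
  assumes "quad_bdd f" "A \<in> sets borel" "\<And>y. y \<in> A \<Longrightarrow> 0 \<le> f y" shows "0 \<le> killed A n f x"
  using killed_mono[of "\<lambda>_. 0" f A n x] assms by simp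

lemma killed_lin:
  assumes "quad_bdd f" "quad_bdd g" "A \<in> sets borel"
  shows "killed A n (\<lambda>y. a * f y + b * g y) x = a * killed A n f x + b * killed A n g x"
proof (induction n arbitrary: x)
  case (Suc n)
  hence e: "killed A n (\<lambda>y. a * f y + b * g y) = (\<lambda>x. a * killed A n f x + b * killed A n g x)"
    by auto
  have "integrable \<mu> (\<lambda>y. killed A n f (x + y))" "integrable \<mu> (\<lambda>y. killed A n g (x + y))"
    using assms by (auto intro!: quad_bdd_integrable)
  thus ?case unfolding killed_Suc e step_op_def by (simp add: algebra_simps)
qed (simp add: killed_0 algebra_simps)

lemma killed_plus:
  assumes "quad_bdd f" "quad_bdd g" "A \<in> sets borel"
  shows "killed A n (\<lambda>y. f y + g y) x = killed A n f x + killed A n g x"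
  using killed_lin[OF assms, of n 1 1 x] by simp

lemma killed_minus:
  assumes "quad_bdd f" "quad_bdd g" "A \<in> sets borel"
  shows "killed A n (\<lambda>y. f y - g y) x = killed A n f x - killed A n g x"
  using killed_lin[OF assms, of n 1 "-1" x] by simp

lemma killed_cmult:
  assumes "quad_bdd f" "A \<in> sets borel"
  shows "killed A n (\<lambda>y. a * f y) x = a * killed A n f x"
  using killed_lin[OF assms(1,1,2), of n a 0 x] by simp

lemma killed_const:
  assumes "A \<in> sets borel"
  shows "killed A n (\<lambda>y. a) x = a * killed A n (\<lambda>_. 1) x"
  using killed_cmult[of "\<lambda>_. 1" A n a x] assms by simp

lemma killed_sum:
  assumes "\<And>i. i \<in> I \<Longrightarrow> quad_bdd (f i)" "A \<in> sets borel"
  shows "killed A n (\<lambda>y. \<Sum>i\<in>I. f i y) x = (\<Sum>i\<in>I. killed A n (f i) x)"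
  using assms(1)
proof (induction I rule: infinite_finite_induct)
  case (insert i I)
  thus ?case using assms(2) by (simp add: killed_plus quad_bdd_sum)
qed auto

lemma killed_abs:
  assumes "quad_bdd f" "quad_bdd g" "A \<in> sets borel" "\<And>y. y \<in> A \<Longrightarrow> \<bar>f y\<bar> \<le> g y"
  shows "\<bar>killed A n f x\<bar> \<le> killed A n g x"
proof -
  have le: "f y \<le> g y" "(-1) * f y \<le> g y" if "y \<in> A" for y using assms(4)[OF that] by auto
  have "killed A n f x \<le> killed A n g x" using assms(1-3) le(1) by (rule killed_mono)
  moreover have "killed A n (\<lambda>y. (-1) * f y) x \<le> killed A n g x"
    using quad_bdd_cmult[OF assms(1)] assms(2,3) le(2) by (rule killed_mono)
  ultimately show ?thesis using killed_cmult[of f A n "-1" x] assms by auto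
qed

lemma killed_set_mono:
  assumes "quad_bdd f" "A \<in> sets borel" "B \<in> sets borel" "A \<subseteq> B" "\<And>y. 0 \<le> f y"
  shows "killed A n f x \<le> killed B n f x"
proof (induction n arbitrary: x)
  case 0 show ?case using assms(4,5) by (auto simp: killed_0 indicator_def)
next
  case (Suc n)
  have "step_op A (killed A n f) x \<le> step_op A (killed B n f) x"
    using quad_bdd_killed[OF assms(1,2)] quad_bdd_killed[OF assms(1,3)] Suc by (rule step_op_mono)
  also have "\<dots> \<le> step_op B (killed B n f) x"
    unfolding step_op_def
  proof (rule mult_right_mono)
    show "indicator A x \<le> (indicator B x :: real)" using assms(4) by (auto simp: indicator_def)
    have "0 \<le> killed B n f y" for y using killed_nonneg[OF assms(1,3)] assms(5) by blast
    thus "0 \<le> (\<integral>y. killed B n f (x + y) \<partial>\<mu>)" by simp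
  qed
  finally show ?case by (simp add: killed_Suc)
qed

lemma killed_1_le: "A \<in> sets borel \<Longrightarrow> killed A n (\<lambda>_. 1) x \<le> 1"
proof (induction n arbitrary: x)
  case (Suc n)
  have "step_op A (killed A n (\<lambda>_. 1)) x \<le> step_op A (\<lambda>_. 1) x"
    using quad_bdd_killed[OF quad_bdd_const Suc.prems] quad_bdd_const Suc.IH[OF Suc.prems]
    by (rule step_op_mono)
  also have "\<dots> \<le> 1" using prob_space by (simp add: step_op_def indicator_def)
  finally show ?case by (simp add: killed_Suc)
qed (simp add: killed_0 indicator_def)

lemma killed_1_Suc: assumes "A \<in> sets borel"
  shows "killed A (Suc n) (\<lambda>_. 1) x \<le> killed A n (\<lambda>_. 1) x"
proof -
  have "killed A (n + 1) (\<lambda>_. 1) x = killed A n (killed A 1 (\<lambda>_. 1)) x" by (simp only: killed_add)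
  also have "\<dots> \<le> killed A n (\<lambda>_. 1) x"
    using quad_bdd_killed[OF quad_bdd_const assms] quad_bdd_const assms killed_1_le[OF assms]
    by (rule killed_mono)
  finally show ?thesis by simp
qed

lemma killed_1_antimono: assumes "A \<in> sets borel" "m \<le> n"
  shows "killed A n (\<lambda>_. 1) x \<le> killed A m (\<lambda>_. 1) x"
  using assms(2)
proof (induction n rule: dec_induct)
  case (step n) thus ?case using killed_1_Suc[OF assms(1), of n x] by linarith
qed simp

lemma killed_one: "killed A (Suc 0) f x = indicator A x * (\<integral>y. indicator A (x + y) * f (x + y) \<partial>\<mu>)"
proof -
  have "killed A 0 f = (\<lambda>x. indicator A x * f x)" by (auto simp: killed_0)
  thus ?thesis using killed_Suc[of A 0 f] by (simp add: step_op_def)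
qed

lemma killed_one_le:
  assumes f: "quad_bdd f" "A \<in> sets borel" "\<And>y. 0 \<le> f y" and x: "x \<in> A"
  shows "killed A (Suc 0) f x \<le> (\<integral>y. f (x + y) \<partial>\<mu>)"
proof -
  have "(\<integral>y. indicator A (x + y) * f (x + y) \<partial>\<mu>) \<le> (\<integral>y. f (x + y) \<partial>\<mu>)"
    using quad_bdd_integrable[OF quad_bdd_indicator[OF f(1,2)]] quad_bdd_integrable[OF f(1)]
    by (rule integral_mono) (use f(3) in \<open>auto simp: indicator_def\<close>)
  thus ?thesis using x by (simp add: killed_one)
qed

end

section \<open>The path measure and its Markov property\<close>

abbreviation path_space :: "(nat \<Rightarrow> real) measure" where
  "path_space \<equiv> PiM UNIV (\<lambda>_::nat. borel)"

lemma measurable_path_pair [measurable]: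
  "(\<lambda>p. wpath (fst p) (snd p)) \<in> measurable (borel \<Otimes>\<^sub>M path_space) path_space"
  by (rule measurable_PiM_single') (auto simp: wpath_def)

lemma measurable_path' [measurable (raw)]:
  assumes [measurable]: "f \<in> measurable M borel" "g \<in> measurable M path_space"
  shows "(\<lambda>z. wpath (f z) (g z)) \<in> measurable M path_space"
  using measurable_compose[OF measurable_Pair[OF assms] measurable_path_pair] by simp

lemma measurable_path_component [measurable (raw)]:
  assumes [measurable]: "f \<in> measurable M borel" "g \<in> measurable M path_space"
  shows "(\<lambda>z. wpath (f z) (g z) n) \<in> measurable M borel"
proof -
  have "(\<lambda>z. wpath (f z) (g z)) \<in> measurable M path_space" by measurable
  thus ?thesis by (rule measurable_compose) (rule measurable_component_singleton, simp)
qed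

lemma measurable_shift: "(\<lambda>s k. s (n + k)) \<in> measurable path_space path_space"
  by (rule measurable_PiM_single') auto

lemma measurable_case_nat_pair [measurable]:
  "(\<lambda>(y, s). case_nat y s) \<in> measurable (borel \<Otimes>\<^sub>M path_space) path_space"
proof (rule measurable_PiM_single')
  fix i :: nat
  show "(\<lambda>p. (case p of (y, s) \<Rightarrow> case_nat y s) i) \<in> measurable (borel \<Otimes>\<^sub>M path_space) borel"
    by (cases i) (auto simp: split_beta')
qed auto

context centred_walk
begin

abbreviation "incr \<equiv> PiM UNIV (\<lambda>_::nat. \<mu>)"

lemma sets_incr [measurable_cong]: "sets incr = sets path_space"
  by (rule sets_PiM_cong) (auto simp: sets_mu)

lemma prob_space_incr: "prob_space incr"
  by (rule prob_space_PiM) (rule prob_space_axioms)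

lemma space_incr [simp]: "space incr = UNIV"
  by (simp add: space_PiM PiE_UNIV_domain)

text \<open>First-step analysis: putting one more independent increment in front of an i.i.d.
  sequence does not change its law.\<close>

lemma nn_integral_incr_step:
  assumes G [measurable]: "G \<in> borel_measurable path_space"
  shows "(\<integral>\<^sup>+s. G s \<partial>incr) = (\<integral>\<^sup>+y. (\<integral>\<^sup>+s. G (case_nat y s) \<partial>incr) \<partial>\<mu>)"
proof -
  interpret seq: sequence_space \<mu> by unfold_locales
  interpret I: prob_space incr by (rule prob_space_incr)
  have "(\<integral>\<^sup>+s. G s \<partial>incr) = (\<integral>\<^sup>+s. G s \<partial>distr (\<mu> \<Otimes>\<^sub>M incr) incr (\<lambda>(s, \<omega>). case_nat s \<omega>))"
    by (simp only: seq.PiM_iter)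
  also have "\<dots> = (\<integral>\<^sup>+p. G (case p of (s, \<omega>) \<Rightarrow> case_nat s \<omega>) \<partial>(\<mu> \<Otimes>\<^sub>M incr))"
    by (rule nn_integral_distr) measurable
  also have "\<dots> = (\<integral>\<^sup>+y. (\<integral>\<^sup>+s. G (case_nat y s) \<partial>incr) \<partial>\<mu>)"
    by (subst sigma_finite_measure.nn_integral_fst[OF prob_space_imp_sigma_finite[OF prob_space_incr], symmetric]) auto
  finally show ?thesis .
qed

text \<open>A copy of \<open>step_op\<close> and \<open>killed\<close> with values in
  \<open>[0, \<infinity>]\<close>: functionals of the whole path, such as the sum of the jumps, are
  not known to be integrable when the Markov property is applied to them.\<close>

definition nn_step :: "real set \<Rightarrow> (real \<Rightarrow> ennreal) \<Rightarrow> real \<Rightarrow> ennreal" where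
  "nn_step A f x = indicator A x * (\<integral>\<^sup>+y. f (x + y) \<partial>\<mu>)"

definition nn_killed :: "real set \<Rightarrow> nat \<Rightarrow> (real \<Rightarrow> ennreal) \<Rightarrow> real \<Rightarrow> ennreal" where
  "nn_killed A n f = (nn_step A ^^ n) (\<lambda>x. indicator A x * f x)"

lemma nn_killed_0: "nn_killed A 0 f x = indicator A x * f x"
  by (simp add: nn_killed_def)

lemma nn_killed_Suc: "nn_killed A (Suc n) f = nn_step A (nn_killed A n f)"
  by (simp add: nn_killed_def)

lemma nn_killed_mono: "(\<And>y. y \<in> A \<Longrightarrow> f y \<le> g y) \<Longrightarrow> nn_killed A n f x \<le> nn_killed A n g x"
proof (induction n arbitrary: x)
  case (Suc n)
  thus ?case unfolding nn_killed_Suc nn_step_def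
    by (intro mult_left_mono nn_integral_mono) auto
qed (auto simp: nn_killed_0 indicator_def)

lemma nn_killed_eq_ennreal:
  assumes f: "quad_bdd f" and A: "A \<in> sets borel" and nn: "\<And>y. y \<in> A \<Longrightarrow> 0 \<le> f y"
  shows "nn_killed A n (\<lambda>y. ennreal (f y)) x = ennreal (killed A n f x)"
proof (induction n arbitrary: x)
  case 0 show ?case using nn by (auto simp: nn_killed_0 killed_0 indicator_def)
next
  case (Suc n)
  hence e: "nn_killed A n (\<lambda>y. ennreal (f y)) = (\<lambda>x. ennreal (killed A n f x))" by auto
  have "(\<integral>\<^sup>+y. ennreal (killed A n f (x + y)) \<partial>\<mu>) = ennreal (\<integral>y. killed A n f (x + y) \<partial>\<mu>)"
    using killed_nonneg[OF f A nn] quad_bdd_integrable[OF quad_bdd_killed[OF f A]]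
    by (intro nn_integral_eq_integral) simp_all
  thus ?case unfolding nn_killed_Suc e killed_Suc
    by (simp add: nn_step_def step_op_def indicator_def)
qed

text \<open>The Markov property at time \<open>n\<close>, where \<open>\<Psi>\<close> may depend on
  the entire path from that time on. It is the bridge by which path functionals are estimated
  through operators.\<close>

lemma nn_integral_killed_path:
  assumes \<Psi> [measurable]: "\<Psi> \<in> borel_measurable path_space" and [measurable]: "A \<in> sets borel"
  shows "(\<integral>\<^sup>+s. (if \<forall>k\<le>n. wpath x s k \<in> A then \<Psi> (\<lambda>k. wpath x s (n + k)) else 0) \<partial>incr)
    = nn_killed A n (\<lambda>y. \<integral>\<^sup>+s. \<Psi> (wpath y s) \<partial>incr) x"
proof (induction n arbitrary: x)
  case 0
  have all0: "(\<forall>k\<le>0. wpath x s k \<in> A) \<longleftrightarrow> x \<in> A" for s by auto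
  show ?case unfolding all0 by (cases "x \<in> A") (simp_all add: nn_killed_0)
next
  case (Suc n)
  define G where "G x n s = (if \<forall>k\<le>n. wpath x s k \<in> A then \<Psi> (\<lambda>k. wpath x s (n + k)) else 0)" for x n s
  have [measurable]: "G x n \<in> borel_measurable path_space" for x n
  proof -
    have [measurable]: "(\<lambda>s k. wpath x s (n + k)) \<in> measurable path_space path_space"
      using measurable_compose[OF _ measurable_shift, of "wpath x" path_space n] by measurable
    show ?thesis unfolding G_def by measurable
  qed
  have all: "(\<forall>k\<le>Suc n. case_nat x p k \<in> A) \<longleftrightarrow> x \<in> A \<and> (\<forall>k\<le>n. p k \<in> A)" for p :: "nat \<Rightarrow> real"
    by (auto simp: less_Suc_eq_le[symmetric] split: nat.split)
  have G: "G x (Suc n) (case_nat y s) = indicator A x * G (x + y) n s" for y s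
    unfolding G_def wpath_case_nat all by (auto simp: indicator_def)
  have "(\<integral>\<^sup>+s. G x (Suc n) s \<partial>incr) = (\<integral>\<^sup>+y. (\<integral>\<^sup>+s. indicator A x * G (x + y) n s \<partial>incr) \<partial>\<mu>)"
    by (subst nn_integral_incr_step) (simp_all add: G)
  also have "\<dots> = indicator A x * (\<integral>\<^sup>+y. (\<integral>\<^sup>+s. G (x + y) n s \<partial>incr) \<partial>\<mu>)"
    by (cases "x \<in> A") simp_all
  also have "\<dots> = nn_killed A (Suc n) (\<lambda>y. \<integral>\<^sup>+s. \<Psi> (wpath y s) \<partial>incr) x"
    unfolding nn_killed_Suc nn_step_def using Suc by (simp add: G_def)
  finally show ?case by (simp add: G_def)
qed

lemma nn_integral_path_quad:
  assumes f: "quad_bdd f" and A [measurable]: "A \<in> sets borel" and nn: "\<And>y. y \<in> A \<Longrightarrow> 0 \<le> f y"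
  shows "(\<integral>\<^sup>+s. (if \<forall>k\<le>n. wpath x s k \<in> A then ennreal (f (wpath x s n)) else 0) \<partial>incr)
    = ennreal (killed A n f x)"
proof -
  note emeasure_incr = prob_space.emeasure_space_1[OF prob_space_incr, simplified]
  have [measurable]: "f \<in> borel_measurable borel" using f by (rule quad_bdd_measurable)
  have m: "(\<lambda>s. ennreal (f (s 0))) \<in> borel_measurable path_space" by measurable
  have c: "(\<integral>\<^sup>+s. ennreal (f (wpath y s 0)) \<partial>incr) = ennreal (f y)" for y
    using emeasure_incr by simp
  show ?thesis
    using nn_integral_killed_path[OF m A, of n x] nn_killed_eq_ennreal[OF f A nn, of n x]
    unfolding c add_0_right by simp
qed

lemma prob_path_killed:
  assumes A [measurable]: "A \<in> sets borel"
  shows "measure incr {s. \<forall>k\<le>n. wpath x s k \<in> A} = killed A n (\<lambda>_. 1) x"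
proof -
  note emeasure_incr = prob_space.emeasure_space_1[OF prob_space_incr, simplified]
  have [measurable]: "{s. \<forall>k\<le>n. wpath x s k \<in> A} \<in> sets incr"
  proof -
    have "{s \<in> space path_space. \<forall>k\<le>n. wpath x s k \<in> A} \<in> sets path_space" by measurable
    thus ?thesis by (simp add: sets_incr space_PiM PiE_UNIV_domain)
  qed
  have "emeasure incr {s. \<forall>k\<le>n. wpath x s k \<in> A}
    = (\<integral>\<^sup>+s. indicator {s. \<forall>k\<le>n. wpath x s k \<in> A} s \<partial>incr)" by simp
  also have "\<dots> = (\<integral>\<^sup>+s. (if \<forall>k\<le>n. wpath x s k \<in> A then ennreal 1 else 0) \<partial>incr)"
    by (intro nn_integral_cong) (auto simp: indicator_def)
  also have "\<dots> = ennreal (killed A n (\<lambda>_. 1) x)"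
    by (rule nn_integral_path_quad) (auto simp: A)
  finally show ?thesis
    using killed_nonneg[of "\<lambda>_. 1" A n x] by (simp add: measure_def A)
qed

end

section \<open>A Lyapunov function\<close>

context centred_walk
begin

text \<open>Half of the mean of \<open>\<bar>X\<bar>\<close>. It provides the spacing of the kinks
  of the Lyapunov function and later a lower bound for \<open>V\<close>.\<close>

definition mean_pos :: real where "mean_pos = (\<integral>y. max 0 y \<partial>\<mu>)"

definition excess :: "real \<Rightarrow> real" where "excess r = (\<integral>y. max 0 (\<bar>y\<bar> - r) \<partial>\<mu>)"

lemma integrable_max_0 [simp]:
  "integrable \<mu> f \<Longrightarrow> integrable \<mu> (\<lambda>y. max 0 (f y :: real))"
  by (rule Bochner_Integration.integrable_max) auto

lemma mean_pos_eq_neg: "(\<integral>y. max 0 (- y) \<partial>\<mu>) = mean_pos"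
proof -
  have "(\<integral>y. max 0 y - max 0 (- y) \<partial>\<mu>) = (\<integral>y. y \<partial>\<mu>)"
    by (rule Bochner_Integration.integral_cong) auto
  thus ?thesis by (simp add: mean_zero mean_pos_def)
qed

text \<open>Centring makes the two one-sided means equal; if they vanished, the increment would be
  \<open>0\<close> almost surely, against \<open>\<sigma> > 0\<close>.\<close>

lemma mean_pos_pos: "mean_pos > 0"
proof (rule ccontr)
  assume "\<not> mean_pos > 0"
  moreover have "mean_pos \<ge> 0" unfolding mean_pos_def by (rule Bochner_Integration.integral_nonneg) auto
  ultimately have m0: "mean_pos = 0" by linarith
  have z: "(\<integral>y. max 0 y \<partial>\<mu>) = 0" "(\<integral>y. max 0 (- y) \<partial>\<mu>) = 0"
    using mean_pos_eq_neg m0 mean_pos_def by metis+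
  have "AE y in \<mu>. max 0 y = 0"
    using z(1) by (subst (asm) integral_nonneg_eq_0_iff_AE) auto
  moreover have "AE y in \<mu>. max 0 (- y) = 0"
    using z(2) by (subst (asm) integral_nonneg_eq_0_iff_AE) auto
  ultimately have "AE y in \<mu>. y\<^sup>2 = 0" by eventually_elim (auto simp: max_def split: if_splits)
  hence "(\<integral>y. y\<^sup>2 \<partial>\<mu>) = 0" by (subst integral_cong_AE[where g="\<lambda>_. 0"]) auto
  thus False using second_moment sigma_pos by simp
qed

text \<open>This is the mean loss caused by a concave kink that lies within
  \<open>a = mean_pos / 2\<close> of the current position, on the side of zero. It follows from
  \<open>max 0 (u - a) \<ge> max 0 u - a\<close>.\<close>

lemma mean_excess_ge:
  assumes "e = 1 \<or> e = -1"
  shows "mean_pos / 2 \<le> (\<integral>y. max 0 (- (mean_pos / 2) - e * y) \<partial>\<mu>)"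
proof -
  have "(\<integral>y. max 0 (- (e * y)) - mean_pos / 2 \<partial>\<mu>) \<le> (\<integral>y. max 0 (- (mean_pos / 2) - e * y) \<partial>\<mu>)"
  proof (rule integral_mono)
    show "max 0 (- (e * y)) - mean_pos / 2 \<le> max 0 (- (mean_pos / 2) - e * y)" for y
      using mean_pos_pos by (auto simp: max_def)
  qed auto
  moreover have "(\<integral>y. max 0 (- (e * y)) - mean_pos / 2 \<partial>\<mu>) = (\<integral>y. max 0 (- (e * y)) \<partial>\<mu>) - mean_pos / 2"
    using prob_space by simp
  moreover have "(\<integral>y. max 0 (- (e * y)) \<partial>\<mu>) = mean_pos"
    using assms mean_pos_eq_neg by (auto simp: mean_pos_def)
  ultimately show ?thesis by simp
qed

lemma excess_nonneg: "excess r \<ge> 0"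
  unfolding excess_def by (rule Bochner_Integration.integral_nonneg) auto

lemma excess_antimono: "r \<le> s \<Longrightarrow> excess s \<le> excess r"
  unfolding excess_def by (rule integral_mono) (auto intro: integrable_diff)

lemma excess_measurable [measurable]: "excess \<in> borel_measurable borel"
  unfolding excess_def[abs_def] by measurable

lemma quad_bdd_excess: "quad_bdd (\<lambda>x. excess \<bar>x\<bar>)"
proof (rule quad_bdd_bounded)
  show "\<bar>excess \<bar>x\<bar>\<bar> \<le> excess 0" for x
    using excess_nonneg[of "\<bar>x\<bar>"] excess_antimono[of 0 "\<bar>x\<bar>"] by simp
qed measurable

text \<open>Only indices with \<open>j * a < u\<close> contribute, at most \<open>u / a + 1\<close>
  of them, and each contributes at most \<open>u\<close>.\<close>

lemma sum_excess_le:
  fixes a u :: real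
  assumes "a > 0" "u \<ge> 0"
  shows "(\<Sum>j<n. max 0 (u - real j * a)) \<le> u * (u / a + 1)"
proof -
  define K where "K = nat \<lceil>u / a\<rceil>"
  have z: "max 0 (u - real j * a) = 0" if "j \<notin> {..<K}" for j
  proof -
    have "u / a \<le> real K" unfolding K_def by linarith
    also have "\<dots> \<le> real j" using that by simp
    finally show ?thesis using assms by (simp add: field_simps)
  qed
  have "(\<Sum>j<n. max 0 (u - real j * a)) \<le> (\<Sum>j\<in>{..<n} \<inter> {..<K}. u)"
  proof -
    have "(\<Sum>j<n. max 0 (u - real j * a)) = (\<Sum>j\<in>{..<n} \<inter> {..<K}. max 0 (u - real j * a))"
      using z by (intro sum.mono_neutral_right) auto
    also have "\<dots> \<le> (\<Sum>j\<in>{..<n} \<inter> {..<K}. u)" using assms by (intro sum_mono) auto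
    finally show ?thesis .
  qed
  also have "\<dots> \<le> real K * u"
    using card_mono[of "{..<K}" "{..<n} \<inter> {..<K}"] assms by (auto intro!: mult_right_mono)
  also have "real K \<le> u / a + 1"
    using assms unfolding K_def by (simp add: of_nat_nat)
  hence "real K * u \<le> u * (u / a + 1)" using assms by (simp add: mult_left_mono mult.commute)
  finally show ?thesis .
qed

text \<open>Exchanging sum and expectation leaves a quadratic function of
  \<open>\<bar>y\<bar>\<close>. This is where the finite variance enters the Lyapunov function; the
  continuous analogue is that \<open>excess\<close> integrates over \<open>[0, \<infinity>)\<close>
  to half the second moment.\<close>

lemma summable_excess: assumes "a > 0" shows "summable (\<lambda>j. excess (real j * a))"
proof (rule summableI_nonneg_bounded[OF excess_nonneg])
  fix n
  have i: "integrable \<mu> (\<lambda>y. \<bar>y\<bar> * (\<bar>y\<bar> / a + 1))"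
  proof -
    have e: "\<bar>y\<bar> * (\<bar>y\<bar> / a + 1) = y\<^sup>2 / a + \<bar>y\<bar>" for y :: real
      by (simp add: distrib_left flip: power2_eq_square)
    show ?thesis unfolding e using sq_int by simp
  qed
  have "(\<Sum>j<n. excess (real j * a)) = (\<integral>y. (\<Sum>j<n. max 0 (\<bar>y\<bar> - real j * a)) \<partial>\<mu>)"
    unfolding excess_def by (rule Bochner_Integration.integral_sum[symmetric]) auto
  also have "\<dots> \<le> (\<integral>y. \<bar>y\<bar> * (\<bar>y\<bar> / a + 1) \<partial>\<mu>)"
    using sum_excess_le[OF assms] i by (intro integral_mono Bochner_Integration.integrable_sum) auto
  finally show "(\<Sum>j<n. excess (real j * a)) \<le> (\<integral>y. \<bar>y\<bar> * (\<bar>y\<bar> / a + 1) \<partial>\<mu>)" .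
qed

text \<open>
  A mixture of the concave functions \<open>min \<bar>x\<bar> (j a)\<close>: a kink at distance at most \<open>a\<close> below
  \<open>\<bar>x\<bar>\<close> with weight proportional to \<open>excess\<close> produces the drift \<open>- excess \<bar>x\<bar>\<close>, and removing
  the first kinks makes the total weight, hence the loss at a sign change, small.
\<close>

lemma lyapunov:
  obtains F R b where "R > 0" "b \<ge> 0" "quad_bdd F" "\<And>x. 0 \<le> F x" "\<And>x. F x \<le> \<bar>x\<bar>"
    "\<And>\<epsilon>. \<epsilon> > 0 \<Longrightarrow> \<exists>C\<ge>0. \<forall>x. F x \<le> \<epsilon> * \<bar>x\<bar> + C"
    "\<And>x. (\<integral>y. F (x + y) \<partial>\<mu>) \<le> F x - excess \<bar>x\<bar> + b * indicator {-R..R} x"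
proof -
  define a where "a = mean_pos / 2"
  have a: "a > 0" using mean_pos_pos by (simp add: a_def)
  \<comment> \<open>A tail below \<open>a / 4\<close> makes the total weight \<open>r\<close> at
    most \<open>1 / 2\<close>, so that the upward drift \<open>2 * r * excess \<bar>x\<bar>\<close>
    due to sign changes is at most \<open>excess \<bar>x\<bar>\<close>.\<close>
  obtain J where J: "\<bar>\<Sum>j. excess (real (j + J) * a)\<bar> < a / 4"
  proof -
    have "(\<lambda>J. \<Sum>j. excess (real (j + J) * a)) \<longlonglongrightarrow> 0"
      using suminf_exist_split2[OF summable_excess[OF a]] by simp
    hence "\<forall>\<^sub>F J in sequentially. dist (\<Sum>j. excess (real (j + J) * a)) 0 < a / 4"
      by (rule tendstoD) (use a in simp)
    thus ?thesis using that by (auto simp: eventually_sequentially)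
  qed
  \<comment> \<open>The factor \<open>2 / a\<close> is matched to \<open>mean_excess_ge\<close>: for
    \<open>i \<ge> J\<close> the kink just below \<open>\<bar>x\<bar>\<close> lowers the mean by at
    least \<open>\<rho> i * a \<ge> 2 * excess \<bar>x\<bar>\<close>, which pays for the sign
    changes and leaves \<open>excess \<bar>x\<bar>\<close>.\<close>
  define \<rho> where "\<rho> j = (if j < J then 0 else 2 / a * excess (real j * a))" for j
  have rho0: "\<rho> j \<ge> 0" for j using a excess_nonneg by (simp add: \<rho>_def)
  have sJ: "summable (\<lambda>j. excess (real (j + J) * a))"
    using summable_ignore_initial_segment[OF summable_excess[OF a], of J] .
  have s\<rho>: "(\<lambda>j. \<rho> (j + J)) = (\<lambda>j. 2 / a * excess (real (j + J) * a))" by (auto simp: \<rho>_def)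
  have sumrho: "summable \<rho>"
    using summable_mult[OF sJ, of "2 / a"] unfolding s\<rho>[symmetric] by (simp add: summable_iff_shift)
  define r where "r = suminf \<rho>"
  have r0: "r \<ge> 0" unfolding r_def using sumrho rho0 by (rule suminf_nonneg)
  have "r = (\<Sum>j. \<rho> (j + J)) + (\<Sum>j<J. \<rho> j)"
    unfolding r_def by (rule suminf_split_initial_segment[OF sumrho])
  also have "\<dots> = 2 / a * (\<Sum>j. excess (real (j + J) * a))"
    unfolding s\<rho> using suminf_mult[OF sJ, of "2 / a"] by (simp add: \<rho>_def)
  also have "\<dots> \<le> 2 / a * (a / 4)" using J a by (intro mult_left_mono) auto
  finally have r: "r \<le> 1 / 2" using a by simp
  define t where "t j x = \<rho> j * min \<bar>x\<bar> (real j * a)" for j and x :: real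
  have t0: "t j x \<ge> 0" for j x unfolding t_def using rho0 a by simp
  have tle: "t j x \<le> \<rho> j * \<bar>x\<bar>" for j x unfolding t_def using rho0 by (intro mult_left_mono) auto
  have st: "summable (\<lambda>j. t j x)" for x
    by (rule summable_comparison_test'[OF summable_mult2[OF sumrho, of "\<bar>x\<bar>"], of 0]) (use t0 tle in auto)
  define F where "F x = (\<Sum>j. t j x)" for x
  have tF: "(\<lambda>j. t j x) sums F x" for x unfolding F_def using st by (rule summable_sums)
  have F0: "F x \<ge> 0" for x unfolding F_def using st t0 by (rule suminf_nonneg)
  have Fle: "F x \<le> r * \<bar>x\<bar>" for x
    unfolding F_def r_def suminf_mult2[OF sumrho] using tle st summable_mult2[OF sumrho] by (rule suminf_le)
  have Fle1: "F x \<le> \<bar>x\<bar>" for x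
    using order_trans[OF Fle[of x] mult_right_mono[of r 1 "\<bar>x\<bar>"]] r by simp
  have [measurable]: "F \<in> borel_measurable borel"
    unfolding F_def[abs_def] t_def by measurable
  have qF: "quad_bdd F"
    by (rule quad_bdd_linear[where a=0 and b=1]) (use F0 Fle1 in auto)
  \<comment> \<open>The first \<open>K\<close> components are bounded functions, and the remaining
    ones have total slope below \<open>\<epsilon>\<close>.\<close>
  have small: "\<exists>C\<ge>0. \<forall>x. F x \<le> \<epsilon> * \<bar>x\<bar> + C" if "\<epsilon> > 0" for \<epsilon>
  proof -
    have "(\<lambda>K. \<Sum>j. \<rho> (j + K)) \<longlonglongrightarrow> 0" using suminf_exist_split2[OF sumrho] by simp
    hence "\<forall>\<^sub>F K in sequentially. dist (\<Sum>j. \<rho> (j + K)) 0 < \<epsilon>" by (rule tendstoD) fact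
    then obtain K where K: "\<bar>\<Sum>j. \<rho> (j + K)\<bar> < \<epsilon>" by (auto simp: eventually_sequentially)
    have sK: "summable (\<lambda>j. \<rho> (j + K))" using sumrho by (simp add: summable_iff_shift)
    have "F x \<le> \<epsilon> * \<bar>x\<bar> + (\<Sum>j<K. \<rho> j * (real j * a))" for x
    proof -
      have "F x = (\<Sum>j. t (j + K) x) + (\<Sum>j<K. t j x)"
        unfolding F_def by (rule suminf_split_initial_segment[OF st])
      also have "(\<Sum>j. t (j + K) x) \<le> (\<Sum>j. \<rho> (j + K) * \<bar>x\<bar>)"
        by (intro suminf_le tle summable_mult2[OF sK]) (rule summable_ignore_initial_segment[OF st])
      also have "\<dots> = (\<Sum>j. \<rho> (j + K)) * \<bar>x\<bar>" using suminf_mult2[OF sK] by simp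
      also have "\<dots> \<le> \<epsilon> * \<bar>x\<bar>" using K by (intro mult_right_mono) auto
      also have "(\<Sum>j<K. t j x) \<le> (\<Sum>j<K. \<rho> j * (real j * a))"
        unfolding t_def using rho0 by (intro sum_mono mult_left_mono) auto
      finally show ?thesis by simp
    qed
    moreover have "0 \<le> (\<Sum>j<K. \<rho> j * (real j * a))" using rho0 a by (intro sum_nonneg) auto
    ultimately show ?thesis by blast
  qed
  \<comment> \<open>Each component stays below its tangent at \<open>x\<close>, up to
    \<open>2 * max 0 (\<bar>y\<bar> - \<bar>x\<bar>)\<close> for steps across zero. The component
    with its kink in \<open>[\<bar>x\<bar> - a, \<bar>x\<bar>]\<close> has the loss in the last term
    in addition. The tangent term is linear in \<open>y\<close> and averages to zero.\<close>
  have pointwise: "F (x + y) \<le> F x + (\<Sum>j. \<rho> j * (if \<bar>x\<bar> < real j * a then 1 else 0)) * (e * y)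
      + r * (2 * max 0 (\<bar>y\<bar> - \<bar>x\<bar>)) - \<rho> i * max 0 (- a - e * y)"
    if e: "e = 1 \<or> e = -1" "x = e * \<bar>x\<bar>" and i: "real i * a \<le> \<bar>x\<bar>" "\<bar>x\<bar> \<le> (real i + 1) * a" for x y e i
  proof -
    define \<theta> where "\<theta> j = (if \<bar>x\<bar> < real j * a then 1 else 0 :: real)" for j
    have s\<theta>: "summable (\<lambda>j. \<rho> j * \<theta> j)"
      by (rule summable_comparison_test'[OF sumrho, of 0]) (use rho0 in \<open>auto simp: \<theta>_def\<close>)
    have ab: "\<bar>x + y\<bar> = \<bar>\<bar>x\<bar> + e * y\<bar>" using e by (auto simp: abs_if split: if_splits)
    have ey: "\<bar>e * y\<bar> = \<bar>y\<bar>" using e(1) by auto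
    have le: "min \<bar>x + y\<bar> s \<le> min \<bar>x\<bar> s + (if \<bar>x\<bar> < s then 1 else 0) * (e * y) + 2 * max 0 (\<bar>y\<bar> - \<bar>x\<bar>)"
      for s using ey unfolding ab by (auto simp: min_def max_def abs_if split: if_splits)
    have le_i: "min \<bar>x + y\<bar> s \<le> min \<bar>x\<bar> s + 2 * max 0 (\<bar>y\<bar> - \<bar>x\<bar>) - max 0 (- a - e * y)"
      if "s \<le> \<bar>x\<bar>" "\<bar>x\<bar> \<le> s + a" for s
      using ey that a unfolding ab by (auto simp: min_def max_def abs_if split: if_splits)
    have "F (x + y) \<le> F x + (\<Sum>j. \<rho> j * \<theta> j) * (e * y) + r * (2 * max 0 (\<bar>y\<bar> - \<bar>x\<bar>)) - \<rho> i * max 0 (- a - e * y)"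
    proof (rule sums_le[OF _ tF])
      show "(\<lambda>j. t j x + \<rho> j * \<theta> j * (e * y) + \<rho> j * (2 * max 0 (\<bar>y\<bar> - \<bar>x\<bar>))
          - (if j = i then \<rho> j * max 0 (- a - e * y) else 0))
        sums (F x + (\<Sum>j. \<rho> j * \<theta> j) * (e * y) + r * (2 * max 0 (\<bar>y\<bar> - \<bar>x\<bar>)) - \<rho> i * max 0 (- a - e * y))"
        unfolding r_def
        by (intro sums_diff sums_add tF sums_mult2 summable_sums s\<theta> sumrho sums_single)
      show "t j (x + y) \<le> t j x + \<rho> j * \<theta> j * (e * y) + \<rho> j * (2 * max 0 (\<bar>y\<bar> - \<bar>x\<bar>))
          - (if j = i then \<rho> j * max 0 (- a - e * y) else 0)" for j
      proof (cases "j = i")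
        case True
        have "\<theta> j = 0" using i True by (simp add: \<theta>_def)
        moreover have "t j (x + y) \<le> \<rho> j * (min \<bar>x\<bar> (real j * a) + 2 * max 0 (\<bar>y\<bar> - \<bar>x\<bar>) - max 0 (- a - e * y))"
          unfolding t_def using i rho0 True by (intro mult_left_mono le_i) (auto simp: algebra_simps)
        ultimately show ?thesis using True by (simp add: t_def algebra_simps)
      next
        case False
        have "t j (x + y) \<le> \<rho> j * (min \<bar>x\<bar> (real j * a) + \<theta> j * (e * y) + 2 * max 0 (\<bar>y\<bar> - \<bar>x\<bar>))"
          unfolding t_def \<theta>_def using rho0 by (intro mult_left_mono le)
        thus ?thesis using False by (simp add: t_def algebra_simps)
      qed
    qed
    thus ?thesis by (simp add: \<theta>_def)
  qed
  have drift: "(\<integral>y. F (x + y) \<partial>\<mu>) \<le> F x - excess \<bar>x\<bar> + 2 * excess 0 * indicator {-(real J * a + 1)..real J * a + 1} x" for x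
  proof -
    define e :: real where "e = (if x \<ge> 0 then 1 else -1)"
    have e: "e = 1 \<or> e = -1" "x = e * \<bar>x\<bar>" by (auto simp: e_def)
    define i where "i = nat \<lfloor>\<bar>x\<bar> / a\<rfloor>"
    have i1: "real i \<le> \<bar>x\<bar> / a" "\<bar>x\<bar> / a \<le> real i + 1"
      using a unfolding i_def by (simp_all add: of_nat_nat)
    hence i: "real i * a \<le> \<bar>x\<bar>" "\<bar>x\<bar> \<le> (real i + 1) * a" using a by (simp_all add: field_simps)
    define c where "c = (\<Sum>j. \<rho> j * (if \<bar>x\<bar> < real j * a then 1 else 0))"
    have "(\<integral>y. F (x + y) \<partial>\<mu>) \<le> (\<integral>y. F x + c * (e * y) + r * (2 * max 0 (\<bar>y\<bar> - \<bar>x\<bar>)) - \<rho> i * max 0 (- a - e * y) \<partial>\<mu>)"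
      using pointwise[OF e i] quad_bdd_integrable[OF qF]
      by (intro integral_mono) (simp_all add: c_def)
    also have "\<dots> = F x + r * (2 * excess \<bar>x\<bar>) - \<rho> i * (\<integral>y. max 0 (- a - e * y) \<partial>\<mu>)"
      using prob_space by (simp add: mean_zero excess_def)
    also have "\<dots> \<le> F x + excess \<bar>x\<bar> - \<rho> i * a"
    proof -
      have "r * (2 * excess \<bar>x\<bar>) \<le> 1 / 2 * (2 * excess \<bar>x\<bar>)"
        using r excess_nonneg by (intro mult_right_mono) auto
      moreover have "\<rho> i * a \<le> \<rho> i * (\<integral>y. max 0 (- a - e * y) \<partial>\<mu>)"
        using mean_excess_ge[OF e(1)] rho0 unfolding a_def by (intro mult_left_mono)
      ultimately show ?thesis by simp
    qed
    also have "\<dots> \<le> F x - excess \<bar>x\<bar> + 2 * excess 0 * indicator {-(real J * a + 1)..real J * a + 1} x"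
    proof (cases "\<bar>x\<bar> \<le> real J * a + 1")
      case True
      have "0 \<le> \<rho> i * a" using rho0 a by simp
      thus ?thesis using True excess_antimono[of 0 "\<bar>x\<bar>"] by (simp add: indicator_def abs_le_iff)
    next
      case False
      have "real J * a < (real i + 1) * a" using False i(2) by linarith
      hence "J \<le> i" using a by (simp add: mult_less_cancel_right)
      hence "\<rho> i * a = 2 * excess (real i * a)" using a by (simp add: \<rho>_def)
      also have "\<dots> \<ge> 2 * excess \<bar>x\<bar>" using excess_antimono[OF i(1)] by simp
      finally show ?thesis using excess_nonneg[of 0] by (simp add: indicator_def)
    qed
    finally show ?thesis .
  qed
  have Rp: "real J * a + 1 > 0" using a by (simp add: add_nonneg_pos)
  show ?thesis
    by (rule that[OF Rp _ qF F0 Fle1 small drift]) (use excess_nonneg[of 0] in simp_all)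
qed

end

section \<open>Accessible points and the state space\<close>

lemma closed_int_multiples: "closed (int_multiples l)"
proof -
  have "int_multiples l = (*) l ` range of_int" by (auto simp: int_multiples_def)
  also have "closed \<dots>"
    using closed_scaling[OF closed_of_int_image[where A=UNIV and 'a=real], of l] by simp
  finally show ?thesis .
qed

text \<open>If there are arbitrarily small positive elements, their multiples are dense and
  closedness gives the whole line. Otherwise the least positive element exists, and division with
  remainder shows that it generates the group.\<close>

lemma closed_add_subgroup_real_cases:
  fixes G :: "real set"
  assumes cl: "closed G" and diff: "\<And>x y. x \<in> G \<Longrightarrow> y \<in> G \<Longrightarrow> x - y \<in> G" and a: "a \<in> G" "a > 0"
  shows "G = UNIV \<or> (\<exists>l>0. G = int_multiples l)"
proof -
  have z: "0 \<in> G" using diff[OF a(1) a(1)] by simp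
  have neg: "- x \<in> G" if "x \<in> G" for x using diff[OF z that] by simp
  have add: "x + y \<in> G" if "x \<in> G" "y \<in> G" for x y using diff[OF that(1) neg[OF that(2)]] by simp
  have nmult: "real n * x \<in> G" if "x \<in> G" for n x
    by (induction n) (use z that add in \<open>auto simp: distrib_right\<close>)
  have imult: "of_int k * x \<in> G" if "x \<in> G" for k x
    using nmult[OF that, of "nat k"] neg[OF nmult[OF that, of "nat (- k)"]] by (cases "k \<ge> 0") auto
  show ?thesis
  proof (cases "\<forall>\<epsilon>>0. \<exists>g\<in>G. 0 < g \<and> g < \<epsilon>")
    case True
    have "x \<in> G" for x
    proof -
      have "\<exists>y\<in>G. dist y x < \<epsilon>" if \<epsilon>: "\<epsilon> > 0" for \<epsilon>
      proof -
        obtain g where g: "g \<in> G" "0 < g" "g < \<epsilon>" using True \<epsilon> by blast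
        have "\<bar>of_int \<lfloor>x / g\<rfloor> * g - x\<bar> \<le> g"
        proof -
          have "of_int \<lfloor>x / g\<rfloor> * g \<le> x" "x < (of_int \<lfloor>x / g\<rfloor> + 1) * g"
            using g(2) by (rule floor_divide_lower, rule floor_divide_upper)
          thus ?thesis by (simp add: algebra_simps)
        qed
        thus ?thesis using imult[OF g(1)] g(3) by (intro bexI[of _ "of_int \<lfloor>x / g\<rfloor> * g"]) (auto simp: dist_real_def)
      qed
      hence "x \<in> closure G" by (auto simp: closure_approachable)
      thus ?thesis using cl by simp
    qed
    thus ?thesis by auto
  next
    case False
    then obtain \<epsilon> where \<epsilon>: "\<epsilon> > 0" "\<And>g. g \<in> G \<Longrightarrow> 0 < g \<Longrightarrow> \<epsilon> \<le> g" by (meson not_less)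
    define B where "B = G \<inter> {\<epsilon>..}"
    define l where "l = Inf B"
    have B: "closed B" "B \<noteq> {}" "bdd_below B"
      using cl a \<epsilon> by (auto simp: B_def intro!: closed_Int)
    have "l \<in> B" unfolding l_def using closed_contains_Inf[OF B(2,3,1)] .
    hence l: "l \<in> G" "l > 0" using \<epsilon>(1) by (auto simp: B_def)
    have lmin: "l \<le> g" if "g \<in> G" "g > 0" for g
      unfolding l_def using that \<epsilon> B(3) by (intro cInf_lower) (auto simp: B_def)
    have "g \<in> int_multiples l" if g: "g \<in> G" for g
    proof -
      define h where "h = g - of_int \<lfloor>g / l\<rfloor> * l"
      have hG: "h \<in> G" unfolding h_def by (intro diff g imult l)
      have "of_int \<lfloor>g / l\<rfloor> * l \<le> g" "g < (of_int \<lfloor>g / l\<rfloor> + 1) * l"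
        using l(2) by (rule floor_divide_lower, rule floor_divide_upper)
      hence "0 \<le> h" "h < l" by (auto simp: h_def algebra_simps)
      hence "h = 0" using lmin[OF hG] by force
      thus ?thesis by (auto simp: int_multiples_def h_def mult.commute)
    qed
    moreover have "int_multiples l \<subseteq> G" using imult[OF l(1)] by (auto simp: int_multiples_def mult.commute)
    ultimately show ?thesis using l(2) by blast
  qed
qed

context centred_walk
begin

text \<open>The possible values of the walk in the sense of recurrence theory. Asking for balls
  instead of the point itself makes the set closed, as the group dichotomy requires.\<close>

definition reach :: "real set" where
  "reach = {z. \<forall>\<delta>>0. \<exists>k. killed UNIV k (indicator (ball z \<delta>)) 0 > 0}"

lemma reachD: "z \<in> reach \<Longrightarrow> \<delta> > 0 \<Longrightarrow> \<exists>k. killed UNIV k (indicator (ball z \<delta>)) 0 > 0"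
  by (simp add: reach_def)

lemma quad_bdd_ind [simp]: "B \<in> sets borel \<Longrightarrow> quad_bdd (indicator B)"
  by (rule quad_bdd_bounded[where c=1]) (auto simp: indicator_def)

lemma killed_UNIV_translate: "killed UNIV n f (x + t) = killed UNIV n (\<lambda>y. f (y + t)) x"
proof (induction n arbitrary: x)
  case (Suc n)
  have "killed UNIV n f (x + t + y) = killed UNIV n (\<lambda>y. f (y + t)) (x + y)" for y
    using Suc[of "x + y"] by (simp add: add_ac)
  thus ?case by (simp add: killed_Suc step_op_def)
qed (simp add: killed_0)

lemma killed_UNIV_one: "killed UNIV n (\<lambda>_. 1) x = 1"
proof (induction n arbitrary: x)
  case (Suc n) thus ?case using prob_space by (simp add: killed_Suc step_op_def)
qed (simp add: killed_0)

text \<open>A passage close to \<open>z\<close> is followed by one with displacement close to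
  \<open>w\<close>, each within \<open>\<delta> / 2\<close>; the second starts from a displaced
  point, hence the translation.\<close>

lemma reach_add: assumes "z \<in> reach" "w \<in> reach" shows "z + w \<in> reach"
  unfolding reach_def
proof (intro CollectI allI impI)
  fix \<delta> :: real assume \<delta>: "\<delta> > 0"
  obtain j where j: "killed UNIV j (indicator (ball z (\<delta>/2))) 0 > 0"
    using reachD[OF assms(1), of "\<delta>/2"] \<delta> by auto
  obtain k where k: "killed UNIV k (indicator (ball w (\<delta>/2))) 0 > 0" (is "?c > 0")
    using reachD[OF assms(2), of "\<delta>/2"] \<delta> by auto
  have "0 < ?c * killed UNIV j (indicator (ball z (\<delta>/2))) 0" using j k by simp
  also have "\<dots> = killed UNIV j (\<lambda>y. ?c * indicator (ball z (\<delta>/2)) y) 0"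
    by (simp add: killed_cmult)
  also have "\<dots> \<le> killed UNIV j (killed UNIV k (indicator (ball (z + w) \<delta>))) 0"
  proof (rule killed_mono)
    fix y
    show "?c * indicator (ball z (\<delta>/2)) y \<le> killed UNIV k (indicator (ball (z + w) \<delta>)) y"
    proof (cases "y \<in> ball z (\<delta>/2)")
      case True
      have "?c \<le> killed UNIV k (\<lambda>u. indicator (ball (z + w) \<delta>) (u + y)) 0"
      proof (rule killed_mono)
        fix u show "indicator (ball w (\<delta>/2)) u \<le> (indicator (ball (z + w) \<delta>) (u + y) :: real)"
          using True by (auto simp: indicator_def dist_real_def; smt (verit))
      qed (auto intro!: quad_bdd_bounded[where c=1] simp: indicator_def)
      also have "\<dots> = killed UNIV k (indicator (ball (z + w) \<delta>)) y"
        using killed_UNIV_translate[of k "indicator (ball (z + w) \<delta>)" 0 y] by simp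
      finally show ?thesis using True by simp
    next
      case False
      thus ?thesis by (simp add: killed_nonneg)
    qed
  qed (auto simp: quad_bdd_killed)
  also have "\<dots> = killed UNIV (j + k) (indicator (ball (z + w) \<delta>)) 0" by (simp add: killed_add)
  finally show "\<exists>k. 0 < killed UNIV k (indicator (ball (z + w) \<delta>)) 0" by blast
qed

lemma zero_in_reach: "0 \<in> reach"
  unfolding reach_def by (auto intro!: exI[of _ 0] simp: killed_0)

lemma closed_reach: "closed reach"
proof -
  have "z \<in> reach" if z: "z \<in> closure reach" for z
    unfolding reach_def
  proof (intro CollectI allI impI)
    fix \<delta> :: real assume \<delta>: "\<delta> > 0"
    obtain w where w: "w \<in> reach" "dist w z < \<delta> / 2"
      using z \<delta> unfolding closure_approachable by (meson half_gt_zero)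
    obtain k where k: "killed UNIV k (indicator (ball w (\<delta>/2))) 0 > 0"
      using reachD[OF w(1), of "\<delta>/2"] \<delta> by auto
    have sub: "ball w (\<delta>/2) \<subseteq> ball z \<delta>" using w(2) by (auto simp: dist_real_def; smt (verit))
    have "killed UNIV k (indicator (ball w (\<delta>/2))) 0 \<le> killed UNIV k (indicator (ball z \<delta>)) 0"
      by (rule killed_mono) (use sub in \<open>auto simp: indicator_def subset_eq\<close>)
    thus "\<exists>k. 0 < killed UNIV k (indicator (ball z \<delta>)) 0" using k less_le_trans by blast
  qed
  thus ?thesis by (metis closure_subset closure_eq subsetI subset_antisym)
qed

lemma killed_one_ind: "B \<in> sets borel \<Longrightarrow> killed UNIV (Suc 0) (indicator B) 0 = measure \<mu> B"
  by (simp add: killed_one sets_mu)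

text \<open>A point of which some neighbourhood has measure zero lies in a null ball with rational
  centre and radius, and there are countably many of these. All other points are accessible in one
  step.\<close>

lemma AE_reach: "AE y in \<mu>. y \<in> reach"
proof -
  have "AE y in \<mu>. \<forall>p\<in>\<rat>. \<forall>q\<in>\<rat>. measure \<mu> (ball p q) = 0 \<longrightarrow> y \<notin> ball p q"
  proof -
    have "AE y in \<mu>. measure \<mu> (ball p q) = 0 \<longrightarrow> y \<notin> ball p q" for p q
    proof (cases "measure \<mu> (ball p q) = 0")
      case True
      hence "ball p q \<in> null_sets \<mu>"
        by (auto simp: null_sets_def sets_mu emeasure_eq_measure)
      from AE_not_in[OF this] show ?thesis by auto
    qed auto
    thus ?thesis by (intro AE_ball_countable[THEN iffD2] ballI countable_rat)
  qed
  thus ?thesis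
  proof eventually_elim
    case (elim y)
    show ?case unfolding reach_def
    proof (intro CollectI allI impI)
      fix \<delta> :: real assume \<delta>: "\<delta> > 0"
      obtain q where q: "q \<in> \<rat>" "0 < q" "q < \<delta> / 2" using Rats_dense_in_real[of 0 "\<delta>/2"] \<delta> by auto
      obtain p where p: "p \<in> \<rat>" "y - q < p" "p < y" using Rats_dense_in_real[of "y - q" y] q by auto
      have y: "y \<in> ball p q" using p by (auto simp: dist_real_def; smt (verit))
      have sub: "ball p q \<subseteq> ball y \<delta>" using p q by (auto simp: dist_real_def; smt (verit))
      have "measure \<mu> (ball p q) \<noteq> 0" using elim p(1) q(1) y by blast
      hence "0 < measure \<mu> (ball p q)" using measure_nonneg[of \<mu> "ball p q"] by linarith
      also have "\<dots> \<le> measure \<mu> (ball y \<delta>)" using sub by (intro finite_measure_mono) (auto simp: sets_mu)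
      finally show "\<exists>k. 0 < killed UNIV k (indicator (ball y \<delta>)) 0"
        by (intro exI[of _ "Suc 0"]) (simp add: killed_one_ind)
    qed
  qed
qed

lemma ex_reach_pos: "\<exists>a\<in>reach. a > 0" and ex_reach_neg: "\<exists>a\<in>reach. a < 0"
proof -
  show "\<exists>a\<in>reach. a > 0"
  proof (rule ccontr)
    assume "\<not> (\<exists>a\<in>reach. a > 0)"
    hence "AE y in \<mu>. max 0 y = 0" using AE_reach by (auto simp: not_less max_def elim!: eventually_mono)
    hence "mean_pos = 0" unfolding mean_pos_def by (subst integral_cong_AE[where g="\<lambda>_. 0"]) auto
    thus False using mean_pos_pos by simp
  qed
  show "\<exists>a\<in>reach. a < 0"
  proof (rule ccontr)
    assume "\<not> (\<exists>a\<in>reach. a < 0)"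
    hence "AE y in \<mu>. max 0 (- y) = 0" using AE_reach by (auto simp: not_less max_def elim!: eventually_mono)
    hence "mean_pos = 0" unfolding mean_pos_eq_neg[symmetric] by (subst integral_cong_AE[where g="\<lambda>_. 0"]) auto
    thus False using mean_pos_pos by simp
  qed
qed

lemma reach_mult: "z \<in> reach \<Longrightarrow> real n * z \<in> reach"
  by (induction n) (auto simp: zero_in_reach distrib_right reach_add)

text \<open>
  If \<open>z\<close> and \<open>w\<close> have opposite signs, Dirichlet's theorem makes some \<open>k z + h w\<close> with
  \<open>k \<ge> 1\<close> small, so that \<open>(k - 1) z + h w\<close> approximates \<open>- z\<close>.
\<close>

lemma reach_uminus_aux:
  assumes z: "z \<in> reach" and w: "w \<in> reach" and opp: "z * w < 0"
  shows "- z \<in> reach"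
proof -
  have w0: "w \<noteq> 0" using opp by auto
  have "- z \<in> closure reach" unfolding closure_approachable
  proof (intro allI impI)
    fix \<epsilon> :: real assume \<epsilon>: "\<epsilon> > 0"
    \<comment> \<open>\<open>N\<close> is so large that the error \<open>1 / N\<close> in
      Dirichlet's theorem stays below \<open>\<epsilon>\<close> after multiplication by
      \<open>\<bar>w\<bar>\<close>.\<close>
    obtain N :: nat where N: "\<bar>w\<bar> / \<epsilon> < real N" using reals_Archimedean2 by blast
    have N0: "N > 0" using N \<epsilon> by (metis divide_nonneg_pos abs_ge_zero gr0I linorder_not_less of_nat_0)
    obtain h k where hk: "0 < k" "k \<le> int N" "\<bar>of_int k * (- z / w) - of_int h\<bar> < 1 / N"
      using Dirichlet_approx[OF N0] by blast
    \<comment> \<open>The opposite signs make \<open>h\<close> nonnegative. This matters because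
      negative multiples of \<open>w\<close> are not yet known to be accessible.\<close>
    have "- z / w > 0" using opp by (auto simp: divide_less_0_iff mult_less_0_iff)
    hence "0 < of_int k * (- z / w)" using hk(1) by (intro mult_pos_pos) auto
    moreover have "1 / real N \<le> 1" using N0 by simp
    ultimately have "(-1::real) < of_int h" using hk(3) by linarith
    hence h: "h \<ge> 0" by simp
    have m: "real (nat (k - 1)) * z + real (nat h) * w \<in> reach" by (intro reach_add reach_mult z w)
    have "real (nat (k - 1)) * z + real (nat h) * w - (- z) = - w * (of_int k * (- z / w) - of_int h)"
      using hk(1) h w0 by (simp add: field_simps)
    hence "\<bar>real (nat (k - 1)) * z + real (nat h) * w - (- z)\<bar> = \<bar>w\<bar> * \<bar>of_int k * (- z / w) - of_int h\<bar>"
      by (simp only: abs_mult abs_minus_cancel)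
    also have "\<dots> \<le> \<bar>w\<bar> * (1 / N)" using hk(3) by (intro mult_left_mono) auto
    also have "\<dots> < \<epsilon>" using N \<epsilon> N0 by (simp add: field_simps)
    finally show "\<exists>y\<in>reach. dist y (- z) < \<epsilon>" using m unfolding dist_real_def by blast
  qed
  thus ?thesis using closed_reach by simp
qed

lemma reach_uminus: assumes "z \<in> reach" shows "- z \<in> reach"
proof -
  obtain a b where "a \<in> reach" "a > 0" "b \<in> reach" "b < 0" using ex_reach_pos ex_reach_neg by blast
  thus ?thesis
    using reach_uminus_aux[OF assms, of a] reach_uminus_aux[OF assms, of b] assms
    by (cases z "0::real" rule: linorder_cases) (auto simp: mult_less_0_iff)
qed

text \<open>A walk started on a closed lattice that carries the increments almost surely stays on
  it, and hence avoids a neighbourhood of any point outside.\<close>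

lemma reach_subset_int_multiples:
  assumes l: "measure \<mu> (int_multiples l) = 1" shows "reach \<subseteq> int_multiples l"
proof (rule subsetI, rule ccontr)
  fix z assume z: "z \<in> reach" "z \<notin> int_multiples l"
  have "open (- int_multiples l)" using closed_int_multiples by auto
  then obtain \<delta> where \<delta>: "\<delta> > 0" "ball z \<delta> \<subseteq> - int_multiples l" using z(2) open_contains_ball by blast
  have ae: "AE y in \<mu>. y \<in> int_multiples l" using l by (subst AE_in_set_eq_1) (auto simp: sets_mu closed_int_multiples borel_closed)
  have "killed UNIV n (indicator (ball z \<delta>)) x = 0" if "x \<in> int_multiples l" for n x
    using that
  proof (induction n arbitrary: x)
    case 0 thus ?case using \<delta>(2) by (auto simp: killed_0 indicator_def)
  next
    case (Suc n)
    have "AE y in \<mu>. killed UNIV n (indicator (ball z \<delta>)) (x + y) = 0"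
      using ae
    proof eventually_elim
      case (elim y)
      have "x + y \<in> int_multiples l" using elim Suc.prems unfolding int_multiples_def
        by (auto simp: distrib_left[symmetric] of_int_add[symmetric] simp del: of_int_add)
      thus ?case by (rule Suc.IH)
    qed
    hence "(\<integral>y. killed UNIV n (indicator (ball z \<delta>)) (x + y) \<partial>\<mu>) = 0" by (rule integral_eq_zero_AE)
    thus ?case by (simp add: killed_Suc step_op_def)
  qed
  moreover have "0 \<in> int_multiples l" by (auto simp: int_multiples_def intro!: image_eqI[of _ _ 0])
  ultimately show False using z(1) \<delta>(1) unfolding reach_def by force
qed

lemma arithmetic_unique: "arithmetic_dist \<mu> l \<Longrightarrow> arithmetic_dist \<mu> l' \<Longrightarrow> l = l'"
  unfolding arithmetic_dist_def by (meson order_antisym)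

text \<open>\<open>reach\<close> is a closed subgroup of the reals. If it is generated by
  \<open>l\<close>, then every lattice carrying the increments contains \<open>l\<close>, so that
  \<open>l\<close> is the maximal span and both sets agree; otherwise it is the whole line.\<close>

lemma state_space_subset_reach: "state_space \<mu> \<subseteq> reach"
proof -
  obtain a where a: "a \<in> reach" "a > 0" using ex_reach_pos by blast
  have "reach = UNIV \<or> (\<exists>l>0. reach = int_multiples l)"
    using closed_reach _ a
  proof (rule closed_add_subgroup_real_cases)
    show "x - y \<in> reach" if "x \<in> reach" "y \<in> reach" for x y
      using reach_add[OF that(1) reach_uminus[OF that(2)]] by simp
  qed
  thus ?thesis
  proof (elim disjE exE conjE)
    fix l assume l: "l > 0" "reach = int_multiples l"
    have "measure \<mu> (int_multiples l) = 1"
      using AE_reach unfolding l(2) by (subst (asm) AE_in_set_eq_1) (auto simp: sets_mu closed_int_multiples borel_closed)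
    moreover have "l' \<le> l" if l': "l' > 0" "measure \<mu> (int_multiples l') = 1" for l'
    proof -
      have "l \<in> int_multiples l" by (auto simp: int_multiples_def intro!: image_eqI[of _ _ 1])
      hence "l \<in> int_multiples l'" using reach_subset_int_multiples[OF l'(2)] l(2) by auto
      then obtain k :: int where k: "l = l' * of_int k" by (auto simp: int_multiples_def)
      hence "k \<ge> 1" using l(1) l'(1) by (simp add: zero_less_mult_iff)
      hence "l' * 1 \<le> l' * of_int k" using l'(1) by (intro mult_left_mono) auto
      thus ?thesis using k by simp
    qed
    ultimately have ar: "arithmetic_dist \<mu> l" using l(1) by (auto simp: arithmetic_dist_def)
    hence "(THE l. arithmetic_dist \<mu> l) = l" using arithmetic_unique by blast
    thus ?thesis using ar unfolding state_space_def l(2) by auto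
  qed auto
qed

lemma state_space_cases:
  "state_space \<mu> = UNIV \<or> (\<exists>l. l > 0 \<and> measure \<mu> (int_multiples l) = 1 \<and> state_space \<mu> = int_multiples l)"
proof (cases "\<exists>l. arithmetic_dist \<mu> l")
  case True
  then obtain l where l: "arithmetic_dist \<mu> l" by blast
  hence "(THE l. arithmetic_dist \<mu> l) = l" using arithmetic_unique by blast
  hence "state_space \<mu> = int_multiples l" using True by (simp add: state_space_def)
  thus ?thesis using l unfolding arithmetic_dist_def by blast
qed (auto simp: state_space_def)

lemma closed_state_space: "closed (state_space \<mu>)"
  using state_space_cases closed_int_multiples by auto

lemma sets_state_space [measurable]: "state_space \<mu> \<in> sets borel"
  using closed_state_space by (rule borel_closed)

lemma state_space_uminus: "x \<in> state_space \<mu> \<Longrightarrow> - x \<in> state_space \<mu>"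
  using state_space_cases by (auto simp: int_multiples_def) (metis mult_minus_right of_int_minus rangeI)

lemma AE_state_space: assumes "x \<in> state_space \<mu>" shows "AE y in \<mu>. x + y \<in> state_space \<mu>"
  using state_space_cases
proof (elim disjE exE conjE)
  fix l assume l: "measure \<mu> (int_multiples l) = 1" "state_space \<mu> = int_multiples l"
  have "AE y in \<mu>. y \<in> int_multiples l"
    using l by (subst AE_in_set_eq_1) (auto simp: sets_mu closed_int_multiples borel_closed)
  thus ?thesis
  proof eventually_elim
    case (elim y)
    thus ?case using assms unfolding l(2) int_multiples_def
      by (auto simp: distrib_left[symmetric] of_int_add[symmetric] simp del: of_int_add)
  qed
qed auto

text \<open>For \<open>z\<close> in the compact set, \<open>- z\<close> is accessible, so walks from
  a whole neighbourhood of \<open>z\<close> are in \<open>(-d, d)\<close> at one fixed time with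
  probability bounded below. Finitely many neighbourhoods suffice, and survival up to the largest of
  these times is the least likely.\<close>

lemma uniform_hitting:
  assumes d: "d > 0"
  obtains N q where "N \<ge> (1::nat)" "q > (0::real)"
    "\<And>x. x \<in> state_space \<mu> \<Longrightarrow> \<bar>x\<bar> \<le> R \<Longrightarrow> killed {x \<in> state_space \<mu>. d \<le> \<bar>x\<bar>} N (\<lambda>_. 1) x \<le> 1 - q"
proof -
  define A where "A = {x \<in> state_space \<mu>. d \<le> \<bar>x\<bar>}"
  have A [measurable]: "A \<in> sets borel" unfolding A_def by measurable
  define K where "K = state_space \<mu> \<inter> cball 0 R"
  have K: "compact K" unfolding K_def using closed_state_space by (intro closed_Int_compact compact_cball)
  have "\<exists>k c. c > 0 \<and> (\<forall>x. \<bar>x - z\<bar> < d / 2 \<longrightarrow> killed A k (\<lambda>_. 1) x \<le> 1 - c)" if z: "z \<in> K" for z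
  proof -
    have zr: "- z \<in> reach" using z state_space_subset_reach reach_uminus by (auto simp: K_def)
    obtain k where k: "killed UNIV k (indicator (ball (- z) (d/2))) 0 > 0" (is "?c > 0")
      using reachD[OF zr, of "d/2"] d by auto
    have "killed A k (\<lambda>_. 1) x \<le> 1 - ?c" if x: "\<bar>x - z\<bar> < d / 2" for x
    proof -
      \<comment> \<open>Two radii \<open>d / 2\<close> add up to \<open>d\<close>: a displacement
        close to \<open>- z\<close> carries every \<open>x\<close> close to \<open>z\<close> into
        \<open>(-d, d)\<close>.\<close>
      have "?c \<le> killed UNIV k (\<lambda>u. indicator {- d<..<d} (u + x)) 0"
      proof (rule killed_mono)
        fix u show "indicator (ball (- z) (d/2)) u \<le> (indicator {-d<..<d} (u + x) :: real)"
          using x by (auto simp: indicator_def dist_real_def; smt (verit))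
      qed (auto intro!: quad_bdd_bounded[where c=1] simp: indicator_def)
      also have "\<dots> = killed UNIV k (indicator {-d<..<d}) x"
        using killed_UNIV_translate[of k "indicator {-d<..<d}" 0 x] by simp
      finally have 1: "?c \<le> killed UNIV k (indicator {-d<..<d}) x" .
      have "killed A k (\<lambda>_. 1) x = killed A k (indicator A) x" by (rule killed_cong) auto
      also have "\<dots> \<le> killed UNIV k (indicator A) x" by (rule killed_set_mono) auto
      finally have 2: "killed A k (\<lambda>_. 1) x \<le> killed UNIV k (indicator A) x" .
      have "killed UNIV k (indicator A) x + killed UNIV k (indicator {-d<..<d}) x
          = killed UNIV k (\<lambda>y. indicator A y + indicator {-d<..<d} y) x"
        by (rule killed_plus[symmetric]) auto
      also have "\<dots> \<le> killed UNIV k (\<lambda>_. 1) x"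
      proof (rule killed_mono)
        show "indicator A y + indicator {-d<..<d} y \<le> (1::real)" for y
          by (auto simp: A_def indicator_def)
      qed auto
      finally show ?thesis using 1 2 by (simp add: killed_UNIV_one)
    qed
    thus ?thesis using k by blast
  qed
  then obtain k c where kc: "\<And>z. z \<in> K \<Longrightarrow> c z > 0"
      "\<And>z x. z \<in> K \<Longrightarrow> \<bar>x - z\<bar> < d / 2 \<Longrightarrow> killed A (k z) (\<lambda>_. 1) x \<le> 1 - c z" by metis
  obtain T where T: "T \<subseteq> K" "finite T" "K \<subseteq> (\<Union>z\<in>T. ball z (d/2))"
    using compactE_image[OF K, of K "\<lambda>z. ball z (d/2)"] d by force
  define N where "N = Max (insert 1 (k ` T))"
  define q where "q = Min (insert 1 (c ` T))"
  show ?thesis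
  proof (rule that[of N q])
    show "N \<ge> 1" unfolding N_def using T(2) by simp
    show "q > 0" unfolding q_def using T kc(1) by (subst Min_gr_iff) auto
    fix x assume "x \<in> state_space \<mu>" "\<bar>x\<bar> \<le> R"
    hence "x \<in> K" by (simp add: K_def dist_real_def)
    then obtain z where z: "z \<in> T" "\<bar>x - z\<bar> < d / 2" using T(3) by (auto simp: dist_real_def abs_minus_commute)
    have "k z \<le> N" unfolding N_def using T(2) z(1) by (intro Max_ge) auto
    hence "killed A N (\<lambda>_. 1) x \<le> killed A (k z) (\<lambda>_. 1) x" by (intro killed_1_antimono A)
    also have "\<dots> \<le> 1 - c z" using kc(2) z T(1) by auto
    also have "q \<le> c z" unfolding q_def using T(2) z(1) by (intro Min_le) auto
    hence "1 - c z \<le> 1 - q" by simp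
    finally show "killed {x \<in> state_space \<mu>. d \<le> \<bar>x\<bar>} N (\<lambda>_. 1) x \<le> 1 - q" by (simp add: A_def)
  qed
qed

end

section \<open>Uniform central limit theorem\<close>

definition \<Phi> :: "real \<Rightarrow> real" where "\<Phi> = cdf std_normal_distribution"

interpretation std_normal: real_distribution std_normal_distribution
  by (rule real_dist_normal_dist)

lemma Phi_mono: "a \<le> b \<Longrightarrow> \<Phi> a \<le> \<Phi> b"
  and Phi_nonneg: "0 \<le> \<Phi> a" and Phi_le_1: "\<Phi> a \<le> 1"
  and Phi_at_top: "(\<Phi> \<longlongrightarrow> 1) at_top"
  unfolding \<Phi>_def
  by (rule std_normal.cdf_nondecreasing std_normal.cdf_nonneg std_normal.cdf_bounded_prob
      std_normal.cdf_lim_at_top_prob; assumption?)+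

text \<open>The density is at most its value at \<open>0\<close> and, by
  \<open>exp u \<ge> 1 + u\<close>, at least \<open>1 - b^2 / 2\<close> times that value between
  \<open>a\<close> and \<open>b\<close>.\<close>

lemma std_normal_cdf_bounds:
  fixes a b :: real
  assumes "a < b"
  shows "\<Phi> b - \<Phi> a \<le> (b - a) / sqrt (2 * pi)"
    and "0 \<le> a \<Longrightarrow> (1 - b\<^sup>2 / 2) * (b - a) / sqrt (2 * pi) \<le> \<Phi> b - \<Phi> a"
proof -
  have eq: "\<Phi> b - \<Phi> a = enn2real (\<integral>\<^sup>+x. ennreal (std_normal_density x) * indicator {a<..b} x \<partial>lborel)"
    using assms by (simp add: \<Phi>_def std_normal.cdf_diff_eq measure_def emeasure_density)
  have ub: "std_normal_density x \<le> 1 / sqrt (2 * pi)" for x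
    by (simp add: std_normal_density_def field_simps)
  have cst: "(\<integral>\<^sup>+x. ennreal c * indicator {a<..b} x \<partial>lborel) = ennreal (c * (b - a))" if "c \<ge> 0" for c
    using assms that by (simp add: nn_integral_cmult_indicator ennreal_mult)
  have le: "(\<integral>\<^sup>+x. ennreal (std_normal_density x) * indicator {a<..b} x \<partial>lborel) \<le> ennreal (1 / sqrt (2 * pi) * (b - a))"
  proof -
    have "(\<integral>\<^sup>+x. ennreal (std_normal_density x) * indicator {a<..b} x \<partial>lborel)
        \<le> (\<integral>\<^sup>+x. ennreal (1 / sqrt (2 * pi)) * indicator {a<..b} x \<partial>lborel)"
      by (intro nn_integral_mono mult_right_mono ennreal_leI ub) simp
    thus ?thesis by (subst (asm) cst) simp_all
  qed
  have "\<Phi> b - \<Phi> a \<le> enn2real (ennreal (1 / sqrt (2 * pi) * (b - a)))"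
    unfolding eq by (rule enn2real_mono[OF le]) simp
  thus 1: "\<Phi> b - \<Phi> a \<le> (b - a) / sqrt (2 * pi)"
    using assms by (subst (asm) enn2real_ennreal) simp_all
  assume a: "0 \<le> a"
  show "(1 - b\<^sup>2 / 2) * (b - a) / sqrt (2 * pi) \<le> \<Phi> b - \<Phi> a"
  proof (cases "1 - b\<^sup>2 / 2 \<ge> 0")
    case True
    define c where "c = (1 - b\<^sup>2 / 2) / sqrt (2 * pi)"
    have c: "c \<ge> 0" using True by (simp add: c_def)
    have "c \<le> std_normal_density x" if "x \<in> {a<..b}" for x
    proof -
      have "1 - b\<^sup>2 / 2 \<le> 1 - x\<^sup>2 / 2" using that a by (auto intro!: power_mono)
      also have "\<dots> \<le> exp (- x\<^sup>2 / 2)" using exp_ge_add_one_self[of "- x\<^sup>2 / 2"] by simp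
      finally show ?thesis unfolding c_def std_normal_density_def by (simp add: divide_right_mono)
    qed
    hence "ennreal (c * (b - a)) \<le> (\<integral>\<^sup>+x. ennreal (std_normal_density x) * indicator {a<..b} x \<partial>lborel)"
      unfolding cst[OF c, symmetric] by (intro nn_integral_mono) (auto simp: indicator_def intro!: ennreal_leI)
    hence "c * (b - a) \<le> \<Phi> b - \<Phi> a"
    proof -
      assume *: "ennreal (c * (b - a)) \<le> (\<integral>\<^sup>+x. ennreal (std_normal_density x) * indicator {a<..b} x \<partial>lborel)"
      have "enn2real (ennreal (c * (b - a))) \<le> \<Phi> b - \<Phi> a"
        unfolding eq by (rule enn2real_mono[OF *]) (rule le_less_trans[OF le], simp)
      thus ?thesis using c assms by simp
    qed
    thus ?thesis by (simp add: c_def)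
  next
    case False
    have "(1 - b\<^sup>2 / 2) * (b - a) / sqrt (2 * pi) \<le> 0"
      using False assms by (intro divide_nonpos_nonneg mult_nonpos_nonneg) auto
    also have "0 \<le> \<Phi> b - \<Phi> a" using Phi_mono[of a b] assms by simp
    finally show ?thesis .
  qed
qed

lemma sqrt_2pi_ge_2: "sqrt (2 * pi) \<ge> 2"
proof -
  have "sqrt (2\<^sup>2) \<le> sqrt (2 * pi)" using pi_ge_two by (intro real_sqrt_le_mono) auto
  thus ?thesis by simp
qed

lemma std_normal_cdf_lipschitz: "a \<le> b \<Longrightarrow> \<Phi> b - \<Phi> a \<le> (b - a) / 2"
proof (cases "a = b")
  case False
  assume "a \<le> b"
  hence "\<Phi> b - \<Phi> a \<le> (b - a) / sqrt (2 * pi)" using False std_normal_cdf_bounds(1) by simp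
  also have "\<dots> \<le> (b - a) / 2" using sqrt_2pi_ge_2 \<open>a \<le> b\<close> by (intro divide_left_mono) auto
  finally show ?thesis .
qed simp

lemma isCont_std_normal_cdf: "isCont \<Phi> x"
proof -
  have l: "\<bar>\<Phi> b - \<Phi> a\<bar> \<le> \<bar>b - a\<bar>" for a b
    using std_normal_cdf_lipschitz[of a b] std_normal_cdf_lipschitz[of b a]
      Phi_mono[of a b] Phi_mono[of b a]
    by (cases "a \<le> b") auto
  show ?thesis unfolding continuous_at_eps_delta dist_real_def
    using l le_less_trans by blast
qed

lemma std_normal_cdf_minus: "\<Phi> (- t) = 1 - \<Phi> t"
proof -
  have "emeasure std_normal_distribution {..- t} = (\<integral>\<^sup>+x. ennreal (std_normal_density x) * indicator {..- t} x \<partial>lborel)"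
    by (rule emeasure_density) auto
  also have "\<dots> = (\<integral>\<^sup>+x. ennreal (std_normal_density x) * indicator {t..} x \<partial>lborel)"
    by (subst nn_integral_real_affine[where c="-1" and t=0])
       (auto simp: std_normal_density_def indicator_def intro!: nn_integral_cong)
  also have "\<dots> = emeasure std_normal_distribution {t..}"
    by (rule emeasure_density[symmetric]) auto
  finally have "\<Phi> (- t) = measure std_normal_distribution {t..}" by (simp add: \<Phi>_def cdf_def measure_def)
  also have "{t..} = {t} \<union> (UNIV - {..t})" by auto
  also have "measure std_normal_distribution \<dots> = measure std_normal_distribution {t}
      + measure std_normal_distribution (UNIV - {..t})"
    by (rule std_normal.finite_measure_Union) auto
  also have "measure std_normal_distribution {t} = 0"
    using isCont_std_normal_cdf[of t] std_normal.isCont_cdf by (simp add: \<Phi>_def)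
  also have "measure std_normal_distribution (UNIV - {..t}) = 1 - \<Phi> t"
    using std_normal.prob_compl[of "{..t}"] by (simp add: \<Phi>_def cdf_def)
  finally show ?thesis by simp
qed

text \<open>The slope \<open>sqrt (2 / pi)\<close> is twice the density at \<open>0\<close>; it is
  the origin of the constant in the asymptotics of the survival probability.\<close>

lemma std_normal_cdf_approx:
  assumes "t \<ge> 0" shows "\<bar>2 * \<Phi> t - 1 - sqrt (2 / pi) * t\<bar> \<le> t ^ 3"
proof (cases "t = 0")
  case True thus ?thesis using std_normal_cdf_minus[of 0] by simp
next
  case False
  hence t: "t > 0" using assms by simp
  have half: "\<Phi> 0 = 1 / 2" using std_normal_cdf_minus[of 0] by simp
  have c: "sqrt (2 / pi) = 2 / sqrt (2 * pi)"
    by (simp add: real_sqrt_divide real_sqrt_mult field_simps)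
  have "2 * \<Phi> t - 1 \<le> sqrt (2 / pi) * t"
    using std_normal_cdf_bounds(1)[OF t] half unfolding c by simp
  moreover have "sqrt (2 / pi) * t - t ^ 3 \<le> 2 * \<Phi> t - 1"
  proof -
    have "1 \<le> sqrt (2 * pi)" using sqrt_2pi_ge_2 by linarith
    hence "t ^ 3 / sqrt (2 * pi) \<le> t ^ 3 / 1" using t by (intro divide_left_mono) auto
    moreover have "(1 - t\<^sup>2 / 2) * t / sqrt (2 * pi) \<le> \<Phi> t - 1 / 2"
      using std_normal_cdf_bounds(2)[OF t] half by simp
    moreover have "2 * ((1 - t\<^sup>2 / 2) * t / sqrt (2 * pi)) = 2 / sqrt (2 * pi) * t - t ^ 3 / sqrt (2 * pi)"
      by (simp add: field_simps power2_eq_square power3_eq_cube)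
    ultimately show ?thesis unfolding c by linarith
  qed
  moreover have "0 \<le> t ^ 3" using t by simp
  ultimately show ?thesis by linarith
qed

text \<open>Polya's theorem: monotone functions that are close to a continuous limit at finitely
  many grid points, between which the limit moves little, are close to it everywhere.\<close>

lemma uniform_convergence_cdf:
  assumes wc: "weak_conv F \<Phi>"
    and F: "\<And>n s t. s \<le> t \<Longrightarrow> F n s \<le> F n t" "\<And>n t. 0 \<le> F n t" "\<And>n t. F n t \<le> 1" and \<epsilon>: "\<epsilon> > 0"
  shows "\<forall>\<^sub>F n in sequentially. \<forall>t. \<bar>F n t - \<Phi> t\<bar> \<le> \<epsilon>"
proof -
  define e where "e = \<epsilon> / 2"
  have e: "e > 0" using \<epsilon> by (simp add: e_def)
  have "\<forall>\<^sub>F x in at_top. dist (\<Phi> x) 1 < e" using Phi_at_top e by (rule tendstoD)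
  then obtain K1 where K1: "\<And>x. x \<ge> K1 \<Longrightarrow> \<bar>\<Phi> x - 1\<bar> < e" by (auto simp: eventually_at_top_linorder dist_real_def)
  define K where "K = max 1 K1"
  have K: "K > 0" "\<Phi> K > 1 - e" using K1[of K] by (auto simp: K_def)
  have K': "\<Phi> (- K) < e" using K std_normal_cdf_minus[of K] by simp
  \<comment> \<open>The number of cells of mesh \<open>e\<close> needed to cover
    \<open>[-K, K]\<close>; outside, the tails of \<open>\<Phi>\<close> are below
    \<open>e\<close>.\<close>
  define m where "m = nat \<lceil>2 * K / e\<rceil>"
  define g where "g i = - K + real i * e" for i
  have m: "g m \<ge> K"
  proof -
    have "2 * K / e \<le> real m" unfolding m_def by linarith
    thus ?thesis using e by (simp add: g_def field_simps)
  qed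
  have "\<forall>\<^sub>F n in sequentially. \<bar>F n (g i) - \<Phi> (g i)\<bar> < e" for i
  proof -
    have "(\<lambda>n. F n (g i)) \<longlonglongrightarrow> \<Phi> (g i)"
      using wc isCont_std_normal_cdf unfolding weak_conv_def by blast
    from tendstoD[OF this e] show ?thesis by (simp add: dist_real_def)
  qed
  hence "\<forall>\<^sub>F n in sequentially. \<forall>i\<in>{..m}. \<bar>F n (g i) - \<Phi> (g i)\<bar> < e"
    by (intro eventually_ball_finite) auto
  thus ?thesis
  proof eventually_elim
    case (elim n)
    hence g: "\<bar>F n (g i) - \<Phi> (g i)\<bar> < e" if "i \<le> m" for i using that by auto
    show ?case
    proof
      fix t
      have e2: "\<epsilon> = 2 * e" by (simp add: e_def)
      have P: "0 \<le> \<Phi> t" "\<Phi> t \<le> 1" using Phi_nonneg Phi_le_1 by auto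
      consider "t < - K" | "t \<ge> g m" | "- K \<le> t" "t < g m" by linarith
      thus "\<bar>F n t - \<Phi> t\<bar> \<le> \<epsilon>"
      proof cases
        case 1
        have "F n t \<le> F n (g 0)" "\<Phi> t \<le> \<Phi> (- K)"
          using 1 F(1) Phi_mono by (auto simp: g_def)
        thus ?thesis using g[of 0] K' P F(2)[of n t] unfolding e2 by (simp add: g_def abs_le_iff abs_less_iff)
      next
        case 2
        have "F n (g m) \<le> F n t" "\<Phi> K \<le> \<Phi> (g m)" "\<Phi> (g m) \<le> \<Phi> t"
          using 2 m F(1) Phi_mono by auto
        thus ?thesis using g[of m] K P F(3)[of n t] unfolding e2 by (simp add: abs_le_iff abs_less_iff)
      next
        case 3
        define i where "i = nat \<lfloor>(t + K) / e\<rfloor>"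
        have i: "real i \<le> (t + K) / e" "(t + K) / e < real i + 1"
          using 3 e unfolding i_def by (simp_all add: of_nat_nat)
        have gi: "g i \<le> t" "t < g (Suc i)" using i e by (auto simp: g_def field_simps)
        have "real i * e < real m * e" using gi(1) 3 by (simp add: g_def)
        hence im: "Suc i \<le> m" using e by simp
        have "F n (g i) \<le> F n t" "F n t \<le> F n (g (Suc i))" "\<Phi> (g i) \<le> \<Phi> t" "\<Phi> t \<le> \<Phi> (g (Suc i))"
          using gi F(1) Phi_mono by auto
        moreover have "\<Phi> (g (Suc i)) - \<Phi> (g i) \<le> e"
        proof -
          have ge: "g (Suc i) - g i = e" by (simp add: g_def algebra_simps)
          have "\<Phi> (g (Suc i)) - \<Phi> (g i) \<le> e / 2"
            using std_normal_cdf_lipschitz[of "g i" "g (Suc i)"] gi unfolding ge by simp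
          thus ?thesis using e by linarith
        qed
        moreover have "F n (g (Suc i)) < \<Phi> (g (Suc i)) + e" "\<Phi> (g i) - e < F n (g i)"
          using g[OF Suc_leD[OF im]] g[OF im] by linarith+
        ultimately show ?thesis using e unfolding e2 by (intro abs_leI) linarith+
      qed
    qed
  qed
qed

section \<open>Normal approximation uniformly in the starting point\<close>

context centred_walk
begin

lemma killed_UNIV_prob:
  assumes B [measurable]: "B \<in> sets borel"
  shows "killed UNIV n (indicator B) x = measure incr {s. wpath x s n \<in> B}"
proof -
  have s: "{s. wpath x s n \<in> B} \<in> sets incr"
  proof -
    have "{s \<in> space path_space. wpath x s n \<in> B} \<in> sets path_space" by measurable
    thus ?thesis by (simp add: sets_incr space_PiM PiE_UNIV_domain)
  qed
  have "ennreal (killed UNIV n (indicator B) x) = (\<integral>\<^sup>+s. ennreal (indicator B (wpath x s n)) \<partial>incr)"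
    using nn_integral_path_quad[of "indicator B" UNIV n x] B by simp
  also have "\<dots> = (\<integral>\<^sup>+s. indicator {s. wpath x s n \<in> B} s \<partial>incr)"
    by (intro nn_integral_cong) (auto simp: indicator_def)
  also have "\<dots> = emeasure incr {s. wpath x s n \<in> B}" using s by simp
  finally have "measure incr {s. wpath x s n \<in> B} = enn2real (ennreal (killed UNIV n (indicator B) x))"
    by (simp only: measure_def)
  thus ?thesis using killed_nonneg[of "indicator B" UNIV n x] B by simp
qed

lemma clt: "weak_conv (\<lambda>n t. killed UNIV n (indicator {..t * (\<sigma> * sqrt (real n))}) 0) \<Phi>"
proof -
  interpret I: prob_space incr by (rule prob_space_incr)
  have d: "distr incr borel (\<lambda>s. s i) = \<mu>" for i :: nat
  proof -
    have "distr incr borel (\<lambda>s. s i) = distr incr \<mu> (\<lambda>s. s i)"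
      by (rule distr_cong) (auto simp: sets_mu)
    also have "\<dots> = \<mu>" using prob_space_axioms by (intro distr_PiM_component) auto
    finally show ?thesis .
  qed
  have indep: "I.indep_vars (\<lambda>_. borel) (\<lambda>i s. s i) (UNIV :: nat set)"
  proof (subst I.indep_vars_iff_distr_eq_PiM)
    show "distr incr path_space (\<lambda>x. \<lambda>i\<in>UNIV. x i) = PiM UNIV (\<lambda>i. distr incr borel (\<lambda>s. s i))"
      unfolding d restrict_UNIV by (rule distr_id2) (simp add: sets_incr)
  qed auto
  have var: "I.variance (\<lambda>s. s i) = \<sigma>\<^sup>2" and ex: "I.expectation (\<lambda>s. s i) = 0"
    and si: "integrable incr (\<lambda>s. (s i)\<^sup>2)" for i :: nat
  proof -
    have m: "(\<lambda>s. s i) \<in> measurable incr borel" by measurable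
    show ex: "I.expectation (\<lambda>s. s i) = 0"
      using integral_distr[OF m, of "\<lambda>y. y"] mean_zero unfolding d by simp
    show "integrable incr (\<lambda>s. (s i)\<^sup>2)"
      using integrable_distr_eq[OF m, of "\<lambda>y. y\<^sup>2"] sq_int unfolding d by simp
    show "I.variance (\<lambda>s. s i) = \<sigma>\<^sup>2"
      using integral_distr[OF m, of "\<lambda>y. y\<^sup>2"] second_moment ex unfolding d by simp
  qed
  have "weak_conv_m (\<lambda>n. distr incr borel (\<lambda>s. (\<Sum>i<n. s i) / sqrt (n * \<sigma>\<^sup>2))) std_normal_distribution"
    by (rule I.central_limit_theorem_zero_mean[OF indep ex sigma_pos si var d])
  moreover have "\<forall>\<^sub>F n in sequentially. cdf (distr incr borel (\<lambda>s. (\<Sum>i<n. s i) / sqrt (n * \<sigma>\<^sup>2))) t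
      = killed UNIV n (indicator {..t * (\<sigma> * sqrt (real n))}) 0" for t
    using eventually_gt_at_top[of 0]
  proof eventually_elim
    case (elim n)
    have "sqrt (n * \<sigma>\<^sup>2) = \<sigma> * sqrt (real n)" using sigma_pos by (simp add: real_sqrt_mult)
    moreover have "\<sigma> * sqrt (real n) > 0" using sigma_pos elim by simp
    ultimately show ?case
      by (simp add: cdf_def measure_distr killed_UNIV_prob wpath_def vimage_def pos_divide_le_eq)
  qed
  ultimately show ?thesis
    unfolding weak_conv_m_def weak_conv_def \<Phi>_def by (blast intro: Lim_transform_eventually)
qed

text \<open>Moving the starting point amounts to moving the threshold, so uniformity in the
  threshold gives uniformity in \<open>x\<close>.\<close>

lemma clt_uniform:
  assumes "\<epsilon> > 0"
  shows "\<forall>\<^sub>F n in sequentially. \<forall>x t. \<bar>killed UNIV n (indicator {..t}) x - \<Phi> ((t - x) / (\<sigma> * sqrt (real n)))\<bar> \<le> \<epsilon>"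
proof -
  have "\<forall>\<^sub>F n in sequentially. \<forall>t. \<bar>killed UNIV n (indicator {..t * (\<sigma> * sqrt (real n))}) 0 - \<Phi> t\<bar> \<le> \<epsilon>"
  proof (rule uniform_convergence_cdf[OF clt])
    fix n and s t :: real assume "s \<le> t"
    hence "s * (\<sigma> * sqrt (real n)) \<le> t * (\<sigma> * sqrt (real n))" using sigma_pos by (intro mult_right_mono) auto
    thus "killed UNIV n (indicator {..s * (\<sigma> * sqrt (real n))}) 0 \<le> killed UNIV n (indicator {..t * (\<sigma> * sqrt (real n))}) 0"
      by (intro killed_mono) (auto simp: indicator_def[abs_def] intro!: quad_bdd_bounded[where c=1])
  next
    fix n and t :: real
    show "0 \<le> killed UNIV n (indicator {..t * (\<sigma> * sqrt (real n))}) 0" by (rule killed_nonneg) auto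
    show "killed UNIV n (indicator {..t * (\<sigma> * sqrt (real n))}) 0 \<le> 1"
      unfolding killed_UNIV_prob[OF borel_closed[OF closed_atMost]]
      using prob_space.prob_le_1[OF prob_space_incr] by blast
  qed fact
  thus ?thesis using eventually_gt_at_top[of 0]
  proof eventually_elim
    case (elim n)
    have p: "\<sigma> * sqrt (real n) > 0" using sigma_pos elim by simp
    show ?case
    proof (intro allI)
      fix x t
      have "killed UNIV n (indicator {..t}) x = killed UNIV n (\<lambda>y. indicator {..t} (y + x)) 0"
        using killed_UNIV_translate[of n "indicator {..t}" 0 x] by simp
      also have "\<dots> = killed UNIV n (indicator {..(t - x) / (\<sigma> * sqrt (real n)) * (\<sigma> * sqrt (real n))}) 0"
        using elim(2) sigma_pos by (intro killed_cong) (auto simp: indicator_def)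
      finally show "\<bar>killed UNIV n (indicator {..t}) x - \<Phi> ((t - x) / (\<sigma> * sqrt (real n)))\<bar> \<le> \<epsilon>"
        using spec[OF elim(1), of "(t - x) / (\<sigma> * sqrt (real n))"] by (simp only:)
    qed
  qed
qed

lemma anticoncentration:
  assumes "\<epsilon> > 0"
  shows "\<forall>\<^sub>F n in sequentially. \<forall>x r. r \<ge> 0 \<longrightarrow>
    killed UNIV n (indicator {-r..r}) x \<le> r / (\<sigma> * sqrt (real n)) + \<epsilon>"
proof -
  have "\<epsilon> / 3 > 0" using assms by simp
  from clt_uniform[OF this] show ?thesis using eventually_gt_at_top[of 0]
  proof eventually_elim
    case (elim n)
    have p: "\<sigma> * sqrt (real n) > 0" (is "?s > 0") using sigma_pos elim(2) by simp
    show ?case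
    proof (intro allI impI)
      fix x r :: real assume r: "r \<ge> 0"
      \<comment> \<open>The interval is closed, so a half-line ending strictly to its left is
        subtracted, at distance \<open>h\<close>. The choice makes this gap cost
        \<open>\<epsilon> / 3\<close>, as much as each of the two normal approximations.\<close>
      define h where "h = 2 * \<epsilon> / 3 * ?s"
      have h: "h > 0" using assms p by (simp add: h_def)
      have "killed UNIV n (indicator {-r..r}) x \<le> killed UNIV n (\<lambda>y. indicator {..r} y - indicator {..- r - h} y) x"
        by (rule killed_mono) (use h r in \<open>auto simp: indicator_def[abs_def] intro!: quad_bdd_bounded[where c=1]\<close>)
      also have "\<dots> = killed UNIV n (indicator {..r}) x - killed UNIV n (indicator {..- r - h}) x"
        by (rule killed_minus) auto
      also have "\<dots> \<le> \<Phi> ((r - x) / ?s) + \<epsilon> / 3 - (\<Phi> ((- r - h - x) / ?s) - \<epsilon> / 3)"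
        using spec[OF spec[OF elim(1), of x], of r] spec[OF spec[OF elim(1), of x], of "- r - h"]
        unfolding abs_le_iff by linarith
      also have "\<dots> \<le> ((r - x) / ?s - (- r - h - x) / ?s) / 2 + 2 * \<epsilon> / 3"
        using std_normal_cdf_lipschitz[of "(- r - h - x) / ?s" "(r - x) / ?s"] p r h
        by (simp add: divide_right_mono)
      also have "((r - x) / ?s - (- r - h - x) / ?s) / 2 = r / ?s + h / ?s / 2"
        by (simp add: diff_divide_distrib[symmetric] add_divide_distrib)
      also have "h / ?s / 2 = \<epsilon> / 3" using elim(2) sigma_pos by (simp add: h_def)
      finally show "killed UNIV n (indicator {-r..r}) x \<le> r / ?s + \<epsilon>" by simp
    qed
  qed
qed

end

section \<open>Survival probabilities\<close>

lemma quad_bdd_divide [intro!]: "quad_bdd f \<Longrightarrow> quad_bdd (\<lambda>x. f x / c)"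
  using quad_bdd_cmult[of f "1 / c"] by simp

context centred_walk
begin

text \<open>The intersection with the state space is there for \<open>uniform_hitting\<close>, whose
  lower bound holds at accessible points. For starting points in the state space it does not alter
  the killed walk, by \<open>killed_alive_eq\<close>.\<close>

definition alive :: "real \<Rightarrow> real set" where
  "alive d = {x \<in> state_space \<mu>. d \<le> \<bar>x\<bar>}"

lemma sets_alive [measurable, simp]: "alive d \<in> sets borel"
  unfolding alive_def by measurable

section \<open>Expected occupation and the Green function\<close>

lemma step_op_sum:
  assumes "\<And>j. j \<in> I \<Longrightarrow> quad_bdd (f j)"
  shows "step_op A (\<lambda>z. \<Sum>j\<in>I. f j z) x = (\<Sum>j\<in>I. step_op A (f j) x)"
  unfolding step_op_def
  by (subst Bochner_Integration.integral_sum) (use quad_bdd_integrable[OF assms] in \<open>auto simp: sum_distrib_left\<close>)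

lemma step_op_add:
  assumes "quad_bdd f" "quad_bdd g"
  shows "step_op A (\<lambda>z. f z + g z) x = step_op A f x + step_op A g x"
  unfolding step_op_def using quad_bdd_integrable[OF assms(1), of x] quad_bdd_integrable[OF assms(2), of x]
  by (simp add: distrib_left)

lemma step_op_cmult: "step_op A (\<lambda>z. c * f z) x = c * step_op A f x"
  unfolding step_op_def by simp

lemma step_op_const_le: "c \<ge> 0 \<Longrightarrow> step_op A (\<lambda>_. c) x \<le> c"
  unfolding step_op_def using prob_space by (simp add: indicator_def)

lemma occupation_Suc:
  assumes "quad_bdd f" "A \<in> sets borel"
  shows "(\<Sum>j<Suc n. killed A j f x) = indicator A x * f x + step_op A (\<lambda>z. \<Sum>j<n. killed A j f z) x"
proof -
  have "(\<Sum>j<Suc n. killed A j f x) = killed A 0 f x + (\<Sum>j<n. killed A (Suc j) f x)"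
    by (rule sum.lessThan_Suc_shift)
  also have "(\<Sum>j<n. killed A (Suc j) f x) = step_op A (\<lambda>z. \<Sum>j<n. killed A j f z) x"
    unfolding killed_Suc using quad_bdd_killed[OF assms] by (intro step_op_sum[symmetric]) 
  finally show ?thesis by (simp add: killed_0)
qed

text \<open>Each visit to \<open>[-R, R]\<close> leads with probability at least \<open>q\<close> to
  death within \<open>N\<close> steps. The bound \<open>N / q\<close> is the solution of
  \<open>D = N + (1 - q) * D\<close>. In the induction one step is taken from outside the interval
  and \<open>N\<close> steps from inside, both of which shorten the horizon.\<close>

lemma occupation_bounded:
  assumes A: "A \<in> sets borel" and N: "N \<ge> 1" and q: "q > 0"
    and hit: "\<And>x. x \<in> A \<Longrightarrow> \<bar>x\<bar> \<le> R \<Longrightarrow> killed A N (\<lambda>_. 1) x \<le> 1 - q"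
  shows "(\<Sum>j<n. killed A j (indicator {-R..R}) x) \<le> real N / q"
proof (induction n arbitrary: x rule: less_induct)
  case (less n)
  let ?f = "indicator {-R..R} :: real \<Rightarrow> real"
  have qf: "quad_bdd ?f" by simp
  have D0: "0 \<le> real N / q" using q by simp
  have qs: "quad_bdd (\<lambda>z. \<Sum>j<m. killed A j ?f z)" for m
    using quad_bdd_killed[OF qf A] by (intro quad_bdd_sum)
  have le1: "killed A j ?f x \<le> 1" for j
    by (rule order_trans[OF killed_mono[OF qf _ A, of "\<lambda>_. 1"] killed_1_le[OF A]]) (auto simp: indicator_def)
  consider "x \<notin> A" | "x \<in> A" "\<bar>x\<bar> > R" | "x \<in> A" "\<bar>x\<bar> \<le> R" by linarith
  thus ?case
  proof cases
    case 1 thus ?thesis using D0 by (simp add: killed_outside)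
  next
    case 2
    show ?thesis
    proof (cases n)
      case 0 thus ?thesis using D0 by simp
    next
      case (Suc m)
      have "(\<Sum>j<Suc m. killed A j ?f x) = step_op A (\<lambda>z. \<Sum>j<m. killed A j ?f z) x"
        using 2 by (subst occupation_Suc[OF qf A]) (auto simp: indicator_def)
      also have "\<dots> \<le> step_op A (\<lambda>_. real N / q) x"
        using less Suc qs by (intro step_op_mono) auto
      also have "\<dots> \<le> real N / q" by (rule step_op_const_le[OF D0])
      finally show ?thesis using Suc by simp
    qed
  next
    case 3
    have p: "killed A N (\<lambda>_. 1) x \<le> 1 - q" using hit 3 by blast
    have "0 \<le> killed A N (\<lambda>_. 1) x" using A by (intro killed_nonneg) auto
    hence q1: "q \<le> 1" using p by simp
    have "q * real N \<le> 1 * real N" using q1 by (intro mult_right_mono) auto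
    hence ND: "real N \<le> real N / q" using q by (simp add: pos_le_divide_eq mult.commute)
    have few: "(\<Sum>j<m. killed A j ?f x) \<le> real m" for m
      using sum_mono[of "{..<m}" "\<lambda>j. killed A j ?f x" "\<lambda>_. 1"] le1 by simp
    show ?thesis
    proof (cases "n \<le> N")
      case True thus ?thesis using few[of n] ND by linarith
    next
      case False
      define m where "m = n - N"
      have nm: "n = N + m" "m < n" using False N by (auto simp: m_def)
      have sp: "(\<Sum>j<N + k. f j) = (\<Sum>j<N. f j) + (\<Sum>j<k. f (N + j))" for f :: "nat \<Rightarrow> real" and k
        by (induction k) auto
      have "(\<Sum>j<n. killed A j ?f x) = (\<Sum>j<N. killed A j ?f x) + (\<Sum>j<m. killed A (N + j) ?f x)"
        unfolding nm(1) by (rule sp)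
      also have "(\<Sum>j<m. killed A (N + j) ?f x) = killed A N (\<lambda>z. \<Sum>j<m. killed A j ?f z) x"
        using quad_bdd_killed[OF qf A] A by (subst killed_sum) (auto simp: killed_add)
      also have "\<dots> \<le> killed A N (\<lambda>_. real N / q) x"
        using less[OF nm(2)] qs A by (intro killed_mono) auto
      also have "\<dots> = real N / q * killed A N (\<lambda>_. 1) x" using A by (rule killed_const)
      also have "\<dots> \<le> real N / q * (1 - q)" using p D0 by (rule mult_left_mono)
      also have "\<dots> = real N / q - N" using q by (simp add: field_simps)
      finally show ?thesis using few[of N] by simp
    qed
  qed
qed

text \<open>Summing the drift inequality bounds the accumulated \<open>excess\<close> by the initial
  value of \<open>F\<close> plus \<open>b\<close> times the occupation of \<open>[-R, R]\<close>,
  whatever the horizon \<open>n\<close>.\<close>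

lemma green_bound:
  assumes d: "d > 0"
  obtains e where "\<And>x. 0 \<le> e x" "\<And>\<epsilon>. \<epsilon> > 0 \<Longrightarrow> \<exists>C\<ge>0. \<forall>x. e x \<le> \<epsilon> * \<bar>x\<bar> + C"
    "\<And>n x. (\<Sum>j<n. killed (alive d) j (\<lambda>y. excess \<bar>y\<bar>) x) \<le> e x"
proof -
  obtain F R b where F: "R > 0" "b \<ge> 0" "quad_bdd F" "\<And>x. 0 \<le> F x" "\<And>x. F x \<le> \<bar>x\<bar>"
    and small: "\<And>\<epsilon>. \<epsilon> > 0 \<Longrightarrow> \<exists>C\<ge>0. \<forall>x. F x \<le> \<epsilon> * \<bar>x\<bar> + C"
    and drift: "\<And>x. (\<integral>y. F (x + y) \<partial>\<mu>) \<le> F x - excess \<bar>x\<bar> + b * indicator {-R..R} x"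
    by (rule lyapunov) blast
  obtain N q where Nq: "N \<ge> (1::nat)" "q > (0::real)"
    "\<And>x. x \<in> state_space \<mu> \<Longrightarrow> \<bar>x\<bar> \<le> R \<Longrightarrow> killed (alive d) N (\<lambda>_. 1) x \<le> 1 - q"
    using uniform_hitting[OF d, of R] unfolding alive_def by metis
  let ?A = "alive d" and ?f = "indicator {-R..R} :: real \<Rightarrow> real" and ?h = "\<lambda>y. excess \<bar>y\<bar>"
  have A: "?A \<in> sets borel" by simp
  have qf: "quad_bdd ?f" by simp
  have occ: "(\<Sum>j<n. killed ?A j ?f x) \<le> real N / q" for n x
    using Nq by (intro occupation_bounded A) (auto simp: alive_def)
  have qs: "quad_bdd (\<lambda>z. \<Sum>j<m. killed ?A j ?f z)" "quad_bdd (\<lambda>z. \<Sum>j<m. killed ?A j ?h z)" for m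
    using quad_bdd_killed[OF qf A] quad_bdd_killed[OF quad_bdd_excess A] by (auto intro!: quad_bdd_sum)
  have main: "(\<Sum>j<n. killed ?A j ?h x) \<le> F x + b * (\<Sum>j<n. killed ?A j ?f x)" for n x
  proof (induction n arbitrary: x)
    case 0 thus ?case using F by simp
  next
    case (Suc n)
    show ?case
    proof (cases "x \<in> ?A")
      case False thus ?thesis using F by (simp add: killed_outside)
    next
      case True
      have "(\<Sum>j<Suc n. killed ?A j ?h x) = excess \<bar>x\<bar> + step_op ?A (\<lambda>z. \<Sum>j<n. killed ?A j ?h z) x"
        using True by (subst occupation_Suc[OF quad_bdd_excess A]) simp
      also have "step_op ?A (\<lambda>z. \<Sum>j<n. killed ?A j ?h z) x
          \<le> step_op ?A (\<lambda>z. F z + b * (\<Sum>j<n. killed ?A j ?f z)) x"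
        by (rule step_op_mono[OF qs(2) quad_bdd_add[OF F(3) quad_bdd_cmult[OF qs(1)]] Suc])
      also have "\<dots> = step_op ?A F x + b * step_op ?A (\<lambda>z. \<Sum>j<n. killed ?A j ?f z) x"
        by (simp only: step_op_add[OF F(3) quad_bdd_cmult[OF qs(1)]] step_op_cmult)
      also have "step_op ?A F x \<le> F x - excess \<bar>x\<bar> + b * ?f x"
        using drift[of x] True by (simp add: step_op_def)
      also have "b * step_op ?A (\<lambda>z. \<Sum>j<n. killed ?A j ?f z) x
          = b * (\<Sum>j<Suc n. killed ?A j ?f x) - b * ?f x"
        using True by (subst occupation_Suc[OF qf A]) (simp add: algebra_simps)
      finally show ?thesis by simp
    qed
  qed
  show ?thesis
  proof (rule that[of "\<lambda>x. F x + b * (real N / q)"])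
    show "0 \<le> F x + b * (real N / q)" for x using F Nq(2) by simp
    show "(\<Sum>j<n. killed ?A j ?h x) \<le> F x + b * (real N / q)" for n x
      using order_trans[OF main[of x n]] mult_left_mono[OF occ[of x n] F(2)] by simp
    show "\<exists>C\<ge>0. \<forall>x. F x + b * (real N / q) \<le> \<epsilon> * \<bar>x\<bar> + C" if \<epsilon>: "\<epsilon> > 0" for \<epsilon>
    proof -
      obtain C where C: "C \<ge> 0" "\<And>x. F x \<le> \<epsilon> * \<bar>x\<bar> + C" using small[OF \<epsilon>] by blast
      have "0 \<le> b * (real N / q)" using F Nq(2) by simp
      thus ?thesis using C by (intro exI[of _ "C + b * (real N / q)"]) (auto simp: add.assoc[symmetric])
    qed
  qed
qed

text \<open>The absolute value is linear apart from its kink, which a step \<open>z\<close> can pass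
  only if \<open>\<bar>z\<bar> > \<bar>y\<bar>\<close>; the linear part averages to zero.\<close>

lemma mean_abs_le: "(\<integral>z. \<bar>y + z\<bar> \<partial>\<mu>) \<le> \<bar>y\<bar> + 2 * excess \<bar>y\<bar>"
proof -
  define s :: real where "s = (if y \<ge> 0 then 1 else -1)"
  have "(\<integral>z. \<bar>y + z\<bar> \<partial>\<mu>) \<le> (\<integral>z. \<bar>y\<bar> + s * z + 2 * max 0 (\<bar>z\<bar> - \<bar>y\<bar>) \<partial>\<mu>)"
  proof (rule integral_mono)
    show "\<bar>y + z\<bar> \<le> \<bar>y\<bar> + s * z + 2 * max 0 (\<bar>z\<bar> - \<bar>y\<bar>)" for z
      by (auto simp: s_def max_def abs_if)
  qed auto
  also have "\<dots> = \<bar>y\<bar> + 2 * excess \<bar>y\<bar>"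
    using prob_space by (simp add: mean_zero excess_def)
  finally show ?thesis .
qed

lemma killed_abs_le:
  assumes A: "A \<in> sets borel"
  shows "killed A n abs x \<le> \<bar>x\<bar> + 2 * (\<Sum>j<n. killed A j (\<lambda>y. excess \<bar>y\<bar>) x)"
proof (induction n)
  case (Suc n)
  have q: "quad_bdd (\<lambda>y. \<bar>y\<bar> + 2 * excess \<bar>y\<bar>)" by (intro quad_bdd_add quad_bdd_cmult quad_bdd_excess) simp
  have "killed A (Suc n) abs x = killed A n (killed A (Suc 0) abs) x"
    using killed_add[of A n "Suc 0" abs] by simp
  also have "\<dots> \<le> killed A n (\<lambda>y. \<bar>y\<bar> + 2 * excess \<bar>y\<bar>) x"
  proof (rule killed_mono[OF _ q A])
    show "killed A (Suc 0) abs y \<le> \<bar>y\<bar> + 2 * excess \<bar>y\<bar>" if "y \<in> A" for y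
      using order_trans[OF killed_one_le[OF _ A _ that] mean_abs_le] by simp
  qed (use A in auto)
  also have "\<dots> = killed A n abs x + 2 * killed A n (\<lambda>y. excess \<bar>y\<bar>) x"
    using killed_lin[OF quad_bdd_simps(2) quad_bdd_excess A, of n 1 2 x] by simp
  finally show ?case using Suc by simp
qed (simp add: killed_0 indicator_def)

lemma sum_inverse_sqrt: "(\<Sum>k<n. 1 / sqrt (real (Suc k))) \<le> 2 * sqrt (real n)"
proof (induction n)
  case (Suc n)
  have p: "0 < sqrt (real (Suc n))" by simp
  have "2 * sqrt (real n) * sqrt (real (Suc n)) \<le> real n + real (Suc n)"
  proof -
    have "0 \<le> (sqrt (real n) - sqrt (real (Suc n)))\<^sup>2" by simp
    thus ?thesis by (simp add: power2_diff)
  qed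
  also have "\<dots> = 2 * sqrt (real (Suc n)) * sqrt (real (Suc n)) - 1"
    unfolding mult.assoc real_sqrt_mult_self by simp
  finally have "2 * sqrt (real n) \<le> 2 * sqrt (real (Suc n)) - 1 / sqrt (real (Suc n))"
    using p by (simp add: field_simps)
  thus ?case using Suc by simp
qed simp

text \<open>A surviving walk at time \<open>n\<close> is either farther than \<open>r\<close> from
  zero, which is controlled by the mean of \<open>\<bar>S\<^sub>n\<bar>\<close>, or in
  \<open>[-r, r]\<close>, which given the first half of the path has probability at most
  \<open>1 / 4\<close>. The factor \<open>1 / 4\<close> outweighs the factor of at most
  \<open>2\<close> that halving the time costs in \<open>sqrt n\<close>.\<close>

lemma survival_bound:
  assumes d: "d > 0"
  obtains C where "C > 0" "\<And>n x. killed (alive d) n (\<lambda>_. 1) x \<le> C * (1 + \<bar>x\<bar>) / sqrt (real (Suc n))"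
proof -
  let ?A = "alive d"
  have A: "?A \<in> sets borel" by simp
  obtain e where e: "\<And>x. 0 \<le> e x" "\<And>\<epsilon>. \<epsilon> > 0 \<Longrightarrow> \<exists>C\<ge>0. \<forall>x. e x \<le> \<epsilon> * \<bar>x\<bar> + C"
    "\<And>n x. (\<Sum>j<n. killed ?A j (\<lambda>y. excess \<bar>y\<bar>) x) \<le> e x"
    by (rule green_bound[OF d]) blast
  obtain C1 where C1: "C1 \<ge> 0" "\<And>x. e x \<le> 1 * \<bar>x\<bar> + C1" using e(2)[of 1] by auto
  define C0 where "C0 = 3 + 2 * C1"
  have absb: "killed ?A n abs x \<le> C0 * (1 + \<bar>x\<bar>)" for n x
  proof -
    have "killed ?A n abs x \<le> \<bar>x\<bar> + 2 * e x"
      using killed_abs_le[OF A, of n x] e(3)[of x n] by (rule order_trans[OF _ add_left_mono[OF mult_left_mono]]) simp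
    also have "\<dots> \<le> \<bar>x\<bar> + 2 * (1 * \<bar>x\<bar> + C1)" using C1(2)[of x] by simp
    also have "\<dots> \<le> C0 * (1 + \<bar>x\<bar>)" using C1(1) by (simp add: C0_def algebra_simps)
    finally show ?thesis .
  qed
  obtain n1 where n1: "\<And>n x r. n \<ge> n1 \<Longrightarrow> r \<ge> 0 \<Longrightarrow>
      killed UNIV n (indicator {-r..r}) x \<le> r / (\<sigma> * sqrt (real n)) + 1 / 8"
    using anticoncentration[of "1/8"] by (auto simp: eventually_sequentially)
  \<comment> \<open>As \<open>n \<le> 4 * (n - m)\<close>, this choice makes
    \<open>r / (\<sigma> * sqrt (n - m))\<close> at most \<open>1 / 8\<close>; the normal
    approximation contributes the other \<open>1 / 8\<close>.\<close>
  define \<theta> where "\<theta> = \<sigma> / 16"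
  have \<theta>: "\<theta> > 0" using sigma_pos by (simp add: \<theta>_def)
  define n2 where "n2 = 2 * n1 + 2"
  \<comment> \<open>The first summand covers the times below \<open>n2\<close>. The second closes
    the induction: the halved time contributes \<open>C / 2\<close>, and
    \<open>C0 / \<theta> \<le> C / 2\<close>.\<close>
  define C where "C = sqrt (real n2) + 2 * C0 / \<theta>"
  have C0: "C0 > 0" using C1 by (simp add: C0_def)
  have C: "C > 0" "C \<ge> sqrt (real n2)" "2 * C0 / \<theta> \<le> C"
    using C0 \<theta> by (auto simp: C_def n2_def intro!: add_pos_pos)
  let ?p = "\<lambda>n. killed ?A n (\<lambda>_. 1)"
  have "?p n x * sqrt (real n) \<le> C * (1 + \<bar>x\<bar>)" for n x
  proof (induction n rule: less_induct)
    case (less n)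
    show ?case
    proof (cases "n < n2")
      case True
      have "?p n x * sqrt (real n) \<le> 1 * sqrt (real n2)"
        using True killed_1_le[OF A] by (intro mult_mono) auto
      also have "\<dots> \<le> C * (1 + \<bar>x\<bar>)" using C by (simp add: distrib_left add_increasing2)
      finally show ?thesis .
    next
      case False
      define m where "m = n div 2"
      define r where "r = \<theta> * sqrt (real n)"
      have n: "n > 0" "n - m \<ge> n1" "n - m > 0" "m < n" "m > 0" using False by (auto simp: m_def n2_def)
      have r: "r > 0" using \<theta> n by (simp add: r_def)
      let ?I = "indicator {-r..r} :: real \<Rightarrow> real"
      have "?p n x \<le> killed ?A n (\<lambda>y. ?I y + 1 / r * \<bar>y\<bar>) x"
      proof (rule killed_mono)
        show "1 \<le> ?I y + 1 / r * \<bar>y\<bar>" for y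
          using r by (cases "\<bar>y\<bar> \<le> r") (auto simp: indicator_def abs_le_iff)
      qed auto
      also have "\<dots> = killed ?A n ?I x + 1 / r * killed ?A n abs x"
        using killed_lin[of ?I abs ?A n 1 "1/r" x] by simp
      also have "killed ?A n ?I x \<le> 1 / 4 * ?p m x"
      proof -
        have "killed ?A n ?I x = killed ?A m (killed ?A (n - m) ?I) x"
          using killed_add[of ?A m "n - m" ?I] n by simp
        also have "\<dots> \<le> killed ?A m (\<lambda>_. 1 / 4) x"
        proof (rule killed_mono)
          fix y
          have "killed ?A (n - m) ?I y \<le> killed UNIV (n - m) ?I y" by (rule killed_set_mono) auto
          also have "\<dots> \<le> r / (\<sigma> * sqrt (real (n - m))) + 1 / 8" using n(2) r by (intro n1) auto
          also have "r / (\<sigma> * sqrt (real (n - m))) \<le> 1 / 8"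
          proof -
            have "sqrt (real n) \<le> sqrt (4 * real (n - m))" by (rule real_sqrt_le_mono) (simp add: m_def)
            also have "\<dots> = 2 * sqrt (real (n - m))" by (simp add: real_sqrt_mult)
            finally show ?thesis using sigma_pos n(3) by (simp add: r_def \<theta>_def field_simps)
          qed
          finally show "killed ?A (n - m) ?I y \<le> 1 / 4" by simp
        qed auto
        also have "\<dots> = 1 / 4 * ?p m x" by (rule killed_const[OF A])
        finally show ?thesis .
      qed
      finally have "?p n x * sqrt (real n) \<le> (1 / 4 * ?p m x + 1 / r * killed ?A n abs x) * sqrt (real n)"
        by (simp add: mult_right_mono)
      also have "\<dots> = 1 / 4 * (?p m x * sqrt (real n)) + killed ?A n abs x / \<theta>"
        using n \<theta> by (simp add: r_def field_simps)
      also have "?p m x * sqrt (real n) \<le> ?p m x * (2 * sqrt (real m))"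
      proof (rule mult_left_mono)
        have "sqrt (real n) \<le> sqrt (4 * real m)"
        proof (rule real_sqrt_le_mono)
          have "n \<le> 4 * m" using n(5) by (auto simp: m_def)
          thus "real n \<le> 4 * real m" by linarith
        qed
        thus "sqrt (real n) \<le> 2 * sqrt (real m)" by (simp add: real_sqrt_mult)
      qed (rule killed_nonneg, auto)
      also have "\<dots> \<le> 2 * (C * (1 + \<bar>x\<bar>))" using less[OF n(4)] by simp
      also have "killed ?A n abs x / \<theta> \<le> C0 * (1 + \<bar>x\<bar>) / \<theta>" using absb \<theta> by (intro divide_right_mono) auto
      also have "\<dots> = C0 / \<theta> * (1 + \<bar>x\<bar>)" by simp
      also have "\<dots> \<le> C / 2 * (1 + \<bar>x\<bar>)" 
      proof (rule mult_right_mono)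
        have "C0 / \<theta> = (2 * C0 / \<theta>) / 2" by simp
        also have "\<dots> \<le> C / 2" using C(3) by (rule divide_right_mono) simp
        finally show "C0 / \<theta> \<le> C / 2" .
      qed simp
      finally show ?thesis by (simp add: field_simps)
    qed
  qed
  note b = this
  \<comment> \<open>Passing to \<open>Suc n\<close> gives a bound that is meaningful at
    \<open>n = 0\<close> as well, at the price of a factor \<open>2\<close>.\<close>
  have "?p n x \<le> (2 * C + 1) * (1 + \<bar>x\<bar>) / sqrt (real (Suc n))" for n x
  proof (cases "n = 0")
    case True thus ?thesis using killed_1_le[OF A, of 0 x] C(1)
      by (simp add: field_simps) (smt (verit) mult_nonneg_nonneg abs_ge_zero)
  next
    case False
    have p0: "0 \<le> ?p n x" by (rule killed_nonneg) auto
    have "sqrt (real (Suc n)) \<le> sqrt (4 * real n)" using False by (intro real_sqrt_le_mono) auto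
    also have "\<dots> = 2 * sqrt (real n)" by (simp add: real_sqrt_mult)
    finally have "?p n x * sqrt (real (Suc n)) \<le> ?p n x * (2 * sqrt (real n))" using p0 by (rule mult_left_mono)
    also have "\<dots> \<le> 2 * (C * (1 + \<bar>x\<bar>))" using b[of n x] by simp
    also have "\<dots> \<le> (2 * C + 1) * (1 + \<bar>x\<bar>)" by (simp add: algebra_simps)
    finally show ?thesis by (simp add: pos_le_divide_eq)
  qed
  thus ?thesis using C(1) by (intro that[of "2 * C + 1"]) auto
qed

lemma survival_tendsto_0:
  assumes d: "d > 0" shows "(\<lambda>n. killed (alive d) n (\<lambda>_. 1) x) \<longlonglongrightarrow> 0"
proof -
  obtain C where C: "C > 0" "\<And>n x. killed (alive d) n (\<lambda>_. 1) x \<le> C * (1 + \<bar>x\<bar>) / sqrt (real (Suc n))"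
    by (rule survival_bound[OF d]) blast
  show ?thesis
  proof (rule tendsto_sandwich[OF _ _ tendsto_const])
    show "(\<lambda>n. C * (1 + \<bar>x\<bar>) / sqrt (real (Suc n))) \<longlonglongrightarrow> 0"
      by (rule real_tendsto_divide_at_top[OF tendsto_const])
         (intro filterlim_compose[OF sqrt_at_top] filterlim_compose[OF filterlim_real_sequentially] filterlim_Suc)
    show "\<forall>\<^sub>F n in sequentially. 0 \<le> killed (alive d) n (\<lambda>_. 1) x"
      by (intro always_eventually allI killed_nonneg) auto
  qed (use C in auto)
qed

text \<open>Each step taken alive adds \<open>\<sigma>\<^sup>2\<close> to the mean of the square,
  and killing only removes mass.\<close>

lemma killed_square_le:
  assumes A: "A \<in> sets borel"
  shows "killed A n (\<lambda>y. y\<^sup>2) x \<le> x\<^sup>2 + \<sigma>\<^sup>2 * (\<Sum>k<n. killed A k (\<lambda>_. 1) x)"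
proof (induction n)
  case (Suc n)
  have "killed A (Suc n) (\<lambda>y. y\<^sup>2) x = killed A n (killed A (Suc 0) (\<lambda>y. y\<^sup>2)) x"
    using killed_add[of A n "Suc 0" "\<lambda>y. y\<^sup>2"] by simp
  also have "\<dots> \<le> killed A n (\<lambda>y. 1 * y\<^sup>2 + \<sigma>\<^sup>2 * 1) x"
  proof (rule killed_mono)
    fix y assume y: "y \<in> A"
    have "killed A (Suc 0) (\<lambda>y. y\<^sup>2) y \<le> (\<integral>z. (y + z)\<^sup>2 \<partial>\<mu>)" by (rule killed_one_le[OF _ A _ y]) auto
    also have "\<dots> = (\<integral>z. y\<^sup>2 + z\<^sup>2 + 2 * y * z \<partial>\<mu>)" by (simp add: power2_sum)
    also have "\<dots> = y\<^sup>2 + \<sigma>\<^sup>2" using sq_int prob_space by (simp add: mean_zero second_moment)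
    finally show "killed A (Suc 0) (\<lambda>y. y\<^sup>2) y \<le> 1 * y\<^sup>2 + \<sigma>\<^sup>2 * 1" by simp
  qed (use A in auto)
  also have "\<dots> = killed A n (\<lambda>y. y\<^sup>2) x + \<sigma>\<^sup>2 * killed A n (\<lambda>_. 1) x"
    by (subst killed_lin) (use A in auto)
  finally show ?case using Suc by (simp add: distrib_left)
qed (simp add: killed_0 indicator_def)

text \<open>\<open>entrance d k g x\<close> is \<open>\<E>\<^sub>x (g S\<^sub>k; \<tau> = k)\<close>.\<close>

definition entrance :: "real \<Rightarrow> nat \<Rightarrow> (real \<Rightarrow> real) \<Rightarrow> real \<Rightarrow> real" where
  "entrance d k g = (step_op (alive d) ^^ k) (\<lambda>x. indicator {-d<..<d} x * g x)"

lemma entrance_0: "entrance d 0 g x = indicator {-d<..<d} x * g x"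
  and entrance_Suc: "entrance d (Suc k) g = step_op (alive d) (entrance d k g)"
  by (simp_all add: entrance_def)

lemma quad_bdd_entrance: "quad_bdd g \<Longrightarrow> quad_bdd (entrance d k g)"
proof (induction k)
  case 0 thus ?case by (simp add: entrance_def quad_bdd_indicator)
next
  case (Suc k) thus ?case by (simp add: entrance_Suc quad_bdd_step_op)
qed

lemma entrance_mono:
  assumes "quad_bdd f" "quad_bdd g" "\<And>y. \<bar>y\<bar> < d \<Longrightarrow> f y \<le> g y"
  shows "entrance d k f x \<le> entrance d k g x"
proof (induction k arbitrary: x)
  case 0 show ?case using assms(3) by (auto simp: entrance_0 indicator_def abs_less_iff)
next
  case (Suc k) thus ?case unfolding entrance_Suc
    by (intro step_op_mono quad_bdd_entrance assms)
qed

lemma entrance_cmult: "entrance d k (\<lambda>y. c * f y) x = c * entrance d k f x"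
proof (induction k arbitrary: x)
  case (Suc k)
  hence "entrance d k (\<lambda>y. c * f y) = (\<lambda>x. c * entrance d k f x)" by auto
  thus ?case by (simp add: entrance_Suc step_op_cmult)
qed (simp add: entrance_0)

lemma entrance_nonneg: "quad_bdd f \<Longrightarrow> (\<And>y. \<bar>y\<bar> < d \<Longrightarrow> 0 \<le> f y) \<Longrightarrow> 0 \<le> entrance d k f x"
  using entrance_mono[of "\<lambda>_. 0" f d k x] entrance_cmult[of d k 0 "\<lambda>_. 0" x] by simp

lemma entrance_abs_le:
  assumes "quad_bdd g" "\<And>y. \<bar>y\<bar> < d \<Longrightarrow> \<bar>g y\<bar> \<le> c"
  shows "\<bar>entrance d k g x\<bar> \<le> c * entrance d k (\<lambda>_. 1) x"
proof -
  have "entrance d k g x \<le> entrance d k (\<lambda>_. c * 1) x"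
    using assms by (intro entrance_mono) force+
  moreover have "entrance d k (\<lambda>y. (-1) * g y) x \<le> entrance d k (\<lambda>_. c * 1) x"
    using assms by (intro entrance_mono) force+
  ultimately show ?thesis unfolding entrance_cmult by linarith
qed

text \<open>A path either avoids \<open>(-d, d)\<close> up to time \<open>n\<close>, or enters it at
  some \<open>k \<le> n\<close> and then runs freely for \<open>n - k\<close> steps. The start lies
  in the state space because \<open>alive d\<close> also kills outside of it, which is not an
  entrance.\<close>

lemma first_entrance:
  assumes g: "quad_bdd g" and x: "x \<in> state_space \<mu>"
  shows "killed UNIV n g x = killed (alive d) n g x + (\<Sum>k\<le>n. entrance d k (killed UNIV (n - k) g) x)"
  using x
proof (induction n arbitrary: x)
  case 0 thus ?case by (auto simp: killed_0 entrance_0 indicator_def alive_def)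
next
  case (Suc n)
  have split: "(\<Sum>k\<le>Suc n. entrance d k (killed UNIV (Suc n - k) g) x)
      = entrance d 0 (killed UNIV (Suc n) g) x + (\<Sum>k\<le>n. entrance d (Suc k) (killed UNIV (n - k) g) x)"
    by (subst sum.atMost_Suc_shift) simp
  have qK: "quad_bdd (killed UNIV m g)" for m using g by auto
  show ?case
  proof (cases "x \<in> alive d")
    case False
    hence "x \<in> {-d<..<d}" using Suc.prems by (auto simp: alive_def)
    thus ?thesis unfolding split using False
      by (simp add: entrance_0 entrance_Suc killed_outside step_op_def)
  next
    case True
    hence nx: "x \<notin> {-d<..<d}" by (auto simp: alive_def)
    have "killed UNIV (Suc n) g x = (\<integral>y. killed UNIV n g (x + y) \<partial>\<mu>)"
      by (simp add: killed_Suc step_op_def)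
    also have "\<dots> = (\<integral>y. killed (alive d) n g (x + y) + (\<Sum>k\<le>n. entrance d k (killed UNIV (n - k) g) (x + y)) \<partial>\<mu>)"
    proof (rule integral_cong_AE)
      show "AE y in \<mu>. killed UNIV n g (x + y)
          = killed (alive d) n g (x + y) + (\<Sum>k\<le>n. entrance d k (killed UNIV (n - k) g) (x + y))"
        using AE_state_space[OF Suc.prems] by eventually_elim (rule Suc.IH)
      show "(\<lambda>y. killed UNIV n g (x + y)) \<in> borel_measurable \<mu>"
        by (rule borel_measurable_integrable[OF quad_bdd_integrable[OF qK]])
      have "quad_bdd (\<lambda>x. killed (alive d) n g x + (\<Sum>k\<le>n. entrance d k (killed UNIV (n - k) g) x))"
        using g qK by (intro quad_bdd_add quad_bdd_sum quad_bdd_entrance quad_bdd_killed) auto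
      from borel_measurable_integrable[OF quad_bdd_integrable[OF this, of x]]
      show "(\<lambda>y. killed (alive d) n g (x + y) + (\<Sum>k\<le>n. entrance d k (killed UNIV (n - k) g) (x + y)))
          \<in> borel_measurable \<mu>" .
    qed
    also have "\<dots> = (\<integral>y. killed (alive d) n g (x + y) \<partial>\<mu>)
        + (\<Sum>k\<le>n. \<integral>y. entrance d k (killed UNIV (n - k) g) (x + y) \<partial>\<mu>)"
      using quad_bdd_integrable[OF quad_bdd_killed[OF g sets_alive], of d n x]
        quad_bdd_integrable[OF quad_bdd_entrance[OF qK], where x=x]
      by (simp add: Bochner_Integration.integral_add Bochner_Integration.integral_sum)
    also have "\<dots> = killed (alive d) (Suc n) g x + (\<Sum>k\<le>n. entrance d (Suc k) (killed UNIV (n - k) g) x)"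
      using True by (simp add: killed_Suc entrance_Suc step_op_def)
    finally show ?thesis unfolding split using nx by (simp add: entrance_0)
  qed
qed

lemma sum_entrance_le_1:
  assumes "x \<in> state_space \<mu>" shows "(\<Sum>k\<le>n. entrance d k (\<lambda>_. 1) x) \<le> 1"
proof -
  have e: "killed UNIV m (\<lambda>_. 1) = (\<lambda>_. 1)" for m by (auto simp: killed_UNIV_one)
  have "0 \<le> killed (alive d) n (\<lambda>_. 1) x" by (rule killed_nonneg) auto
  thus ?thesis using first_entrance[OF quad_bdd_const assms, of n 1 d] unfolding e by simp
qed

end

section \<open>Crossing times of a path\<close>

lemma first_time_eqI: "A n \<Longrightarrow> (\<And>m. m < n \<Longrightarrow> \<not> A m) \<Longrightarrow> first_time A = enat n"
  unfolding first_time_def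
  by (intro antisym Inf_lower Inf_greatest) (auto simp: not_less[symmetric])

lemma first_time_infinite: "(\<And>n. \<not> A n) \<Longrightarrow> first_time A = \<infinity>"
  by (simp add: first_time_def top_enat_def)

lemma le_first_time_iff: "enat i \<le> first_time A \<longleftrightarrow> (\<forall>j<i. \<not> A j)"
  unfolding first_time_def le_Inf_iff by (auto simp: not_less[symmetric])

lemma first_time_or: "min (first_time A) (first_time B) = first_time (\<lambda>n. A n \<or> B n)"
  by (simp add: first_time_def Collect_disj_eq image_Un Inf_union_distrib inf_min)

lemma first_time_shift:
  assumes "\<not> A 0" shows "first_time A = eSuc (first_time (\<lambda>n. A (Suc n)))"
proof (cases "\<exists>n. A (Suc n)")
  case True
  define m where "m = (LEAST n. A (Suc n))"
  have m: "A (Suc m)" "\<And>j. j < m \<Longrightarrow> \<not> A (Suc j)"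
    unfolding m_def using True by (auto intro: LeastI_ex dest: not_less_Least)
  have "first_time A = enat (Suc m)"
    by (rule first_time_eqI) (use m assms in \<open>auto simp: less_Suc_eq_0_disj\<close>)
  moreover have "first_time (\<lambda>n. A (Suc n)) = enat m" by (rule first_time_eqI) (use m in auto)
  ultimately show ?thesis by (simp add: eSuc_enat)
next
  case False
  have "\<not> A n" for n using False assms by (cases n) auto
  thus ?thesis using first_time_infinite[of A] first_time_infinite[of "\<lambda>n. A (Suc n)"] by simp
qed

text \<open>Downward and upward crossings in one predicate, so that the minimum of two first times
  becomes a single first time.\<close>

definition crossing :: "real \<Rightarrow> (nat \<Rightarrow> real) \<Rightarrow> nat \<Rightarrow> bool" where
  "crossing d s n \<longleftrightarrow> (s (n - 1) \<ge> d \<and> s n < d) \<or> (s (n - 1) \<le> -d \<and> s n > -d)"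

lemma cross_time_Suc_eq:
  "cross_time d s (Suc k) = first_time (\<lambda>n. enat n > cross_time d s k \<and> crossing d s n)"
  unfolding cross_time.simps first_time_or crossing_def by (rule arg_cong[where f=first_time]) auto

declare cross_time.simps(2) [simp del]

text \<open>The induction step shared by the two shift rules below: \<open>k'\<close> counts the
  crossings of the shifted path and is \<open>k\<close> if the first step is a crossing,
  \<open>Suc k\<close> otherwise.\<close>

lemma cross_time_after:
  assumes "cross_time d s (Suc k) = eSuc T" "cross_time d (\<lambda>n. s (Suc n)) k' = T"
  shows "cross_time d s (Suc (Suc k)) = eSuc (cross_time d (\<lambda>n. s (Suc n)) (Suc k'))"
proof -
  have "cross_time d s (Suc (Suc k)) = first_time (\<lambda>n. enat n > eSuc T \<and> crossing d s n)"
    by (simp only: cross_time_Suc_eq[of d s "Suc k"] assms(1))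
  also have "\<dots> = eSuc (first_time (\<lambda>n. enat (Suc n) > eSuc T \<and> crossing d s (Suc n)))"
    by (rule first_time_shift) (simp add: zero_enat_def[symmetric])
  also have "(\<lambda>n. enat (Suc n) > eSuc T \<and> crossing d s (Suc n))
      = (\<lambda>n. enat n > T \<and> crossing d (\<lambda>n. s (Suc n)) n)"
  proof
    fix n show "(enat (Suc n) > eSuc T \<and> crossing d s (Suc n)) = (enat n > T \<and> crossing d (\<lambda>n. s (Suc n)) n)"
      by (cases n) (simp_all add: eSuc_enat[symmetric] zero_enat_def[symmetric] crossing_def)
  qed
  also have "first_time \<dots> = cross_time d (\<lambda>n. s (Suc n)) (Suc k')"
    by (simp only: cross_time_Suc_eq assms(2))
  finally show ?thesis .
qed

lemma cross_time_crossing: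
  assumes "crossing d s 1"
  shows "cross_time d s (Suc k) = eSuc (cross_time d (\<lambda>n. s (Suc n)) k)"
proof (induction k)
  case 0
  have "cross_time d s (Suc 0) = enat 1"
    unfolding cross_time_Suc_eq by (rule first_time_eqI) (use assms in \<open>auto simp: zero_enat_def\<close>)
  thus ?case by (simp add: zero_enat_def eSuc_enat)
next
  case (Suc k) thus ?case by (rule cross_time_after) simp
qed

lemma cross_time_no_crossing:
  assumes "\<not> crossing d s 1"
  shows "cross_time d s (Suc k) = eSuc (cross_time d (\<lambda>n. s (Suc n)) (Suc k))"
proof (induction k)
  case 0
  have "cross_time d s (Suc 0) = eSuc (first_time (\<lambda>n. enat (Suc n) > 0 \<and> crossing d s (Suc n)))"
    unfolding cross_time_Suc_eq cross_time.simps(1) by (rule first_time_shift) (simp add: zero_enat_def)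
  also have "(\<lambda>n. enat (Suc n) > 0 \<and> crossing d s (Suc n)) = (\<lambda>n. enat n > 0 \<and> crossing d (\<lambda>n. s (Suc n)) n)"
  proof
    fix n show "(enat (Suc n) > 0 \<and> crossing d s (Suc n)) = (enat n > 0 \<and> crossing d (\<lambda>n. s (Suc n)) n)"
      using assms by (cases n) (simp_all add: zero_enat_def crossing_def)
  qed
  finally show ?case by (simp only: cross_time_Suc_eq cross_time.simps(1))
next
  case (Suc k) thus ?case by (rule cross_time_after) simp
qed

lemma cross_pos_0 [simp]: "cross_pos d s 0 = s 0"
  by (simp add: cross_pos_def zero_enat_def)

lemma cross_pos_crossing:
  assumes "crossing d s 1" shows "cross_pos d s (Suc k) = cross_pos d (\<lambda>n. s (Suc n)) k"
  unfolding cross_pos_def cross_time_crossing[OF assms] by (simp add: eSuc_def split: enat.split)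

lemma cross_pos_no_crossing:
  assumes "\<not> crossing d s 1" shows "cross_pos d s (Suc k) = cross_pos d (\<lambda>n. s (Suc n)) (Suc k)"
  unfolding cross_pos_def cross_time_no_crossing[OF assms] by (simp add: eSuc_def split: enat.split)

definition landed :: "real \<Rightarrow> (nat \<Rightarrow> real) \<Rightarrow> nat \<Rightarrow> bool" where
  "landed d s k \<longleftrightarrow> cross_time d s k \<noteq> \<infinity> \<and> \<bar>cross_pos d s k\<bar> < d"

lemma landed_crossing:
  assumes "crossing d s 1" shows "landed d s (Suc k) = landed d (\<lambda>n. s (Suc n)) k"
  unfolding landed_def cross_pos_crossing[OF assms] cross_time_crossing[OF assms]
  by (simp add: eSuc_def split: enat.split)

lemma landed_no_crossing:
  assumes "\<not> crossing d s 1" shows "landed d s (Suc k) = landed d (\<lambda>n. s (Suc n)) (Suc k)"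
  unfolding landed_def cross_pos_no_crossing[OF assms] cross_time_no_crossing[OF assms]
  by (simp add: eSuc_def split: enat.split)

definition jump_sum :: "real \<Rightarrow> (nat \<Rightarrow> real) \<Rightarrow> ennreal" where
  "jump_sum d s = (\<Sum>i. if 1 \<le> i \<and> enat i \<le> kappa d s
     then ennreal \<bar>cross_pos d s i - cross_pos d s (i - 1)\<bar> else 0)"

text \<open>The summand of \<open>jump_sum\<close> with its index moved by one: the jump from
  \<open>H\<^sub>k\<close> to \<open>H\<^sub>k\<^sub>+\<^sub>1\<close> counts iff
  \<open>k + 1 \<le> \<kappa>\<close>. Landings are tested from index \<open>1\<close> on, as in
  \<open>kappa\<close>.\<close>

definition jump :: "real \<Rightarrow> (nat \<Rightarrow> real) \<Rightarrow> nat \<Rightarrow> ennreal" where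
  "jump d s k = (if \<forall>j. 1 \<le> j \<and> j \<le> k \<longrightarrow> \<not> landed d s j
     then ennreal \<bar>cross_pos d s (Suc k) - cross_pos d s k\<bar> else 0)"

lemma suminf_ennreal_Suc: "(\<Sum>i. f i) = f 0 + (\<Sum>i. f (Suc i))" for f :: "nat \<Rightarrow> ennreal"
  using sums_unique[OF sums_Suc[OF summable_sums[OF summableI, of "\<lambda>i. f (Suc i)"]]] by (simp add: add.commute)

lemma jump_sum_eq: "jump_sum d s = (\<Sum>k. jump d s k)"
proof -
  have k: "enat (Suc k) \<le> kappa d s \<longleftrightarrow> (\<forall>j. 1 \<le> j \<and> j \<le> k \<longrightarrow> \<not> landed d s j)" for k
    unfolding kappa_def le_first_time_iff landed_def by (auto simp: less_Suc_eq_le)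
  show ?thesis
    unfolding jump_sum_def by (subst suminf_ennreal_Suc) (simp add: k jump_def[abs_def] del: One_nat_def cong: if_cong)
qed

text \<open>The sum of the jumps between crossings, written step by step: each step counts as
  movement towards zero, with the sign of the point that it leaves. In this form it is an additive
  functional of the walk.\<close>

definition excursion_sum :: "(nat \<Rightarrow> real) \<Rightarrow> nat \<Rightarrow> real" where
  "excursion_sum s N = (\<Sum>j<N. sgn (s j) * (s j - s (Suc j)))"

lemma excursion_sum_Suc:
  "excursion_sum s (Suc N) = sgn (s 0) * (s 0 - s 1) + excursion_sum (\<lambda>n. s (Suc n)) N"
  unfolding excursion_sum_def by (subst sum.lessThan_Suc_shift) simp

text \<open>A step that keeps the sign changes the absolute value by exactly the signed decrement; a
  step across zero needs a correction by twice the distance landed beyond zero.\<close>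

lemma excursion_sum_eq:
  "excursion_sum s N = \<bar>s 0\<bar> - \<bar>s N\<bar> + 2 * (\<Sum>j<N. max 0 (- (sgn (s j) * s (Suc j))))"
  if "\<And>j. j < N \<Longrightarrow> s j \<noteq> 0"
  using that
proof (induction N)
  case (Suc N)
  have "sgn (s N) * (s N - s (Suc N)) = \<bar>s N\<bar> - \<bar>s (Suc N)\<bar> + 2 * max 0 (- (sgn (s N) * s (Suc N)))"
    using Suc.prems[of N] by (auto simp: sgn_if max_def abs_if)
  thus ?case using Suc by (simp add: excursion_sum_def)
qed (simp add: excursion_sum_def)

text \<open>Induction on the hitting time, removing the first step. A crossing step is a jump of its
  own; any other step only moves the origin of the first jump, by the amount \<open>c\<close>. The
  bound on the first crossing position is carried along because it determines the sign of the first
  jump.\<close>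

lemma jump_sum_excursion:
  assumes d: "d > 0" and N: "N \<ge> 1" and out: "\<And>j. j < N \<Longrightarrow> \<bar>s j\<bar> \<ge> d" and hit: "\<bar>s N\<bar> < d"
  shows "sgn (s 0) * cross_pos d s 1 < d \<and> jump_sum d s = ennreal (excursion_sum s N)"
  using N out hit
proof (induction N arbitrary: s)
  case (Suc M)
  let ?s = "\<lambda>n. s (Suc n)"
  have s0: "\<bar>s 0\<bar> \<ge> d" using Suc.prems(2)[of 0] by simp
  show ?case
  proof (cases "crossing d s 1")
    case True
    have H1: "cross_pos d s 1 = s 1" using cross_pos_crossing[OF True, of 0] by simp
    have sg: "sgn (s 0) * s 1 < d" using True s0 d by (auto simp: crossing_def sgn_if abs_if split: if_splits)
    have j0: "jump d s 0 = ennreal (sgn (s 0) * (s 0 - s 1))"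
    proof -
      have "\<bar>s 1 - s 0\<bar> = sgn (s 0) * (s 0 - s 1)" using s0 sg d by (auto simp: sgn_if abs_if split: if_splits)
      thus ?thesis using H1 by (simp add: jump_def)
    qed
    show ?thesis
    proof (cases "M = 0")
      case True': True
      have "landed d s 1" using landed_crossing[OF True, of 0] Suc.prems(3) True' by (simp add: landed_def)
      hence "jump d s (Suc k) = 0" for k by (force simp: jump_def)
      hence "jump_sum d s = jump d s 0" unfolding jump_sum_eq by (subst suminf_ennreal_Suc) simp
      thus ?thesis using H1 sg j0 True' by (simp add: excursion_sum_def)
    next
      case False
      have out': "\<And>j. j < M \<Longrightarrow> \<bar>?s j\<bar> \<ge> d" using Suc.prems(2) by auto
      have s1: "\<bar>s 1\<bar> \<ge> d" using out'[of 0] False by simp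
      have IH: "jump_sum d ?s = ennreal (excursion_sum ?s M)"
        using Suc.IH[of ?s] out' Suc.prems(3) False by simp
      have "jump d s (Suc k) = jump d ?s k" for k
      proof -
        have "(\<forall>j. 1 \<le> j \<and> j \<le> Suc k \<longrightarrow> \<not> landed d s j) \<longleftrightarrow> (\<forall>j\<le>k. \<not> landed d s (Suc j))"
        proof (intro iffI allI impI)
          fix j assume "\<forall>j\<le>k. \<not> landed d s (Suc j)" "1 \<le> j \<and> j \<le> Suc k"
          thus "\<not> landed d s j" by (cases j) auto
        qed auto
        also have "\<dots> \<longleftrightarrow> (\<forall>j\<le>k. \<not> landed d ?s j)" by (simp add: landed_crossing[OF True])
        also have "\<dots> \<longleftrightarrow> (\<forall>j. 1 \<le> j \<and> j \<le> k \<longrightarrow> \<not> landed d ?s j)"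
        proof (intro iffI allI impI)
          fix j assume "\<forall>j. 1 \<le> j \<and> j \<le> k \<longrightarrow> \<not> landed d ?s j" "j \<le> k"
          thus "\<not> landed d ?s j" using s1 by (cases j) (auto simp: landed_def)
        qed auto
        finally show ?thesis unfolding jump_def cross_pos_crossing[OF True] by simp
      qed
      hence "jump_sum d s = jump d s 0 + jump_sum d ?s"
        unfolding jump_sum_eq by (subst suminf_ennreal_Suc) simp
      also have "\<dots> = ennreal (excursion_sum s (Suc M))"
      proof -
        have "0 \<le> sgn (s 0) * (s 0 - s 1)" using sg s0 d by (auto simp: sgn_if abs_if split: if_splits)
        moreover have "0 \<le> excursion_sum ?s M"
        proof -
          have "excursion_sum ?s M = \<bar>s 1\<bar> - \<bar>?s M\<bar> + 2 * (\<Sum>j<M. max 0 (- (sgn (?s j) * ?s (Suc j))))"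
            using excursion_sum_eq[of M ?s] out' d by force
          moreover have "0 \<le> (\<Sum>j<M. max 0 (- (sgn (?s j) * ?s (Suc j))))" by (rule sum_nonneg) simp
          ultimately show ?thesis using s1 Suc.prems(3) by simp
        qed
        ultimately show ?thesis unfolding j0 IH excursion_sum_Suc by (rule ennreal_plus[symmetric])
      qed
      finally show ?thesis using H1 sg by simp
    qed
  next
    case False
    \<comment> \<open>Entering \<open>(-d, d)\<close> from outside is itself a crossing, so a path
      whose first step is no crossing has not hit the interval yet.\<close>
    have M: "M \<ge> 1"
    proof (rule ccontr)
      assume "\<not> M \<ge> 1"
      hence "M = 0" by simp
      hence "\<bar>s 1\<bar> < d" using Suc.prems(3) by simp
      thus False using False s0 by (auto simp: crossing_def abs_if split: if_splits)
    qed
    have out': "\<And>j. j < M \<Longrightarrow> \<bar>?s j\<bar> \<ge> d" using Suc.prems(2) by auto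
    have s1: "\<bar>s 1\<bar> \<ge> d" using out'[of 0] M by simp
    have same: "sgn (s 1) = sgn (s 0)" using False s0 s1 d by (auto simp: crossing_def sgn_if abs_if split: if_splits)
    have IH: "sgn (s 1) * cross_pos d ?s 1 < d" "jump_sum d ?s = ennreal (excursion_sum ?s M)"
      using Suc.IH[of ?s] M out' Suc.prems(3) by auto
    have H1: "cross_pos d s 1 = cross_pos d ?s 1" using cross_pos_no_crossing[OF False, of 0] by simp
    have land: "(\<forall>j. 1 \<le> j \<and> j \<le> k \<longrightarrow> \<not> landed d s j) \<longleftrightarrow> (\<forall>j. 1 \<le> j \<and> j \<le> k \<longrightarrow> \<not> landed d ?s j)" for k
    proof -
      have "landed d s j = landed d ?s j" if "1 \<le> j" for j
        using landed_no_crossing[OF False, of "j - 1"] that by simp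
      thus ?thesis by auto
    qed
    have jS: "jump d s (Suc k) = jump d ?s (Suc k)" for k
      unfolding jump_def land cross_pos_no_crossing[OF False] by simp
    define h where "h = cross_pos d ?s 1"
    define c where "c = sgn (s 0) * (s 0 - s 1)"
    have "\<bar>h - s 1\<bar> = sgn (s 0) * (s 1 - h)"
      using IH(1) s1 d unfolding h_def[symmetric] same[symmetric] by (auto simp: sgn_if abs_if split: if_splits)
    moreover have "\<bar>h - s 0\<bar> = sgn (s 0) * (s 0 - h)"
      using IH(1) s0 d unfolding h_def[symmetric] same by (auto simp: sgn_if abs_if split: if_splits)
    ultimately have rel: "\<bar>h - s 0\<bar> = \<bar>h - s 1\<bar> + c" by (simp add: c_def algebra_simps)
    have j0: "jump d s 0 = ennreal (\<bar>h - s 1\<bar> + c)" "jump d ?s 0 = ennreal \<bar>h - s 1\<bar>"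
      using H1 rel by (simp_all add: jump_def h_def)
    define rest where "rest = (\<Sum>k. jump d ?s (Suc k))"
    have D': "jump_sum d ?s = ennreal \<bar>h - s 1\<bar> + rest"
      unfolding jump_sum_eq rest_def j0(2)[symmetric] by (rule suminf_ennreal_Suc)
    have D: "jump_sum d s = ennreal (\<bar>h - s 1\<bar> + c) + rest"
      unfolding jump_sum_eq rest_def j0(1)[symmetric] jS[symmetric] by (rule suminf_ennreal_Suc)
    \<comment> \<open>The amount \<open>c\<close> may be negative, so the relation is moved to real
      numbers; this requires the other jumps to have a finite sum.\<close>
    have "rest < \<infinity>" using IH(2) unfolding D' by (auto simp: less_top[symmetric])
    then obtain r where r: "rest = ennreal r" "r \<ge> 0" by (cases rest) auto
    have eq: "ennreal (\<bar>h - s 1\<bar> + r) = ennreal (excursion_sum ?s M)"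
      using IH(2) r unfolding D' by simp
    have nn: "0 \<le> excursion_sum ?s M"
    proof -
      have "excursion_sum ?s M = \<bar>s 1\<bar> - \<bar>?s M\<bar> + 2 * (\<Sum>j<M. max 0 (- (sgn (?s j) * ?s (Suc j))))"
        using excursion_sum_eq[of M ?s] out' d by force
      moreover have "0 \<le> (\<Sum>j<M. max 0 (- (sgn (?s j) * ?s (Suc j))))" by (rule sum_nonneg) simp
      ultimately show ?thesis using s1 Suc.prems(3) by simp
    qed
    have e: "\<bar>h - s 1\<bar> + r = excursion_sum ?s M"
      using iffD1[OF ennreal_inj[OF _ nn] eq] r(2) by simp
    have "0 \<le> \<bar>h - s 1\<bar> + c" using rel by (metis abs_ge_zero)
    hence "jump_sum d s = ennreal (\<bar>h - s 1\<bar> + c + r)"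
      unfolding D r(1) using r(2) by (rule ennreal_plus[symmetric])
    also have "\<bar>h - s 1\<bar> + c + r = excursion_sum s (Suc M)"
      unfolding excursion_sum_Suc using e by (simp add: c_def)
    finally show ?thesis using IH(1) H1 same by simp
  qed
qed simp

section \<open>The harmonic function\<close>

text \<open>The event \<open>\<tau> = N\<close> for a path; \<open>N = 0\<close> describes a start
  inside the interval.\<close>

definition hits_at :: "real \<Rightarrow> (nat \<Rightarrow> real) \<Rightarrow> nat \<Rightarrow> bool" where
  "hits_at d s N \<longleftrightarrow> (\<forall>j<N. d \<le> \<bar>s j\<bar>) \<and> \<bar>s N\<bar> < d"

lemma ex_hits_at: assumes "\<bar>s n\<bar> < d" shows "\<exists>N. hits_at d s N"
proof -
  define N where "N = (LEAST n. \<bar>s n\<bar> < d)"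
  have "\<bar>s N\<bar> < d" unfolding N_def using assms by (rule LeastI)
  moreover have "d \<le> \<bar>s j\<bar>" if "j < N" for j
    using not_less_Least[OF that[unfolded N_def]] by simp
  ultimately show ?thesis unfolding hits_at_def by blast
qed

lemma hits_at_case_nat: "d \<le> \<bar>x\<bar> \<Longrightarrow> hits_at d (case_nat x t) (Suc N) \<longleftrightarrow> hits_at d t N"
  by (auto simp: hits_at_def less_Suc_eq_0_disj split: nat.split)

text \<open>Unlike \<open>jump_sum\<close>, this vanishes for paths that start in \<open>(-d, d)\<close>.\<close>

definition jumps :: "real \<Rightarrow> (nat \<Rightarrow> real) \<Rightarrow> ennreal" where
  "jumps d s = (if \<bar>s 0\<bar> < d then 0 else jump_sum d s)"

lemma jumps_inside: "\<bar>s 0\<bar> < d \<Longrightarrow> jumps d s = 0"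
  by (simp add: jumps_def)

lemma jumps_eq:
  assumes "d > 0" "hits_at d s N" shows "jumps d s = ennreal (excursion_sum s N)"
proof (cases "N = 0")
  case True
  thus ?thesis using assms(2) by (simp add: jumps_def hits_at_def excursion_sum_def)
next
  case False
  thus ?thesis using jump_sum_excursion[OF assms(1), of N s] assms(2) by (auto simp: jumps_def hits_at_def)
qed

lemma sgn_cross_pos_1:
  assumes "d > 0" "hits_at d s N" "d \<le> \<bar>s 0\<bar>"
  shows "sgn (s 0) * cross_pos d s 1 < d"
proof -
  have "N \<ge> 1" using assms by (cases N) (auto simp: hits_at_def)
  thus ?thesis using jump_sum_excursion[OF assms(1), of N s] assms(2) by (auto simp: hits_at_def)
qed

lemma excursion_sum_hits:
  assumes "d > 0" "hits_at d s N"
  shows "excursion_sum s N = \<bar>s 0\<bar> - \<bar>s N\<bar> + 2 * (\<Sum>j<N. max 0 (- (sgn (s j) * s (Suc j))))"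
proof (rule excursion_sum_eq)
  show "s j \<noteq> 0" if "j < N" for j using assms that unfolding hits_at_def by (cases "s j = 0") force+
qed

lemma excursion_sum_ge:
  assumes "d > 0" "hits_at d s N" shows "\<bar>s 0\<bar> - d \<le> excursion_sum s N" "0 \<le> excursion_sum s N"
proof -
  have "0 \<le> (\<Sum>j<N. max 0 (- (sgn (s j) * s (Suc j))))" by (rule sum_nonneg) simp
  moreover have "\<bar>s N\<bar> < d" using assms(2) by (simp add: hits_at_def)
  ultimately show *: "\<bar>s 0\<bar> - d \<le> excursion_sum s N" using excursion_sum_hits[OF assms] by linarith
  show "0 \<le> excursion_sum s N"
  proof (cases "N = 0")
    case False
    hence "d \<le> \<bar>s 0\<bar>" using assms(2) by (simp add: hits_at_def)
    thus ?thesis using * by linarith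
  qed (simp add: excursion_sum_def)
qed

text \<open>The first-step relation for the sum of the jumps. The signed first step can have either
  sign and \<open>[0, \<infinity>]\<close> has no true subtraction, so its positive and negative
  parts stand on different sides.\<close>

lemma jumps_case_nat:
  assumes d: "d > 0" and h: "hits_at d t N" and x: "d \<le> \<bar>x\<bar>"
  shows "jumps d (case_nat x t) + ennreal (max 0 (sgn x * (t 0 - x))) = jumps d t + ennreal (max 0 (- (sgn x * (t 0 - x))))"
proof -
  have h': "hits_at d (case_nat x t) (Suc N)" using h x hits_at_case_nat by blast
  have "excursion_sum (case_nat x t) (Suc N) = sgn x * (x - t 0) + excursion_sum t N"
    by (subst excursion_sum_Suc) simp
  hence "excursion_sum (case_nat x t) (Suc N) + max 0 (sgn x * (t 0 - x)) = excursion_sum t N + max 0 (- (sgn x * (t 0 - x)))"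
    by (simp add: max_def algebra_simps)
  moreover have "ennreal (excursion_sum (case_nat x t) (Suc N)) + ennreal (max 0 (sgn x * (t 0 - x)))
      = ennreal (excursion_sum (case_nat x t) (Suc N) + max 0 (sgn x * (t 0 - x)))"
    using excursion_sum_ge(2)[OF d h'] by (rule ennreal_plus[symmetric]) simp
  moreover have "ennreal (excursion_sum t N) + ennreal (max 0 (- (sgn x * (t 0 - x))))
      = ennreal (excursion_sum t N + max 0 (- (sgn x * (t 0 - x))))"
    using excursion_sum_ge(2)[OF d h] by (rule ennreal_plus[symmetric]) simp
  ultimately show ?thesis unfolding jumps_eq[OF d h] jumps_eq[OF d h'] by (simp only:)
qed

text \<open>Dropping the final absolute value and replacing the hitting time by the condition that
  the path is still outside turns the bound into a sum over all times, to each of which the Markov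
  property applies.\<close>

lemma jumps_le:
  assumes d: "d > 0" and h: "hits_at d s N"
  shows "jumps d s \<le> ennreal \<bar>s 0\<bar> + 2 * (\<Sum>j. if \<forall>i\<le>j. d \<le> \<bar>s i\<bar> then ennreal (max 0 (- (sgn (s j) * s (Suc j)))) else 0)"
proof -
  let ?f = "\<lambda>j. max 0 (- (sgn (s j) * s (Suc j)))"
  let ?g = "\<lambda>j. if \<forall>i\<le>j. d \<le> \<bar>s i\<bar> then ennreal (?f j) else 0"
  have "jumps d s \<le> ennreal (\<bar>s 0\<bar> + 2 * (\<Sum>j<N. ?f j))"
    unfolding jumps_eq[OF d h] excursion_sum_hits[OF d h] by (rule ennreal_leI) simp
  also have "\<dots> = ennreal \<bar>s 0\<bar> + 2 * (\<Sum>j<N. ennreal (?f j))"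
  proof -
    have "0 \<le> (\<Sum>j<N. ?f j)" by (rule sum_nonneg) simp
    hence "ennreal (\<bar>s 0\<bar> + 2 * (\<Sum>j<N. ?f j)) = ennreal \<bar>s 0\<bar> + 2 * ennreal (\<Sum>j<N. ?f j)"
      by (simp only: ennreal_plus ennreal_mult abs_ge_zero mult_nonneg_nonneg zero_le_numeral ennreal_numeral)
    also have "ennreal (\<Sum>j<N. ?f j) = (\<Sum>j<N. ennreal (?f j))" by (rule sum_ennreal[symmetric]) simp
    finally show ?thesis .
  qed
  also have "(\<Sum>j<N. ennreal (?f j)) = (\<Sum>j<N. ?g j)"
    using h by (intro sum.cong) (auto simp: hits_at_def)
  also have "\<dots> \<le> (\<Sum>j. ?g j)" by (rule sum_le_suminf) auto
  finally show ?thesis by (simp add: add_left_mono mult_left_mono)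
qed

section \<open>Measurability of the crossing functionals\<close>

lemma crossing_measurable [measurable]: "Measurable.pred path_space (\<lambda>s. crossing d s n)"
  unfolding crossing_def by measurable

lemma first_time_measurable [measurable]:
  assumes [measurable]: "\<And>n :: nat. Measurable.pred M (A n)"
  shows "(\<lambda>s. first_time (\<lambda>n. A n s)) \<in> measurable M (count_space UNIV)"
proof -
  have eq: "first_time (\<lambda>n. A n s) = (if \<exists>n. A n s then enat (LEAST n. A n s) else \<infinity>)" for s
  proof (cases "\<exists>n. A n s")
    case True
    hence "first_time (\<lambda>n. A n s) = enat (LEAST n. A n s)"
      by (intro first_time_eqI) (auto intro: LeastI_ex dest: not_less_Least)
    thus ?thesis using True by simp
  qed (auto intro: first_time_infinite)
  have "(\<lambda>s. LEAST n. A n s) \<in> measurable M (count_space UNIV)" by measurable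
  from measurable_compose[OF this, of enat "count_space UNIV"]
  have [measurable]: "(\<lambda>s. enat (LEAST n. A n s)) \<in> measurable M (count_space UNIV)" by simp
  show ?thesis unfolding eq by measurable
qed

lemma cross_time_measurable [measurable]: "(\<lambda>s. cross_time d s k) \<in> measurable path_space (count_space UNIV)"
proof (induction k)
  case (Suc k)
  have [measurable]: "Measurable.pred path_space (\<lambda>s. cross_time d s k < enat n)" for n
    using measurable_compose[OF Suc, of "\<lambda>t. t < enat n" "count_space UNIV"] by (simp add: pred_def)
  show ?case unfolding cross_time_Suc_eq by measurable
qed simp

lemma cross_pos_measurable [measurable]: "(\<lambda>s. cross_pos d s k) \<in> borel_measurable path_space"
  unfolding cross_pos_def
proof (rule measurable_compose_countable[OF _ cross_time_measurable])
  fix t :: enat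
  show "(\<lambda>s. case t of enat n \<Rightarrow> s n | \<infinity> \<Rightarrow> 0) \<in> borel_measurable path_space"
    by (cases t) auto
qed

lemma jump_sum_measurable [measurable]: "jump_sum d \<in> borel_measurable path_space"
proof -
  have [measurable]: "Measurable.pred path_space (\<lambda>s. cross_time d s k \<noteq> \<infinity>)" for k
    using measurable_compose[OF cross_time_measurable, of "\<lambda>t. t \<noteq> \<infinity>" "count_space UNIV"] by (simp add: pred_def)
  have k: "kappa d \<in> measurable path_space (count_space UNIV)"
    unfolding kappa_def[abs_def] by measurable
  have [measurable]: "Measurable.pred path_space (\<lambda>s. enat i \<le> kappa d s)" for i
    using measurable_compose[OF k, of "\<lambda>t. enat i \<le> t" "count_space UNIV"] by (simp add: pred_def)
  show ?thesis unfolding jump_sum_def[abs_def] by measurable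
qed

lemma jumps_measurable [measurable]: "jumps d \<in> borel_measurable path_space"
  unfolding jumps_def[abs_def] by measurable

section \<open>The mean sum of jumps with values in the extended half-line\<close>

context centred_walk
begin

text \<open>The walk almost surely stays in the state space. This reconciles events about paths,
  which mention only \<open>d \<le> \<bar>y\<bar>\<close>, with \<open>alive d\<close>.\<close>

lemma killed_alive_eq:
  assumes "quad_bdd f" "x \<in> state_space \<mu>"
  shows "killed {y. d \<le> \<bar>y\<bar>} n f x = killed (alive d) n f x"
  using assms(2)
proof (induction n arbitrary: x)
  case 0 thus ?case by (simp add: killed_0 alive_def indicator_def)
next
  case (Suc n)
  have B: "{y. d \<le> \<bar>y\<bar>} \<in> sets borel" by measurable
  have "(\<integral>y. killed {y. d \<le> \<bar>y\<bar>} n f (x + y) \<partial>\<mu>) = (\<integral>y. killed (alive d) n f (x + y) \<partial>\<mu>)"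
  proof (rule integral_cong_AE)
    show "AE y in \<mu>. killed {y. d \<le> \<bar>y\<bar>} n f (x + y) = killed (alive d) n f (x + y)"
      using AE_state_space[OF Suc.prems] by eventually_elim (rule Suc.IH)
    show "(\<lambda>y. killed {y. d \<le> \<bar>y\<bar>} n f (x + y)) \<in> borel_measurable \<mu>"
      by (rule borel_measurable_integrable[OF quad_bdd_integrable[OF quad_bdd_killed[OF assms(1) B]]])
    show "(\<lambda>y. killed (alive d) n f (x + y)) \<in> borel_measurable \<mu>"
      by (rule borel_measurable_integrable[OF quad_bdd_integrable[OF quad_bdd_killed[OF assms(1) sets_alive]]])
  qed
  thus ?case using Suc.prems by (simp add: killed_Suc step_op_def alive_def indicator_def)
qed

text \<open>A walk that never enters survives up to every \<open>n\<close>, and the survival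
  probabilities tend to zero. This gives access to the path identities, which presuppose a finite
  hitting time.\<close>

lemma AE_hits:
  assumes d: "d > 0" and x: "x \<in> state_space \<mu>"
  shows "AE s in incr. \<exists>N. hits_at d (wpath x s) N"
proof -
  interpret I: prob_space incr by (rule prob_space_incr)
  let ?E = "\<lambda>n. {s. \<forall>k\<le>n. wpath x s k \<in> {y. d \<le> \<bar>y\<bar>}}"
  let ?N = "{s. \<forall>k. d \<le> \<bar>wpath x s k\<bar>}"
  have ms: "{s. Q s} \<in> sets incr" if "Measurable.pred path_space Q" for Q
    using that by (auto simp: sets_incr pred_def space_PiM PiE_UNIV_domain)
  have N: "?N \<in> sets incr" by (rule ms) measurable
  have E: "?E n \<in> sets incr" for n by (rule ms) measurable
  have "measure incr ?N \<le> killed (alive d) n (\<lambda>_. 1) x" for n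
  proof -
    have "measure incr ?N \<le> measure incr (?E n)" by (rule I.finite_measure_mono[OF _ E]) auto
    also have "\<dots> = killed {y. d \<le> \<bar>y\<bar>} n (\<lambda>_. 1) x" by (rule prob_path_killed) measurable
    also have "\<dots> = killed (alive d) n (\<lambda>_. 1) x" by (rule killed_alive_eq[OF _ x]) simp
    finally show ?thesis .
  qed
  hence "measure incr ?N \<le> 0" by (intro LIMSEQ_le_const[OF survival_tendsto_0[OF d, of x]]) auto
  hence "measure incr ?N = 0" using measure_nonneg[of incr ?N] by linarith
  hence "?N \<in> null_sets incr" using N by (simp add: null_sets_def I.emeasure_eq_measure)
  from AE_not_in[OF this] show ?thesis
  proof eventually_elim
    case (elim s)
    then obtain k where "\<bar>wpath x s k\<bar> < d" by (auto simp: not_le)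
    thus ?case by (rule ex_hits_at)
  qed
qed

definition nnV :: "real \<Rightarrow> real \<Rightarrow> ennreal" where
  "nnV d x = (\<integral>\<^sup>+s. jumps d (wpath x s) \<partial>incr)"

lemma nnV_measurable [measurable]: "nnV d \<in> borel_measurable borel"
proof -
  interpret I: sigma_finite_measure incr by (rule prob_space_imp_sigma_finite[OF prob_space_incr])
  have "(\<lambda>(x, s). jumps d (wpath x s)) \<in> borel_measurable (borel \<Otimes>\<^sub>M incr)" by measurable
  thus ?thesis unfolding nnV_def[abs_def] by (rule I.borel_measurable_nn_integral)
qed

lemma nnV_inside: "\<bar>x\<bar> < d \<Longrightarrow> nnV d x = 0"
  by (simp add: nnV_def jumps_inside)

lemma nnV_ge:
  assumes "d > 0" "x \<in> state_space \<mu>"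
  shows "ennreal (\<bar>x\<bar> - d) \<le> nnV d x"
proof -
  have "ennreal (\<bar>x\<bar> - d) = (\<integral>\<^sup>+s. ennreal (\<bar>x\<bar> - d) \<partial>incr)"
    using prob_space.emeasure_space_1[OF prob_space_incr] by simp
  also have "\<dots> \<le> nnV d x" unfolding nnV_def
  proof (rule nn_integral_mono_AE)
    show "AE s in incr. ennreal (\<bar>x\<bar> - d) \<le> jumps d (wpath x s)"
      using AE_hits[OF assms]
    proof eventually_elim
      case (elim s)
      then obtain N where N: "hits_at d (wpath x s) N" by blast
      show ?case unfolding jumps_eq[OF assms(1) N] using excursion_sum_ge(1)[OF assms(1) N] by (intro ennreal_leI) simp
    qed
  qed
  finally show ?thesis .
qed

text \<open>A step \<open>z\<close> from \<open>y\<close> passes zero only if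
  \<open>\<bar>z\<bar> > \<bar>y\<bar>\<close>, and then lands at most
  \<open>\<bar>z\<bar> - \<bar>y\<bar>\<close> beyond it.\<close>

lemma nn_integral_backjump_le:
  assumes "y \<noteq> 0"
  shows "(\<integral>\<^sup>+z. ennreal (max 0 (- (sgn y * (y + z)))) \<partial>\<mu>) \<le> ennreal (excess \<bar>y\<bar>)"
proof -
  have "(\<integral>\<^sup>+z. ennreal (max 0 (- (sgn y * (y + z)))) \<partial>\<mu>) \<le> (\<integral>\<^sup>+z. ennreal (max 0 (\<bar>z\<bar> - \<bar>y\<bar>)) \<partial>\<mu>)"
    by (intro nn_integral_mono ennreal_leI) (use assms in \<open>auto simp: sgn_if max_def abs_if\<close>)
  also have "\<dots> = ennreal (excess \<bar>y\<bar>)"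
    unfolding excess_def by (rule nn_integral_eq_integral) auto
  finally show ?thesis .
qed

lemma nn_integral_wpath_1:
  assumes [measurable]: "f \<in> borel_measurable borel"
  shows "(\<integral>\<^sup>+s. f (wpath x s (Suc 0)) \<partial>incr) = (\<integral>\<^sup>+z. f (x + z) \<partial>\<mu>)"
proof -
  have m: "(\<lambda>s. f (wpath x s (Suc 0))) \<in> borel_measurable path_space" by measurable
  show ?thesis using prob_space.emeasure_space_1[OF prob_space_incr]
    by (subst nn_integral_incr_step[OF m]) (simp add: wpath_def)
qed

definition backjump :: "real \<Rightarrow> (nat \<Rightarrow> real) \<Rightarrow> nat \<Rightarrow> ennreal" where
  "backjump d s j = (if \<forall>i\<le>j. d \<le> \<bar>s i\<bar> then ennreal (max 0 (- (sgn (s j) * s (Suc j)))) else 0)"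

lemma backjump_measurable [measurable]: "(\<lambda>s. backjump d s j) \<in> borel_measurable path_space"
  unfolding backjump_def by measurable

lemma backjump_wpath_measurable [measurable]: "(\<lambda>s. backjump d (wpath x s) j) \<in> borel_measurable incr"
proof -
  have "(\<lambda>s. wpath x s) \<in> measurable path_space path_space" by measurable
  from measurable_compose[OF this backjump_measurable] show ?thesis by measurable
qed

text \<open>The Markov property at time \<open>j\<close> bounds the mean backjump at that time by
  the killed expectation of \<open>excess\<close>; the sum over \<open>j\<close> is then bounded by
  \<open>E\<close>.\<close>

lemma suminf_backjump_le:
  assumes d: "d > 0" and x: "x \<in> state_space \<mu>"
    and E: "\<And>n. (\<Sum>j<n. killed (alive d) j (\<lambda>y. excess \<bar>y\<bar>) x) \<le> E"
  shows "(\<Sum>j. \<integral>\<^sup>+s. backjump d (wpath x s) j \<partial>incr) \<le> ennreal E"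
proof -
  let ?B = "{y. d \<le> \<bar>y\<bar>} :: real set"
  have B [measurable]: "?B \<in> sets borel" by measurable
  let ?\<Psi> = "\<lambda>s :: nat \<Rightarrow> real. ennreal (max 0 (- (sgn (s 0) * s (Suc 0))))"
  have \<Psi>m: "?\<Psi> \<in> borel_measurable path_space" by measurable
  have a0: "0 \<le> killed (alive d) j (\<lambda>y. excess \<bar>y\<bar>) x" for j
    by (rule killed_nonneg[OF quad_bdd_excess]) (auto simp: excess_nonneg)
  have gj: "(\<integral>\<^sup>+s. backjump d (wpath x s) j \<partial>incr) \<le> ennreal (killed (alive d) j (\<lambda>y. excess \<bar>y\<bar>) x)" for j
  proof -
    have "(\<integral>\<^sup>+s. backjump d (wpath x s) j \<partial>incr)
        = (\<integral>\<^sup>+s. (if \<forall>i\<le>j. wpath x s i \<in> ?B then ?\<Psi> (\<lambda>k. wpath x s (j + k)) else 0) \<partial>incr)"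
      by (intro nn_integral_cong) (auto simp: backjump_def)
    also have "\<dots> = nn_killed ?B j (\<lambda>y. \<integral>\<^sup>+s. ?\<Psi> (wpath y s) \<partial>incr) x"
      by (rule nn_integral_killed_path[OF \<Psi>m B])
    also have "\<dots> \<le> nn_killed ?B j (\<lambda>y. ennreal (excess \<bar>y\<bar>)) x"
    proof (rule nn_killed_mono)
      fix y assume "y \<in> ?B"
      hence y: "y \<noteq> 0" using d by auto
      have "(\<integral>\<^sup>+s. ?\<Psi> (wpath y s) \<partial>incr) = (\<integral>\<^sup>+z. ennreal (max 0 (- (sgn y * (y + z)))) \<partial>\<mu>)"
        using nn_integral_wpath_1[of "\<lambda>u. ennreal (max 0 (- (sgn y * u)))" y] by simp
      thus "(\<integral>\<^sup>+s. ?\<Psi> (wpath y s) \<partial>incr) \<le> ennreal (excess \<bar>y\<bar>)" using nn_integral_backjump_le[OF y] by simp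
    qed
    also have "\<dots> = ennreal (killed ?B j (\<lambda>y. excess \<bar>y\<bar>) x)"
      by (rule nn_killed_eq_ennreal[OF quad_bdd_excess B excess_nonneg])
    also have "\<dots> = ennreal (killed (alive d) j (\<lambda>y. excess \<bar>y\<bar>) x)"
      by (simp add: killed_alive_eq[OF quad_bdd_excess x])
    finally show ?thesis .
  qed
  have "(\<Sum>j. \<integral>\<^sup>+s. backjump d (wpath x s) j \<partial>incr) \<le> (\<Sum>j. ennreal (killed (alive d) j (\<lambda>y. excess \<bar>y\<bar>) x))"
    by (intro suminf_le gj summableI)
  also have "\<dots> \<le> ennreal E"
  proof -
    have sm: "summable (\<lambda>j. killed (alive d) j (\<lambda>y. excess \<bar>y\<bar>) x)"
      by (rule summableI_nonneg_bounded[OF a0 E])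
    have "(\<Sum>j. ennreal (killed (alive d) j (\<lambda>y. excess \<bar>y\<bar>) x)) = ennreal (\<Sum>j. killed (alive d) j (\<lambda>y. excess \<bar>y\<bar>) x)"
      by (rule suminf_ennreal2[OF a0 sm])
    also have "\<dots> \<le> ennreal E" by (intro ennreal_leI suminf_le_const[OF sm] E)
    finally show ?thesis .
  qed
  finally show ?thesis .
qed

text \<open>The estimate at a fixed level \<open>d0\<close> serves every \<open>d \<ge> d0\<close>,
  as a path outside \<open>(-d, d)\<close> is also outside \<open>(-d0, d0)\<close> and so each
  backjump counted at level \<open>d\<close> is counted at level \<open>d0\<close>. The limit of
  \<open>V - U\<close> rests on this uniformity in \<open>d\<close>.\<close>

lemma nnV_le:
  assumes d0: "0 < d0" "d0 \<le> d" and x: "x \<in> state_space \<mu>"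
    and E: "\<And>n. (\<Sum>j<n. killed (alive d0) j (\<lambda>y. excess \<bar>y\<bar>) x) \<le> E"
  shows "nnV d x \<le> ennreal (\<bar>x\<bar> + 2 * E)"
proof -
  have d: "d > 0" using d0 by simp
  have "nnV d x \<le> (\<integral>\<^sup>+s. ennreal \<bar>x\<bar> + 2 * (\<Sum>j. backjump d0 (wpath x s) j) \<partial>incr)"
    unfolding nnV_def
  proof (rule nn_integral_mono_AE)
    show "AE s in incr. jumps d (wpath x s) \<le> ennreal \<bar>x\<bar> + 2 * (\<Sum>j. backjump d0 (wpath x s) j)"
      using AE_hits[OF d x]
    proof eventually_elim
      case (elim s)
      then obtain N where N: "hits_at d (wpath x s) N" by blast
      let ?s = "wpath x s"
      have "jumps d ?s \<le> ennreal \<bar>?s 0\<bar> + 2 * (\<Sum>j. if \<forall>i\<le>j. d \<le> \<bar>?s i\<bar> then ennreal (max 0 (- (sgn (?s j) * ?s (Suc j)))) else 0)"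
        by (rule jumps_le[OF d N])
      also have "\<dots> \<le> ennreal \<bar>?s 0\<bar> + 2 * (\<Sum>j. backjump d0 ?s j)"
        using d0(2) unfolding backjump_def
        by (intro add_left_mono mult_left_mono suminf_le summableI) (auto intro: order_trans)
      finally show ?case by simp
    qed
  qed
  also have "\<dots> = ennreal \<bar>x\<bar> + 2 * (\<Sum>j. \<integral>\<^sup>+s. backjump d0 (wpath x s) j \<partial>incr)"
    using prob_space.emeasure_space_1[OF prob_space_incr]
    by (subst nn_integral_add, simp, simp) (simp add: nn_integral_cmult nn_integral_suminf)
  also have "\<dots> \<le> ennreal \<bar>x\<bar> + 2 * ennreal E"
    by (intro add_left_mono mult_left_mono suminf_backjump_le d0 x E) simp
  also have "ennreal \<bar>x\<bar> + 2 * ennreal E = ennreal (\<bar>x\<bar> + 2 * E)"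
    using E[of 0] by (simp add: ennreal_plus ennreal_mult)
  finally show ?thesis .
qed

lemma nn_integral_max_sgn: "x \<noteq> 0 \<Longrightarrow> (\<integral>\<^sup>+y. ennreal (max 0 (sgn x * y)) \<partial>\<mu>) = ennreal mean_pos"
  "x \<noteq> 0 \<Longrightarrow> (\<integral>\<^sup>+y. ennreal (max 0 (- (sgn x * y))) \<partial>\<mu>) = ennreal mean_pos"
proof -
  assume "x \<noteq> 0"
  hence e: "sgn x = 1 \<or> sgn x = -1" by (auto simp: sgn_if)
  have "(\<integral>\<^sup>+y. ennreal (max 0 y) \<partial>\<mu>) = ennreal mean_pos"
    unfolding mean_pos_def by (rule nn_integral_eq_integral) auto
  moreover have "(\<integral>\<^sup>+y. ennreal (max 0 (- y)) \<partial>\<mu>) = ennreal mean_pos"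
    unfolding mean_pos_eq_neg[symmetric] by (rule nn_integral_eq_integral) auto
  ultimately show "(\<integral>\<^sup>+y. ennreal (max 0 (sgn x * y)) \<partial>\<mu>) = ennreal mean_pos"
    "(\<integral>\<^sup>+y. ennreal (max 0 (- (sgn x * y))) \<partial>\<mu>) = ennreal mean_pos" using e by auto
qed

text \<open>Integrating \<open>jumps_case_nat\<close> adds the same constant on both sides, because
  the two one-sided means of a centred increment agree. The constant \<open>mean_pos\<close> is
  finite and cancels.\<close>

lemma nnV_harmonic:
  assumes d: "d > 0" and x: "x \<in> state_space \<mu>" "d \<le> \<bar>x\<bar>"
  shows "nnV d x = (\<integral>\<^sup>+y. nnV d (x + y) \<partial>\<mu>)"
proof -
  have x0: "x \<noteq> 0" using assms by auto
  note one = prob_space.emeasure_space_1[OF prob_space_incr, simplified]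
  have jm: "(\<lambda>s. jumps d (wpath z s)) \<in> borel_measurable path_space" for z by measurable
  have jm': "(\<lambda>s. jumps d (case_nat x (wpath (x + y) s))) \<in> borel_measurable incr" for y
  proof -
    have "(\<lambda>s. case_nat x (wpath (x + y) s)) \<in> measurable path_space path_space"
    proof (rule measurable_PiM_single')
      fix i :: nat show "(\<lambda>s. case_nat x (wpath (x + y) s) i) \<in> borel_measurable path_space" by (cases i) auto
    qed auto
    from measurable_compose[OF this jumps_measurable] show ?thesis by measurable
  qed
  have inner: "AE y in \<mu>. (\<integral>\<^sup>+s. jumps d (case_nat x (wpath (x + y) s)) \<partial>incr) + ennreal (max 0 (sgn x * y))
      = nnV d (x + y) + ennreal (max 0 (- (sgn x * y)))"
    using AE_state_space[OF x(1)]
  proof eventually_elim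
    case (elim y)
    have "(\<integral>\<^sup>+s. jumps d (case_nat x (wpath (x + y) s)) \<partial>incr) + ennreal (max 0 (sgn x * y))
        = (\<integral>\<^sup>+s. jumps d (case_nat x (wpath (x + y) s)) + ennreal (max 0 (sgn x * y)) \<partial>incr)"
      using one by (subst nn_integral_add[OF jm']) simp_all
    also have "\<dots> = (\<integral>\<^sup>+s. jumps d (wpath (x + y) s) + ennreal (max 0 (- (sgn x * y))) \<partial>incr)"
    proof (rule nn_integral_cong_AE)
      show "AE s in incr. jumps d (case_nat x (wpath (x + y) s)) + ennreal (max 0 (sgn x * y))
          = jumps d (wpath (x + y) s) + ennreal (max 0 (- (sgn x * y)))"
        using AE_hits[OF d elim]
      proof eventually_elim
        case (elim s)
        then obtain N where N: "hits_at d (wpath (x + y) s) N" by blast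
        show ?case using jumps_case_nat[OF d N x(2)] by simp
      qed
    qed
    also have "\<dots> = nnV d (x + y) + ennreal (max 0 (- (sgn x * y)))"
      using one jm[of "x + y"] unfolding nnV_def by (subst nn_integral_add) (simp_all add: measurable_cong_sets[OF sets_incr refl])
    finally show ?case .
  qed
  have "nnV d x = (\<integral>\<^sup>+y. (\<integral>\<^sup>+s. jumps d (wpath x (case_nat y s)) \<partial>incr) \<partial>\<mu>)"
    unfolding nnV_def by (rule nn_integral_incr_step[OF jm])
  hence V: "nnV d x = (\<integral>\<^sup>+y. (\<integral>\<^sup>+s. jumps d (case_nat x (wpath (x + y) s)) \<partial>incr) \<partial>\<mu>)"
    by (simp add: wpath_case_nat)
  have m: "(\<lambda>y. \<integral>\<^sup>+s. jumps d (wpath x (case_nat y s)) \<partial>incr) \<in> borel_measurable \<mu>"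
  proof -
    interpret I: sigma_finite_measure incr by (rule prob_space_imp_sigma_finite[OF prob_space_incr])
    have "(\<lambda>p. case_nat (fst p) (snd p)) \<in> measurable (borel \<Otimes>\<^sub>M path_space) path_space"
      using measurable_case_nat_pair by (simp add: split_beta')
    from measurable_compose[OF this jm[of x]]
    have "(\<lambda>(y, s). jumps d (wpath x (case_nat y s))) \<in> borel_measurable (\<mu> \<Otimes>\<^sub>M incr)"
      by (simp add: split_beta' measurable_cong_sets[OF sets_pair_measure_cong[OF sets_mu sets_incr] refl])
    thus ?thesis by (rule I.borel_measurable_nn_integral)
  qed
  have "nnV d x + ennreal mean_pos = (\<integral>\<^sup>+y. (\<integral>\<^sup>+s. jumps d (case_nat x (wpath (x + y) s)) \<partial>incr) + ennreal (max 0 (sgn x * y)) \<partial>\<mu>)"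
    unfolding V nn_integral_max_sgn(1)[OF x0, symmetric]
    using m unfolding wpath_case_nat by (intro nn_integral_add[symmetric]) auto
  also have "\<dots> = (\<integral>\<^sup>+y. nnV d (x + y) + ennreal (max 0 (- (sgn x * y))) \<partial>\<mu>)"
    by (rule nn_integral_cong_AE[OF inner])
  also have "\<dots> = (\<integral>\<^sup>+y. nnV d (x + y) \<partial>\<mu>) + ennreal mean_pos"
    unfolding nn_integral_max_sgn(2)[OF x0, symmetric] by (intro nn_integral_add) auto
  finally show ?thesis by (simp add: add.commute[of _ "ennreal mean_pos"] ennreal_add_left_cancel)
qed

text \<open>The bound \<open>\<bar>x\<bar> - d\<close> degenerates at the boundary. One step of
  harmonicity repairs it, since \<open>\<bar>x + y\<bar> - d \<ge> sgn x * y\<close>. A lower bound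
  away from zero is what allows errors to be measured relative to \<open>V\<close>.\<close>

lemma nnV_ge_mean_pos:
  assumes d: "d > 0" and x: "x \<in> state_space \<mu>" "d \<le> \<bar>x\<bar>"
  shows "ennreal mean_pos \<le> nnV d x"
proof -
  have x0: "x \<noteq> 0" using assms by auto
  have "ennreal mean_pos = (\<integral>\<^sup>+y. ennreal (max 0 (sgn x * y)) \<partial>\<mu>)" by (rule nn_integral_max_sgn(1)[OF x0, symmetric])
  also have "\<dots> \<le> (\<integral>\<^sup>+y. nnV d (x + y) \<partial>\<mu>)"
  proof (rule nn_integral_mono_AE)
    show "AE y in \<mu>. ennreal (max 0 (sgn x * y)) \<le> nnV d (x + y)"
      using AE_state_space[OF x(1)]
    proof eventually_elim
      case (elim y)
      have "sgn x * y \<le> \<bar>x + y\<bar> - d" using x(2) by (auto simp: sgn_if abs_if split: if_splits)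
      hence "ennreal (sgn x * y) \<le> ennreal (\<bar>x + y\<bar> - d)" by (rule ennreal_leI)
      moreover have "ennreal (max 0 u) = ennreal u" for u by (simp add: max_def ennreal_neg)
      ultimately show ?case using nnV_ge[OF d elim] by (auto intro: order_trans)
    qed
  qed
  also have "\<dots> = nnV d x" by (rule nnV_harmonic[OF assms, symmetric])
  finally show ?thesis .
qed

end

section \<open>The harmonic function as a real function\<close>

context centred_walk
begin

definition rV :: "real \<Rightarrow> real \<Rightarrow> real" where "rV d x = enn2real (nnV d x)"

lemma rV_inside: "\<bar>x\<bar> < d \<Longrightarrow> rV d x = 0"
  by (simp add: rV_def nnV_inside)

lemma rV_nonneg: "0 \<le> rV d x"
  by (simp add: rV_def)

lemma rV_measurable [measurable]: "rV d \<in> borel_measurable borel"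
  unfolding rV_def[abs_def] by measurable

text \<open>A single error function of order \<open>o(\<bar>x\<bar>)\<close> serves all levels
  \<open>d' \<ge> d\<close>, by the two-level form of \<open>nnV_le\<close>.\<close>

lemma rV_bounds:
  assumes d: "d > 0"
  obtains e where "\<And>x. 0 \<le> e x" "\<And>\<epsilon>. \<epsilon> > 0 \<Longrightarrow> \<exists>C\<ge>0. \<forall>x. e x \<le> \<epsilon> * \<bar>x\<bar> + C"
    "\<And>d' x. d \<le> d' \<Longrightarrow> x \<in> state_space \<mu> \<Longrightarrow> nnV d' x = ennreal (rV d' x)"
    "\<And>d' x. d \<le> d' \<Longrightarrow> x \<in> state_space \<mu> \<Longrightarrow> rV d' x \<le> \<bar>x\<bar> + 2 * e x"
    "\<And>d' x. d \<le> d' \<Longrightarrow> x \<in> state_space \<mu> \<Longrightarrow> \<bar>x\<bar> - d' \<le> rV d' x"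
    "\<And>n x. (\<Sum>j<n. killed (alive d) j (\<lambda>y. excess \<bar>y\<bar>) x) \<le> e x"
proof -
  obtain e where e: "\<And>x. 0 \<le> e x" "\<And>\<epsilon>. \<epsilon> > 0 \<Longrightarrow> \<exists>C\<ge>0. \<forall>x. e x \<le> \<epsilon> * \<bar>x\<bar> + C"
    "\<And>n x. (\<Sum>j<n. killed (alive d) j (\<lambda>y. excess \<bar>y\<bar>) x) \<le> e x"
    by (rule green_bound[OF d]) blast
  have le: "nnV d' x \<le> ennreal (\<bar>x\<bar> + 2 * e x)" if "d \<le> d'" "x \<in> state_space \<mu>" for d' x
    by (rule nnV_le[OF d that]) (rule e(3))
  have eq: "nnV d' x = ennreal (rV d' x)" if "d \<le> d'" "x \<in> state_space \<mu>" for d' x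
  proof -
    have "nnV d' x < \<top>" using le_less_trans[OF le[OF that] ennreal_less_top] .
    thus ?thesis by (simp add: rV_def)
  qed
  have up: "rV d' x \<le> \<bar>x\<bar> + 2 * e x" if "d \<le> d'" "x \<in> state_space \<mu>" for d' x
    using le[OF that] unfolding eq[OF that] using e(1)[of x] by (subst (asm) ennreal_le_iff) auto
  have lo: "\<bar>x\<bar> - d' \<le> rV d' x" if "d \<le> d'" "x \<in> state_space \<mu>" for d' x
  proof -
    have "ennreal (\<bar>x\<bar> - d') \<le> ennreal (rV d' x)" using nnV_ge[of d' x] d that unfolding eq[OF that] by auto
    thus ?thesis using rV_nonneg[of d' x] by (subst (asm) ennreal_le_iff) auto
  qed
  show ?thesis by (rule that[OF e(1,2) eq up lo e(3)])
qed

lemma rV_ge_mean_pos: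
  assumes d: "d > 0" and x: "x \<in> alive d" shows "mean_pos \<le> rV d x"
proof -
  obtain e where "nnV d x = ennreal (rV d x)"
    using rV_bounds[OF d] x unfolding alive_def by (metis (no_types, lifting) mem_Collect_eq order_refl)
  thus ?thesis using nnV_ge_mean_pos[of d x] d x rV_nonneg[of d x] by (auto simp: alive_def)
qed

text \<open>The upper bounds on \<open>V\<close> are established on the state space; cut off
  outside, it has linear growth everywhere and can be fed to \<open>killed\<close>.\<close>

definition rVM :: "real \<Rightarrow> real \<Rightarrow> real" where "rVM d x = indicator (state_space \<mu>) x * rV d x"

lemma quad_bdd_rVM: assumes d: "d > 0" shows "quad_bdd (rVM d)"
proof -
  obtain e where e: "\<And>x. 0 \<le> e x" "\<And>\<epsilon>. \<epsilon> > 0 \<Longrightarrow> \<exists>C\<ge>0. \<forall>x. e x \<le> \<epsilon> * \<bar>x\<bar> + C"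
    "\<And>d' x. d \<le> d' \<Longrightarrow> x \<in> state_space \<mu> \<Longrightarrow> rV d' x \<le> \<bar>x\<bar> + 2 * e x"
    by (rule rV_bounds[OF d]) blast
  obtain C where C: "C \<ge> 0" "\<And>x. e x \<le> 1 * \<bar>x\<bar> + C" using e(2)[of 1] by auto
  show ?thesis
  proof (rule quad_bdd_linear[where a="2 * C" and b=3])
    show "\<bar>rVM d x\<bar> \<le> 2 * C + 3 * \<bar>x\<bar>" for x
      using e(3)[of d x] C(2)[of x] C(1) rV_nonneg[of d x] by (auto simp: rVM_def indicator_def)
    show "rVM d \<in> borel_measurable borel" unfolding rVM_def[abs_def] by measurable
  qed simp
qed

lemma integral_rV:
  assumes d: "d > 0" and x: "x \<in> alive d"
  shows "integrable \<mu> (\<lambda>y. rV d (x + y))" "(\<integral>y. rV d (x + y) \<partial>\<mu>) = rV d x"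
proof -
  have xM: "x \<in> state_space \<mu>" "d \<le> \<bar>x\<bar>" using x by (auto simp: alive_def)
  obtain e where eq: "\<And>d' x. d \<le> d' \<Longrightarrow> x \<in> state_space \<mu> \<Longrightarrow> nnV d' x = ennreal (rV d' x)"
    by (rule rV_bounds[OF d]) blast
  have "(\<integral>\<^sup>+y. ennreal (rV d (x + y)) \<partial>\<mu>) = (\<integral>\<^sup>+y. nnV d (x + y) \<partial>\<mu>)"
    by (rule nn_integral_cong_AE) (use AE_state_space[OF xM(1)] eq[of d] in \<open>auto elim!: eventually_mono\<close>)
  also have "\<dots> = ennreal (rV d x)" using nnV_harmonic[OF d xM] eq[of d x] xM by simp
  finally have nn: "(\<integral>\<^sup>+y. ennreal (rV d (x + y)) \<partial>\<mu>) = ennreal (rV d x)" .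
  show "integrable \<mu> (\<lambda>y. rV d (x + y))"
    by (rule integrableI_nonneg) (auto simp: nn rV_nonneg)
  show "(\<integral>y. rV d (x + y) \<partial>\<mu>) = rV d x"
    by (subst integral_eq_nn_integral) (auto simp: nn rV_nonneg)
qed

text \<open>\<open>V\<close> vanishes on \<open>(-d, d)\<close>, so killing there loses nothing and
  the martingale property survives for the killed walk.\<close>

lemma killed_rVM:
  assumes d: "d > 0" shows "killed (alive d) n (rVM d) x = indicator (alive d) x * rV d x"
proof (induction n arbitrary: x)
  case 0 show ?case by (auto simp: killed_0 rVM_def alive_def indicator_def)
next
  case (Suc n)
  show ?case
  proof (cases "x \<in> alive d")
    case True
    hence xM: "x \<in> state_space \<mu>" by (simp add: alive_def)
    have "(\<integral>y. killed (alive d) n (rVM d) (x + y) \<partial>\<mu>) = (\<integral>y. rV d (x + y) \<partial>\<mu>)"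
    proof (rule integral_cong_AE)
      show "AE y in \<mu>. killed (alive d) n (rVM d) (x + y) = rV d (x + y)"
        using AE_state_space[OF xM]
      proof eventually_elim
        case (elim y)
        show ?case
        proof (cases "x + y \<in> alive d")
          case False
          hence "\<bar>x + y\<bar> < d" using elim by (auto simp: alive_def)
          thus ?thesis using False Suc by (simp add: rV_inside)
        qed (simp add: Suc)
      qed
      show "(\<lambda>y. killed (alive d) n (rVM d) (x + y)) \<in> borel_measurable \<mu>"
        by (rule borel_measurable_integrable[OF quad_bdd_integrable[OF quad_bdd_killed[OF quad_bdd_rVM[OF d] sets_alive]]])
    qed measurable
    thus ?thesis using True integral_rV(2)[OF d True] by (simp add: killed_Suc step_op_def)
  qed (simp add: killed_outside)
qed

section \<open>Survival from distances of order square root of time\<close>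

lemma killed_UNIV_id: "killed UNIV n (\<lambda>y. y) x = x"
proof (induction n arbitrary: x)
  case (Suc n)
  thus ?case using prob_space by (simp add: killed_Suc step_op_def mean_zero)
qed (simp add: killed_0)

lemma killed_UNIV_sq: "killed UNIV n (\<lambda>y. y\<^sup>2) x \<le> x\<^sup>2 + \<sigma>\<^sup>2 * real n"
  using killed_square_le[of UNIV n x] by (simp add: killed_UNIV_one)

text \<open>The integrand is \<open>(\<bar>y\<bar> - sgn z * y) / 2\<close>. On survival,
  \<open>\<bar>S\<^sub>n\<bar>\<close> has mean at most \<open>V(z) + d\<close> because
  \<open>V\<close> is harmonic, while \<open>sgn z * S\<^sub>n\<close> has mean at least
  \<open>\<bar>z\<bar> - d\<close> by optional stopping, the entrance position being smaller than
  \<open>d\<close> in absolute value.\<close>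

lemma killed_opposite_side:
  assumes d: "d > 0" and z: "z \<in> alive d"
    and up: "rV d z \<le> \<bar>z\<bar> + 2 * E" and lo: "\<And>y. y \<in> state_space \<mu> \<Longrightarrow> \<bar>y\<bar> - d \<le> rV d y"
  shows "killed (alive d) n (\<lambda>y. max 0 (- (sgn z * y))) z \<le> E + d"
proof -
  have zM: "z \<in> state_space \<mu>" "d \<le> \<bar>z\<bar>" using z by (auto simp: alive_def)
  have w: "sgn z = 1 \<or> sgn z = -1" using zM d by (auto simp: sgn_if)
  have "killed (alive d) n abs z \<le> killed (alive d) n (\<lambda>y. 1 * rVM d y + d * 1) z"
  proof (rule killed_mono)
    show "quad_bdd (\<lambda>y. 1 * rVM d y + d * 1)" using quad_bdd_rVM[OF d] by (intro quad_bdd_add quad_bdd_cmult quad_bdd_const)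
    show "\<bar>y\<bar> \<le> 1 * rVM d y + d * 1" if "y \<in> alive d" for y
      using lo[of y] that by (simp add: rVM_def alive_def)
  qed auto
  also have "\<dots> = 1 * killed (alive d) n (rVM d) z + d * killed (alive d) n (\<lambda>_. 1) z"
    by (rule killed_lin) (auto simp: quad_bdd_rVM d)
  also have "\<dots> \<le> rV d z + d"
    using killed_rVM[OF d, of n z] z killed_1_le[OF sets_alive, of d n z] d by simp
  finally have 1: "killed (alive d) n abs z \<le> rV d z + d" .
  have id: "killed UNIV m (\<lambda>y. y) = (\<lambda>y. y)" for m by (auto simp: killed_UNIV_id)
  have "\<bar>\<Sum>k\<le>n. entrance d k (\<lambda>y. y) z\<bar> \<le> (\<Sum>k\<le>n. \<bar>entrance d k (\<lambda>y. y) z\<bar>)" by (rule sum_abs)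
  also have "\<dots> \<le> (\<Sum>k\<le>n. d * entrance d k (\<lambda>_. 1) z)"
    by (intro sum_mono entrance_abs_le) auto
  also have "\<dots> = d * (\<Sum>k\<le>n. entrance d k (\<lambda>_. 1) z)" by (simp add: sum_distrib_left)
  also have "\<dots> \<le> d * 1" using d sum_entrance_le_1[OF zM(1)] by (intro mult_left_mono) auto
  finally have "\<bar>\<Sum>k\<le>n. entrance d k (\<lambda>y. y) z\<bar> \<le> d" by simp
  moreover have "z = killed (alive d) n (\<lambda>y. y) z + (\<Sum>k\<le>n. entrance d k (\<lambda>y. y) z)"
    using first_entrance[OF _ zM(1), of "\<lambda>y. y" n d] unfolding id by simp
  ultimately have k: "\<bar>killed (alive d) n (\<lambda>y. y) z - z\<bar> \<le> d" by linarith
  have 2: "\<bar>z\<bar> - d \<le> sgn z * killed (alive d) n (\<lambda>y. y) z"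
    using k zM d by (auto simp: sgn_if abs_if split: if_splits)
  have "killed (alive d) n (\<lambda>y. max 0 (- (sgn z * y))) z = killed (alive d) n (\<lambda>y. 1 / 2 * \<bar>y\<bar> + (- sgn z / 2) * y) z"
    by (rule killed_cong) (use w in \<open>auto simp: max_def abs_if\<close>)
  also have "\<dots> = 1 / 2 * killed (alive d) n abs z + (- sgn z / 2) * killed (alive d) n (\<lambda>y. y) z"
    by (rule killed_lin) auto
  finally show ?thesis using 1 2 up by (simp add: field_simps)
qed

text \<open>A sign without the value \<open>0\<close>, so that its mean can be read off the
  distribution function at \<open>0\<close>. On \<open>alive d\<close> with \<open>d > 0\<close> it
  agrees with \<open>sgn\<close>.\<close>

definition side :: "real \<Rightarrow> real" where "side y = (if y \<le> 0 then -1 else 1)"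

lemma quad_bdd_side [simp]: "quad_bdd side"
  by (rule quad_bdd_bounded[where c=1]) (auto simp: side_def[abs_def])

lemma killed_UNIV_side: "killed UNIV n side y = 1 - 2 * killed UNIV n (indicator {..0}) y"
proof -
  have "side = (\<lambda>y. 1 * 1 + (-2) * indicator {..0} y)" by (auto simp: side_def indicator_def)
  hence "killed UNIV n side y = killed UNIV n (\<lambda>y. 1 * 1 + (-2) * indicator {..0} y) y" by (simp only:)
  also have "\<dots> = 1 * killed UNIV n (\<lambda>_. 1) y + (-2) * killed UNIV n (indicator {..0}) y"
    by (rule killed_lin) auto
  finally show ?thesis by (simp add: killed_UNIV_one)
qed

text \<open>From a bounded starting point the normal approximation puts about half of the mass on
  either side of zero.\<close>

lemma side_small:
  assumes \<epsilon>: "\<epsilon> > 0" and d: "d > 0"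
  shows "\<forall>\<^sub>F n in sequentially. \<forall>y. \<bar>y\<bar> < d \<longrightarrow> \<bar>killed UNIV n side y\<bar> \<le> \<epsilon>"
proof -
  have "\<forall>\<^sub>F n in sequentially. d / (\<sigma> * sqrt (real n)) < \<epsilon> / 2"
  proof (rule order_tendstoD(2))
    show "(\<lambda>n. d / (\<sigma> * sqrt (real n))) \<longlonglongrightarrow> 0"
      using sigma_pos by (intro real_tendsto_divide_at_top[OF tendsto_const]
        filterlim_tendsto_pos_mult_at_top[OF tendsto_const] filterlim_compose[OF sqrt_at_top filterlim_real_sequentially])
  qed (use \<epsilon> in simp)
  moreover have "\<epsilon> / 4 > 0" using \<epsilon> by simp
  note clt_uniform[OF this]
  ultimately show ?thesis
  proof eventually_elim
    case (elim n)
    show ?case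
    proof (intro allI impI)
      fix y assume y: "\<bar>y\<bar> < d"
      let ?s = "\<sigma> * sqrt (real n)" and ?K = "killed UNIV n (indicator {..0}) y"
      have s: "?s \<ge> 0" using sigma_pos by simp
      have k: "\<bar>?K - \<Phi> ((0 - y) / ?s)\<bar> \<le> \<epsilon> / 4" using elim(2) by blast
      have half: "\<Phi> 0 = 1 / 2" using std_normal_cdf_minus[of 0] by simp
      have u: "\<bar>(0 - y) / ?s\<bar> \<le> d / ?s" using y s by (simp add: abs_divide divide_right_mono)
      have "\<bar>\<Phi> u - 1 / 2\<bar> \<le> \<bar>u\<bar> / 2" for u
        using std_normal_cdf_lipschitz[of u 0] std_normal_cdf_lipschitz[of 0 u] Phi_mono[of u 0] Phi_mono[of 0 u] half
        by (cases "u \<le> 0") auto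
      note this[of "(0 - y) / ?s"]
      also have "\<bar>(0 - y) / ?s\<bar> / 2 \<le> \<epsilon> / 2 / 2"
        using order_trans[OF u less_imp_le[OF elim(1)]] by (rule divide_right_mono) simp
      finally have p: "\<bar>\<Phi> ((0 - y) / ?s) - 1 / 2\<bar> \<le> \<epsilon> / 4" by simp
      have "\<bar>?K - 1 / 2\<bar> \<le> \<epsilon> / 2" using abs_triangle_ineq[of "?K - \<Phi> ((0 - y) / ?s)" "\<Phi> ((0 - y) / ?s) - 1 / 2"] k p by linarith
      thus "\<bar>killed UNIV n side y\<bar> \<le> \<epsilon>" unfolding killed_UNIV_side by linarith
    qed
  qed
qed

text \<open>
  Up to paths that change sides without hitting \<open>(-d, d)\<close>, survival up to time \<open>n\<close> is measured by
  the mean sign of \<open>S\<^sub>n\<close>, since the sign is nearly balanced after the hitting time.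
\<close>

lemma survival_mid_range:
  assumes d: "d > 0" and B: "B > 0" and \<epsilon>: "\<epsilon> > 0"
  shows "\<forall>\<^sub>F n in sequentially. \<forall>z\<in>alive d. \<bar>z\<bar> \<le> B * sqrt (real n) \<longrightarrow>
    \<bar>killed (alive d) n (\<lambda>_. 1) z - (2 * \<Phi> (\<bar>z\<bar> / (\<sigma> * sqrt (real n))) - 1)\<bar> \<le> \<epsilon>"
proof -
  obtain e where e: "\<And>x. 0 \<le> e x" "\<And>\<epsilon>. \<epsilon> > 0 \<Longrightarrow> \<exists>C\<ge>0. \<forall>x. e x \<le> \<epsilon> * \<bar>x\<bar> + C"
    "\<And>d' x. d \<le> d' \<Longrightarrow> x \<in> state_space \<mu> \<Longrightarrow> rV d' x \<le> \<bar>x\<bar> + 2 * e x"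
    "\<And>d' x. d \<le> d' \<Longrightarrow> x \<in> state_space \<mu> \<Longrightarrow> \<bar>x\<bar> - d' \<le> rV d' x"
    by (rule rV_bounds[OF d]) blast
  \<comment> \<open>\<open>\<eta>\<close> fixes the half-width \<open>r = \<eta> * sqrt n\<close> of
    a zone around zero so that \<open>r / (\<sigma> * sqrt n) = \<epsilon> / 16\<close>;
    \<open>\<theta>\<close> makes the linear part of \<open>e z\<close> at most
    \<open>\<epsilon> / 16\<close> of \<open>r\<close> when
    \<open>\<bar>z\<bar> \<le> B * sqrt n\<close>.\<close>
  define \<eta> where "\<eta> = \<sigma> * \<epsilon> / 16"
  define \<theta> where "\<theta> = \<eta> * \<epsilon> / (16 * B)"
  have \<eta>: "\<eta> > 0" using sigma_pos \<epsilon> by (simp add: \<eta>_def)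
  have \<theta>: "\<theta> > 0" using \<eta> \<epsilon> B by (simp add: \<theta>_def)
  obtain C where C: "C \<ge> 0" "\<And>x. e x \<le> \<theta> * \<bar>x\<bar> + C" using e(2)[OF \<theta>] by auto
  have e1: "\<epsilon> / 32 > 0" and e2: "\<epsilon> / 8 > 0" using \<epsilon> by auto
  obtain l where l: "\<And>j y. j \<ge> l \<Longrightarrow> \<bar>y\<bar> < d \<Longrightarrow> \<bar>killed UNIV j side y\<bar> \<le> \<epsilon> / 8"
    using side_small[OF e2 d] by (auto simp: eventually_sequentially)
  have lim: "(\<lambda>n. c / sqrt (real n)) \<longlonglongrightarrow> 0" for c
    by (intro real_tendsto_divide_at_top[OF tendsto_const] filterlim_compose[OF sqrt_at_top filterlim_real_sequentially])
  have ev1: "\<forall>\<^sub>F n in sequentially. (C + d) / \<eta> / sqrt (real n) < \<epsilon> / 16"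
    by (rule order_tendstoD(2)[OF lim]) (use \<epsilon> in simp)
  have ev2: "\<forall>\<^sub>F n in sequentially. sqrt (d\<^sup>2 + \<sigma>\<^sup>2 * real l) / sqrt (real n) < \<eta> / 2"
    by (rule order_tendstoD(2)[OF lim]) (use \<eta> in simp)
  show ?thesis
    using anticoncentration[OF e1] clt_uniform[OF e1] ev1 ev2 eventually_gt_at_top[of 0]
  proof eventually_elim
    case (elim n)
    have sn: "sqrt (real n) > 0" using elim(5) by simp
    define r where "r = \<eta> * sqrt (real n)"
    have r: "r > 0" using \<eta> sn by (simp add: r_def)
    let ?I = "indicator {-r..r} :: real \<Rightarrow> real"
    have conc: "killed UNIV n ?I x \<le> \<epsilon> / 16 + \<epsilon> / 32" for x
    proof -
      have "killed UNIV n ?I x \<le> r / (\<sigma> * sqrt (real n)) + \<epsilon> / 32" using elim(1) r by (meson less_imp_le)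
      also have "r / (\<sigma> * sqrt (real n)) = \<epsilon> / 16" using sn sigma_pos by (simp add: r_def \<eta>_def field_simps)
      finally show ?thesis .
    qed
    \<comment> \<open>Chebyshev's inequality over at most \<open>l\<close> steps. An entrance during
      the last \<open>l\<close> steps thus leaves \<open>S\<^sub>n\<close> in \<open>[-r, r]\<close>
      with probability at least \<open>1 / 2\<close>, and as that zone has small mass, such
      entrances are rare.\<close>
    have stay: "1 / 2 \<le> killed UNIV j ?I y" if j: "j \<le> l" and y: "\<bar>y\<bar> < d" for j y
    proof -
      have r2: "r\<^sup>2 > 0" using r by simp
      have "1 = killed UNIV j (\<lambda>_. 1) y" by (simp add: killed_UNIV_one)
      also have "\<dots> \<le> killed UNIV j (\<lambda>u. 1 * ?I u + 1 / r\<^sup>2 * u\<^sup>2) y"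
      proof (rule killed_mono)
        fix u show "1 \<le> 1 * ?I u + 1 / r\<^sup>2 * u\<^sup>2"
        proof (cases "\<bar>u\<bar> \<le> r")
          case False
          hence "r\<^sup>2 \<le> u\<^sup>2" using r by (metis abs_le_square_iff abs_of_pos linear)
          thus ?thesis using r2 by (simp add: indicator_def)
        qed (auto simp: indicator_def abs_le_iff)
      qed auto
      also have "\<dots> = 1 * killed UNIV j ?I y + 1 / r\<^sup>2 * killed UNIV j (\<lambda>u. u\<^sup>2) y" by (rule killed_lin) auto
      also have "1 / r\<^sup>2 * killed UNIV j (\<lambda>u. u\<^sup>2) y \<le> 1 / 2"
      proof -
        have y2: "y\<^sup>2 \<le> d\<^sup>2" using y d by (intro power2_le_iff_abs_le[THEN iffD2]) auto
        have "killed UNIV j (\<lambda>u. u\<^sup>2) y \<le> y\<^sup>2 + \<sigma>\<^sup>2 * real j" by (rule killed_UNIV_sq)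
        also have "\<dots> \<le> d\<^sup>2 + \<sigma>\<^sup>2 * real l" using y2 j by (intro add_mono mult_left_mono) auto
        also have "\<dots> = (sqrt (d\<^sup>2 + \<sigma>\<^sup>2 * real l))\<^sup>2" by simp
        also have "\<dots> \<le> (r / 2)\<^sup>2"
        proof (rule power_mono)
          show "sqrt (d\<^sup>2 + \<sigma>\<^sup>2 * real l) \<le> r / 2" using elim(4) sn by (simp add: r_def field_simps)
        qed simp
        also have "\<dots> \<le> r\<^sup>2 / 2" by (simp add: power_divide)
        finally show ?thesis using r2 by (simp add: field_simps)
      qed
      finally show ?thesis by simp
    qed
    show ?case
    proof (intro ballI impI)
      fix z assume z: "z \<in> alive d" and zB: "\<bar>z\<bar> \<le> B * sqrt (real n)"
      have zM: "z \<in> state_space \<mu>" "d \<le> \<bar>z\<bar>" using z by (auto simp: alive_def)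
      let ?w = "sgn z"
      have w: "?w = 1 \<or> ?w = -1" using zM d by (auto simp: sgn_if)
      let ?p = "killed (alive d) n (\<lambda>_. 1) z" and ?q = "killed (alive d) n side z"
      \<comment> \<open>Surviving paths on the side of \<open>z\<close> cancel in this difference,
        and those on the other side count twice. The latter are either within \<open>r\<close> of
        zero, which is unlikely, or farther away, which \<open>killed_opposite_side\<close> controls
        through Markov's inequality.\<close>
      have a0: "\<bar>?p - ?w * ?q\<bar> \<le> 7 / 16 * \<epsilon>"
      proof -
        let ?h = "\<lambda>y. max 0 (- (?w * y))"
        have qh: "quad_bdd ?h"
          by (rule quad_bdd_linear[where a=0 and b=1]) (use w in \<open>auto simp: max_def\<close>)
        have "?p - ?w * ?q = killed (alive d) n (\<lambda>y. 1 * 1 + (- ?w) * side y) z"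
          by (subst killed_lin) auto
        hence "\<bar>?p - ?w * ?q\<bar> = \<bar>killed (alive d) n (\<lambda>y. 1 * 1 + (- ?w) * side y) z\<bar>" by simp
        also have "\<dots> \<le> killed (alive d) n (\<lambda>y. 2 * ?I y + (2 / r) * ?h y) z"
        proof (rule killed_abs)
          fix y assume "y \<in> alive d"
          hence y0: "y \<noteq> 0" using d by (auto simp: alive_def)
          have hge: "1 \<le> 1 / r * ?h y" if "r < \<bar>y\<bar>" "?w * y < 0"
          proof -
            have h: "r \<le> ?h y" using that w by (auto simp: max_def)
            have "1 = 1 / r * r" using r by simp
            also have "\<dots> \<le> 1 / r * ?h y" by (rule mult_left_mono[OF h]) (use r in simp)
            finally show ?thesis .
          qed
          have "0 \<le> 2 / r * ?h y" using r by simp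
          thus "\<bar>1 * 1 + (- ?w) * side y\<bar> \<le> 2 * ?I y + (2 / r) * ?h y"
          proof (cases "?w * y < 0")
            case True
            hence "1 * 1 + (- ?w) * side y = 2" using w y0 by (auto simp: side_def)
            thus ?thesis using hge[OF _ True] \<open>0 \<le> 2 / r * ?h y\<close>
              by (cases "\<bar>y\<bar> \<le> r") (auto simp: indicator_def abs_le_iff)
          next
            case False
            hence "1 * 1 + (- ?w) * side y = 0" using w y0 by (auto simp: side_def)
            thus ?thesis using \<open>0 \<le> 2 / r * ?h y\<close> by (simp add: indicator_def)
          qed
        qed (use qh in auto)
        also have "\<dots> = 2 * killed (alive d) n ?I z + (2 / r) * killed (alive d) n ?h z"
          by (rule killed_lin) (use qh in auto)
        also have "\<dots> \<le> 2 * (\<epsilon> / 16 + \<epsilon> / 32) + (2 / r) * (e z + d)"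
        proof (intro add_mono mult_left_mono)
          show "killed (alive d) n ?I z \<le> \<epsilon> / 16 + \<epsilon> / 32"
            by (rule order_trans[OF killed_set_mono conc]) auto
          show "killed (alive d) n ?h z \<le> e z + d"
            by (rule killed_opposite_side[OF d z e(3)[OF order_refl zM(1)] e(4)[OF order_refl]])
        qed (use r in auto)
        also have "(2 / r) * (e z + d) \<le> \<epsilon> / 4"
        proof -
          have "e z + d \<le> \<theta> * (B * sqrt (real n)) + (C + d)"
          proof -
            have "\<theta> * \<bar>z\<bar> \<le> \<theta> * (B * sqrt (real n))" using zB \<theta> by (intro mult_left_mono) auto
            thus ?thesis using C(2)[of z] by linarith
          qed
          hence "(2 / r) * (e z + d) \<le> (2 / r) * (\<theta> * (B * sqrt (real n)) + (C + d))" using r by (intro mult_left_mono) auto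
          also have "\<dots> = 2 * (\<theta> * B / \<eta>) + 2 * ((C + d) / \<eta> / sqrt (real n))"
            using \<eta> sn by (simp add: r_def field_simps)
          also have "\<theta> * B / \<eta> = \<epsilon> / 16" using \<eta> B by (simp add: \<theta>_def field_simps)
          also have "2 * (\<epsilon> / 16) + 2 * ((C + d) / \<eta> / sqrt (real n)) \<le> 2 * (\<epsilon> / 16) + 2 * (\<epsilon> / 16)"
            using elim(3) by (intro add_left_mono mult_left_mono) auto
          finally show ?thesis by simp
        qed
        finally show ?thesis by (simp add: algebra_simps)
      qed
      let ?S = "\<Sum>k\<le>n. entrance d k (killed UNIV (n - k) side) z"
      have ent0: "0 \<le> entrance d k (\<lambda>_. 1) z" for k by (rule entrance_nonneg) auto
      have late: "(\<Sum>k\<in>{k. k \<le> n \<and> n - k < l}. entrance d k (\<lambda>_. 1) z) \<le> 2 * (\<epsilon> / 16 + \<epsilon> / 32)"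
      proof -
        have qKI: "quad_bdd (killed UNIV m ?I)" for m by (rule quad_bdd_killed) auto
        have "(\<Sum>k\<in>{k. k \<le> n \<and> n - k < l}. 1 / 2 * entrance d k (\<lambda>_. 1) z)
            \<le> (\<Sum>k\<in>{k. k \<le> n \<and> n - k < l}. entrance d k (killed UNIV (n - k) ?I) z)"
        proof (rule sum_mono)
          fix k assume k: "k \<in> {k. k \<le> n \<and> n - k < l}"
          have "1 / 2 * entrance d k (\<lambda>_. 1) z = entrance d k (\<lambda>_. 1 / 2 * 1) z" by (rule entrance_cmult[symmetric])
          also have "\<dots> \<le> entrance d k (killed UNIV (n - k) ?I) z"
            by (rule entrance_mono[OF _ qKI]) (use k stay in auto)
          finally show "1 / 2 * entrance d k (\<lambda>_. 1) z \<le> entrance d k (killed UNIV (n - k) ?I) z" .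
        qed
        also have "\<dots> \<le> (\<Sum>k\<le>n. entrance d k (killed UNIV (n - k) ?I) z)"
          by (rule sum_mono2) (auto intro!: entrance_nonneg qKI killed_nonneg)
        also have "\<dots> \<le> killed UNIV n ?I z"
          using first_entrance[OF _ zM(1), of ?I n d] killed_nonneg[of ?I "alive d" n z] by simp
        also have "\<dots> \<le> \<epsilon> / 16 + \<epsilon> / 32" by (rule conc)
        finally have h: "1 / 2 * (\<Sum>k\<in>{k. k \<le> n \<and> n - k < l}. entrance d k (\<lambda>_. 1) z) \<le> \<epsilon> / 16 + \<epsilon> / 32"
          unfolding sum_distrib_left[symmetric] .
        have "T \<le> 2 * c" if "1 / 2 * T \<le> c" for T c :: real using that by simp
        from this[OF h] show ?thesis .
      qed
      \<comment> \<open>Entrances with at least \<open>l\<close> steps left contribute little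
        because the sign is balanced by time \<open>n\<close>; the remaining ones are rare by
        \<open>late\<close>.\<close>
      have b0: "\<bar>?S\<bar> \<le> \<epsilon> / 8 + 2 * (\<epsilon> / 16 + \<epsilon> / 32)"
      proof -
        have qKs: "quad_bdd (killed UNIV m side)" for m by (rule quad_bdd_killed) auto
        have s1: "\<bar>killed UNIV m side y\<bar> \<le> 1" for m y
        proof -
          have "\<bar>killed UNIV m side y\<bar> \<le> killed UNIV m (\<lambda>_. 1) y"
            by (rule killed_abs) (auto simp: side_def)
          thus ?thesis by (simp add: killed_UNIV_one)
        qed
        have "\<bar>?S\<bar> \<le> (\<Sum>k\<le>n. \<bar>entrance d k (killed UNIV (n - k) side) z\<bar>)" by (rule sum_abs)
        also have "\<dots> \<le> (\<Sum>k\<le>n. \<epsilon> / 8 * entrance d k (\<lambda>_. 1) z + (if n - k < l then entrance d k (\<lambda>_. 1) z else 0))"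
        proof (rule sum_mono)
          fix k assume "k \<in> {..n}"
          show "\<bar>entrance d k (killed UNIV (n - k) side) z\<bar>
              \<le> \<epsilon> / 8 * entrance d k (\<lambda>_. 1) z + (if n - k < l then entrance d k (\<lambda>_. 1) z else 0)"
          proof (cases "n - k < l")
            case True
            have "\<bar>entrance d k (killed UNIV (n - k) side) z\<bar> \<le> 1 * entrance d k (\<lambda>_. 1) z"
              by (rule entrance_abs_le[OF qKs s1])
            moreover have "0 \<le> \<epsilon> / 8 * entrance d k (\<lambda>_. 1) z" using ent0 \<epsilon> by simp
            ultimately show ?thesis using True by simp
          next
            case False
            have "\<bar>entrance d k (killed UNIV (n - k) side) z\<bar> \<le> \<epsilon> / 8 * entrance d k (\<lambda>_. 1) z"
              by (rule entrance_abs_le[OF qKs]) (use False l in auto)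
            thus ?thesis using False by simp
          qed
        qed
        also have "\<dots> = \<epsilon> / 8 * (\<Sum>k\<le>n. entrance d k (\<lambda>_. 1) z)
            + (\<Sum>k\<in>{k. k \<le> n \<and> n - k < l}. entrance d k (\<lambda>_. 1) z)"
          by (simp add: sum.distrib sum_distrib_left sum.inter_filter[symmetric] atMost_def Collect_conj_eq[symmetric] conj_commute)
        also have "\<epsilon> / 8 * (\<Sum>k\<le>n. entrance d k (\<lambda>_. 1) z) \<le> \<epsilon> / 8 * 1"
          using \<epsilon> sum_entrance_le_1[OF zM(1)] by (intro mult_left_mono) auto
        finally show ?thesis using late by simp
      qed
      have dec: "killed UNIV n side z = ?q + ?S" by (rule first_entrance[OF quad_bdd_side zM(1)])
      let ?s = "\<sigma> * sqrt (real n)"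
      have c0: "\<bar>?w * killed UNIV n side z - (2 * \<Phi> (\<bar>z\<bar> / ?s) - 1)\<bar> \<le> \<epsilon> / 16"
      proof -
        have k: "\<bar>killed UNIV n (indicator {..0}) z - \<Phi> ((0 - z) / ?s)\<bar> \<le> \<epsilon> / 32" using elim(2) by blast
        have "?w * (1 - 2 * \<Phi> ((0 - z) / ?s)) = 2 * \<Phi> (\<bar>z\<bar> / ?s) - 1"
          using w std_normal_cdf_minus[of "z / ?s"] by (auto simp: sgn_if abs_if split: if_splits)
        hence "?w * killed UNIV n side z - (2 * \<Phi> (\<bar>z\<bar> / ?s) - 1)
            = ?w * (2 * (\<Phi> ((0 - z) / ?s) - killed UNIV n (indicator {..0}) z))"
          unfolding killed_UNIV_side by (simp add: algebra_simps)
        moreover have "\<bar>?w * (2 * u)\<bar> = 2 * \<bar>u\<bar>" for u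
          using w by (auto simp: abs_mult)
        ultimately have "\<bar>?w * killed UNIV n side z - (2 * \<Phi> (\<bar>z\<bar> / ?s) - 1)\<bar>
            = 2 * \<bar>\<Phi> ((0 - z) / ?s) - killed UNIV n (indicator {..0}) z\<bar>"
          by (simp only:)
        also have "\<dots> \<le> 2 * (\<epsilon> / 32)"
          using k by (subst abs_minus_commute) (rule mult_left_mono, simp_all)
        finally show ?thesis by simp
      qed
      have wS: "\<bar>?w * ?S\<bar> = \<bar>?S\<bar>" using w by (auto simp: abs_mult)
      have "?p - (2 * \<Phi> (\<bar>z\<bar> / ?s) - 1)
          = (?p - ?w * ?q) - ?w * ?S + (?w * killed UNIV n side z - (2 * \<Phi> (\<bar>z\<bar> / ?s) - 1))"
        unfolding dec by (simp add: algebra_simps)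
      hence "\<bar>?p - (2 * \<Phi> (\<bar>z\<bar> / ?s) - 1)\<bar>
          \<le> \<bar>?p - ?w * ?q\<bar> + \<bar>?w * ?S\<bar> + \<bar>?w * killed UNIV n side z - (2 * \<Phi> (\<bar>z\<bar> / ?s) - 1)\<bar>"
        by (simp only: abs_triangle_ineq4[THEN order_trans, THEN add_right_mono] order_trans[OF abs_triangle_ineq add_right_mono[OF abs_triangle_ineq4]])
      also have "\<dots> \<le> 7 / 16 * \<epsilon> + (\<epsilon> / 8 + 2 * (\<epsilon> / 16 + \<epsilon> / 32)) + \<epsilon> / 16"
        using a0 b0 c0 unfolding wS by (intro add_mono)
      also have "\<dots> \<le> \<epsilon>" using \<epsilon> by simp
      finally show "\<bar>?p - (2 * \<Phi> (\<bar>z\<bar> / ?s) - 1)\<bar> \<le> \<epsilon>" .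
    qed
  qed
qed

end

section \<open>Asymptotics of the survival probability\<close>

context centred_walk
begin

lemma killed_lin3:
  assumes "quad_bdd f" "quad_bdd g" "quad_bdd h" "A \<in> sets borel"
  shows "killed A n (\<lambda>y. a * f y + b * g y + c * h y) x = a * killed A n f x + b * killed A n g x + c * killed A n h x"
proof -
  have "killed A n (\<lambda>y. (a * f y + b * g y) + c * h y) x
      = killed A n (\<lambda>y. a * f y + b * g y) x + killed A n (\<lambda>y. c * h y) x"
    by (rule killed_plus[OF quad_bdd_add[OF quad_bdd_cmult[OF assms(1)] quad_bdd_cmult[OF assms(2)]]
          quad_bdd_cmult[OF assms(3)] assms(4)])
  thus ?thesis unfolding killed_lin[OF assms(1,2,4)] killed_cmult[OF assms(3,4)] .
qed

text \<open>Summing the a priori bound on the survival probability gives growth of order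
  \<open>(1 + \<bar>x\<bar>) * sqrt m\<close>, instead of the order \<open>m\<close> of the free
  walk.\<close>

lemma second_moment_bound:
  assumes d: "d > 0" and C: "\<And>n x. killed (alive d) n (\<lambda>_. 1) x \<le> C * (1 + \<bar>x\<bar>) / sqrt (real (Suc n))" "C > 0"
  shows "killed (alive d) m (\<lambda>y. y\<^sup>2) x \<le> x\<^sup>2 + \<sigma>\<^sup>2 * (C * (1 + \<bar>x\<bar>) * (2 * sqrt (real m)))"
proof -
  have "(\<Sum>k<m. killed (alive d) k (\<lambda>_. 1) x) \<le> (\<Sum>k<m. C * (1 + \<bar>x\<bar>) * (1 / sqrt (real (Suc k))))"
    using C(1)[of _ x] by (intro sum_mono) simp
  also have "\<dots> = C * (1 + \<bar>x\<bar>) * (\<Sum>k<m. 1 / sqrt (real (Suc k)))" by (simp add: sum_distrib_left)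
  also have "\<dots> \<le> C * (1 + \<bar>x\<bar>) * (2 * sqrt (real m))"
    using C(2) by (intro mult_left_mono sum_inverse_sqrt) auto
  finally have "\<sigma>\<^sup>2 * (\<Sum>k<m. killed (alive d) k (\<lambda>_. 1) x) \<le> \<sigma>\<^sup>2 * (C * (1 + \<bar>x\<bar>) * (2 * sqrt (real m)))"
    by (rule mult_left_mono) simp
  thus ?thesis using killed_square_le[OF sets_alive, of d m x] by linarith
qed

text \<open>
  Let the walk run for a time \<open>m\<close> which is a small fraction of \<open>n\<close>, and use the mid-range
  estimate for \<open>p\<^sub>n\<^sub>-\<^sub>m(S\<^sub>m)\<close>, which is nearly linear in \<open>\<bar>S\<^sub>m\<bar>\<close>, hence proportional to the
  harmonic function \<open>V(S\<^sub>m)\<close>. Values of \<open>\<bar>S\<^sub>m\<bar>\<close> that are much smaller or much larger than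
  \<open>\<surd>m\<close> contribute little by the a priori bound on \<open>p\<^sub>m\<close> and by the second moment.
\<close>

lemma survival_asymptotics:
  assumes d: "d > 0" and a: "a \<longlonglongrightarrow> 0" and \<epsilon>: "\<epsilon> > 0"
  shows "\<forall>\<^sub>F n in sequentially. \<forall>x\<in>alive d. \<bar>x\<bar> \<le> a n * sqrt (real n) \<longrightarrow>
    \<bar>killed (alive d) n (\<lambda>_. 1) x * sqrt (real n) - sqrt (2 / pi) / \<sigma> * rV d x\<bar> \<le> \<epsilon> * rV d x"
proof -
  obtain e where e: "\<And>x. 0 \<le> e x" "\<And>\<epsilon>. \<epsilon> > 0 \<Longrightarrow> \<exists>C\<ge>0. \<forall>x. e x \<le> \<epsilon> * \<bar>x\<bar> + C"
    "\<And>d' x. d \<le> d' \<Longrightarrow> x \<in> state_space \<mu> \<Longrightarrow> rV d' x \<le> \<bar>x\<bar> + 2 * e x"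
    "\<And>d' x. d \<le> d' \<Longrightarrow> x \<in> state_space \<mu> \<Longrightarrow> \<bar>x\<bar> - d' \<le> rV d' x"
    by (rule rV_bounds[OF d]) blast
  obtain Cp where Cp: "Cp > 0" "\<And>n x. killed (alive d) n (\<lambda>_. 1) x \<le> Cp * (1 + \<bar>x\<bar>) / sqrt (real (Suc n))"
    by (rule survival_bound[OF d]) blast
  obtain C1 where C1: "C1 \<ge> 0" "\<And>x. e x \<le> 1 * \<bar>x\<bar> + C1" using e(2)[of 1] by auto
  define c where "c = sqrt (2 / pi) / \<sigma>"
  have c: "c > 0" using sigma_pos by (simp add: c_def)
  \<comment> \<open>Combines \<open>V \<ge> mean_pos\<close> with
    \<open>V \<ge> \<bar>x\<bar> - d\<close>, so that errors of order
    \<open>1 + \<bar>x\<bar>\<close> become relative to \<open>V\<close>.\<close>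
  define CV where "CV = (1 + d) / mean_pos + 1"
  have CV: "CV > 0" "\<And>x. x \<in> alive d \<Longrightarrow> 1 + \<bar>x\<bar> \<le> CV * rV d x"
  proof -
    show "CV > 0" using d mean_pos_pos by (simp add: CV_def add_pos_pos)
    fix x assume x: "x \<in> alive d"
    have "(1 + d) / mean_pos * mean_pos \<le> (1 + d) / mean_pos * rV d x"
      using rV_ge_mean_pos[OF d x] d mean_pos_pos by (intro mult_left_mono) auto
    moreover have "\<bar>x\<bar> - d \<le> rV d x" using e(4)[of d x] x by (simp add: alive_def)
    moreover have "(1 + d) / mean_pos * mean_pos = 1 + d" using mean_pos_pos by simp
    moreover have "CV * rV d x = (1 + d) / mean_pos * rV d x + rV d x"
      unfolding CV_def distrib_right by simp
    ultimately show "1 + \<bar>x\<bar> \<le> CV * rV d x" by linarith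
  qed
  define CW where "CW = 3 + 2 * C1"
  have CW: "CW > 0" using C1 by (simp add: CW_def)
  have CWx: "rV d x \<le> CW * (1 + \<bar>x\<bar>)" if "x \<in> alive d" for x
  proof -
    have "rV d x \<le> \<bar>x\<bar> + 2 * (1 * \<bar>x\<bar> + C1)" using e(3)[of d x] C1(2)[of x] that by (simp add: alive_def)
    also have "\<dots> \<le> CW * (1 + \<bar>x\<bar>)" using C1(1) by (simp add: CW_def algebra_simps)
    finally show ?thesis .
  qed
  \<comment> \<open>The coefficient of a crude linear bound for all \<open>y\<close>:
    \<open>2 * Cp\<close> comes from the survival probability at time \<open>n - m\<close>, and
    \<open>c * CW\<close> from \<open>V\<close>.\<close>
  define E0 where "E0 = 2 * Cp + c * CW"
  have E0: "E0 > 0" using Cp c CW by (simp add: E0_def add_pos_pos)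
  \<comment> \<open>The coefficient of \<open>\<bar>y\<bar> / k\<close> in the main range:
    \<open>1\<close> for the mid-range estimate, \<open>8 / \<sigma> ^ 3\<close> for the cubic
    remainder of \<open>\<Phi>\<close>, one \<open>c\<close> for replacing \<open>n\<close> by
    \<open>n - m\<close> and another for replacing \<open>\<bar>y\<bar>\<close> by
    \<open>V\<close>.\<close>
  define Q where "Q = 1 + 8 / \<sigma> ^ 3 + 2 * c"
  have Q: "Q > 0" using c sigma_pos by (simp add: Q_def add_pos_pos)
  \<comment> \<open>The final relative error is \<open>W / k\<close>. The three summands belong to
    small, large and moderate values of \<open>\<bar>S\<^sub>m\<bar>\<close>.\<close>
  define W where "W = 2 * E0 * Cp * CV + 2 * E0 * CV * (1 + 2 * \<sigma>\<^sup>2 * Cp) + 2 * Q"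
  obtain k :: nat where k: "max 2 (W / \<epsilon>) \<le> real k" using real_arch_simple by blast
  have k2: "k \<ge> 2" "real k > 0" using k by auto
  have W\<epsilon>: "W / k \<le> \<epsilon>" using k k2(2) \<epsilon> by (simp add: field_simps)
  \<comment> \<open>With the fourth power, \<open>sqrt m\<close> is of order
    \<open>sqrt n / k^2\<close>, and the main range from \<open>sqrt m / k\<close> to
    \<open>k * sqrt m\<close> lies between orders \<open>sqrt n / k^3\<close> and
    \<open>sqrt n / k\<close>: small enough to linearise \<open>\<Phi>\<close>, yet not too small
    for an additive error.\<close>
  define m where "m n = n div k ^ 4" for n :: nat
  define \<theta> where "\<theta> = 1 / (4 * real k)"
  have \<theta>: "\<theta> > 0" using k2 by (simp add: \<theta>_def)
  obtain C2 where C2: "C2 \<ge> 0" "\<And>x. e x \<le> \<theta> * \<bar>x\<bar> + C2" using e(2)[OF \<theta>] by auto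
  \<comment> \<open>In the main range \<open>sqrt n \<le> 2 * k ^ 3 * \<bar>y\<bar>\<close>, so an
    additive error \<open>\<delta>\<close> becomes at most \<open>\<bar>y\<bar> / k\<close> after
    multiplication by \<open>sqrt n\<close>.\<close>
  define \<delta> where "\<delta> = 1 / (2 * real k ^ 4)"
  have \<delta>: "\<delta> > 0" using k2 by (simp add: \<delta>_def)
  obtain n1 where n1: "\<And>n z. n \<ge> n1 \<Longrightarrow> z \<in> alive d \<Longrightarrow> \<bar>z\<bar> \<le> 2 * sqrt (real n) \<Longrightarrow>
    \<bar>killed (alive d) n (\<lambda>_. 1) z - (2 * \<Phi> (\<bar>z\<bar> / (\<sigma> * sqrt (real n))) - 1)\<bar> \<le> \<delta>"
    using survival_mid_range[OF d _ \<delta>, of 2] by (auto simp: eventually_sequentially)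
  have ev_a: "\<forall>\<^sub>F n in sequentially. a n < 1 / (2 * (real k)\<^sup>2)"
    by (rule order_tendstoD(2)[OF a]) (use k2 in simp)
  \<comment> \<open>In this order: the mid-range estimate applies at time \<open>n - m\<close>;
    \<open>k \<le> sqrt m\<close>; and the constants in the bounds for \<open>V\<close> are
    absorbed, \<open>2 * C2 + d \<le> \<bar>y\<bar> / (4 * k)\<close> in the main range.\<close>
  have ev_n: "\<forall>\<^sub>F n in sequentially. max (real (2 * n1 + 2)) (max (2 * real k ^ 6) (2 * real k ^ 6 * (4 * real k * (2 * C2 + d))\<^sup>2)) \<le> real n"
    by (intro eventually_compose_filterlim[OF eventually_ge_at_top filterlim_real_sequentially])
  show ?thesis
    using ev_a ev_n
  proof eventually_elim
    case (elim n)
    let ?m = "m n" and ?r = "n - m n"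
    have n: "n \<ge> 2 * n1 + 2" "2 * real k ^ 6 \<le> real n"
      "2 * real k ^ 6 * (4 * real k * (2 * C2 + d))\<^sup>2 \<le> real n" using elim(2) by auto
    have k1: "real k \<ge> 2" using k2(1) by simp
    have k4: "real k ^ 4 \<ge> 16"
      using power_mono[OF k1, of 4] by simp
    have m1: "real ?m * real k ^ 4 \<le> real n"
    proof -
      have "?m * k ^ 4 \<le> n" unfolding m_def by (rule div_times_less_eq_dividend)
      hence "real (?m * k ^ 4) \<le> real n" by (rule of_nat_mono)
      thus ?thesis by simp
    qed
    have m2: "real n \<le> 2 * real k ^ 4 * real ?m"
    proof -
      have pos: "k ^ 4 > 0" using k2 by simp
      have "n < (?m + 1) * k ^ 4" unfolding m_def using dividend_less_div_times[OF pos, of n] by (simp add: algebra_simps)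
      moreover have "?m \<ge> 1"
      proof -
        have "real k ^ 4 \<le> real k ^ 6" using k1 by (intro power_increasing) auto
        moreover have "0 \<le> real k ^ 6" by simp
        ultimately have "real k ^ 4 \<le> real n" using n(2) by linarith
        hence "real (k ^ 4) \<le> real n" unfolding of_nat_power .
        hence "k ^ 4 \<le> n" by (simp only: of_nat_le_iff)
        thus ?thesis unfolding m_def using pos by (simp add: div_greater_zero_iff Suc_le_eq)
      qed
      hence "(?m + 1) * k ^ 4 \<le> (2 * ?m) * k ^ 4" by (intro mult_right_mono) auto
      ultimately have "n \<le> 2 * ?m * k ^ 4" by linarith
      hence "real n \<le> real (2 * ?m * k ^ 4)" by (rule of_nat_mono)
      thus ?thesis by (simp add: mult_ac)
    qed
    have np: "real n > 0" using n(1) by simp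
    have mp: "real ?m > 0" using m2 np k2(2) by (metis mult_zero_right not_le of_nat_0_le_iff order_le_less)
    have m16: "16 * real ?m \<le> real n"
      using mult_left_mono[OF k4, of "real ?m"] m1 by simp
    have rr: "real ?r = real n - real ?m" using m16 by (simp add: of_nat_diff)
    have rbig: "real n \<le> 4 * real ?r" "real ?r > 0" "?r \<ge> n1" using rr m16 np n(1) by linarith+
    have sr: "sqrt (real n) \<le> 2 * sqrt (real ?r)"
      using real_sqrt_le_mono[OF rbig(1)] by (simp add: real_sqrt_mult)
    have sr0: "sqrt (real ?r) > 0" "sqrt (real n) > 0" "sqrt (real ?m) > 0" using rbig np mp by auto
    have sm1: "sqrt (real ?m) * (real k)\<^sup>2 \<le> sqrt (real n)"
    proof -
      have "sqrt (real ?m * real k ^ 4) \<le> sqrt (real n)" by (rule real_sqrt_le_mono[OF m1])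
      moreover have "sqrt (real k ^ 4) = (real k)\<^sup>2" by (rule real_sqrt_unique) auto
      ultimately show ?thesis by (simp add: real_sqrt_mult)
    qed
    have sm2: "sqrt (real n) \<le> 2 * (real k)\<^sup>2 * sqrt (real ?m)"
    proof -
      have "sqrt (real n) \<le> sqrt (4 * real k ^ 4 * real ?m)" using m2 mp k2(2) by (intro real_sqrt_le_mono) (simp add: order_trans[OF m2])
      moreover have "sqrt (real k ^ 4) = (real k)\<^sup>2" by (rule real_sqrt_unique) auto
      ultimately show ?thesis by (simp add: real_sqrt_mult)
    qed
    have k4p: "0 < 2 * real k ^ 4" using k2 by simp
    have smk: "real k \<le> sqrt (real ?m)"
    proof -
      have "2 * real k ^ 4 * (real k)\<^sup>2 = 2 * real k ^ 6" by (simp add: eval_nat_numeral)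
      hence "2 * real k ^ 4 * (real k)\<^sup>2 \<le> 2 * real k ^ 4 * real ?m" using order_trans[OF n(2) m2] by linarith
      hence "(real k)\<^sup>2 \<le> real ?m" using k4p by (rule mult_left_le_imp_le)
      thus ?thesis by (rule real_le_rsqrt)
    qed
    have smC: "4 * real k * (2 * C2 + d) * real k \<le> sqrt (real ?m)"
    proof -
      define u where "u = 4 * real k * (2 * C2 + d)"
      have "2 * real k ^ 4 * (u * real k)\<^sup>2 = 2 * real k ^ 6 * u\<^sup>2" by (simp add: eval_nat_numeral)
      hence "2 * real k ^ 4 * (u * real k)\<^sup>2 \<le> 2 * real k ^ 4 * real ?m"
        using order_trans[OF n(3) m2] unfolding u_def[symmetric] by linarith
      hence "(u * real k)\<^sup>2 \<le> real ?m" using k4p by (rule mult_left_le_imp_le)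
      thus ?thesis unfolding u_def by (rule real_le_rsqrt)
    qed
    \<comment> \<open>One bound for all \<open>y\<close>, whose three terms have controlled means
      under the killed walk at time \<open>m\<close>: a constant by the survival bound, a square by
      the second moment, and \<open>V\<close> by harmonicity.\<close>
    have point: "\<bar>killed (alive d) ?r (\<lambda>_. 1) y * sqrt (real n) - c * rV d y\<bar>
        \<le> E0 * (1 + sqrt (real ?m) / k) + 2 * E0 / (k * sqrt (real ?m)) * y\<^sup>2 + 2 * Q / k * rV d y" (is "?lhs \<le> ?A1 + ?A2 + ?A3")
      if y: "y \<in> alive d" for y
    proof -
      have yM: "y \<in> state_space \<mu>" "d \<le> \<bar>y\<bar>" using y by (auto simp: alive_def)
      have V0: "0 \<le> rV d y" by (rule rV_nonneg)
      let ?p = "killed (alive d) ?r (\<lambda>_. 1) y"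
      have p0: "0 \<le> ?p" by (rule killed_nonneg) auto
      have nonneg: "0 \<le> ?A1" "0 \<le> ?A2" "0 \<le> ?A3" using E0 Q V0 k2 by auto
      have crude: "?lhs \<le> E0 * (1 + \<bar>y\<bar>)"
      proof -
        have "?p * sqrt (real n) \<le> 2 * Cp * (1 + \<bar>y\<bar>)"
        proof -
          have "?p * sqrt (real n) \<le> Cp * (1 + \<bar>y\<bar>) / sqrt (real (Suc ?r)) * (2 * sqrt (real ?r))"
            using Cp sr p0 by (intro mult_mono) auto
          also have "\<dots> \<le> Cp * (1 + \<bar>y\<bar>) / sqrt (real (Suc ?r)) * (2 * sqrt (real (Suc ?r)))"
            using Cp(1) by (intro mult_left_mono) auto
          also have "\<dots> = 2 * Cp * (1 + \<bar>y\<bar>)" by (simp add: field_simps)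
          finally show ?thesis .
        qed
        moreover have "c * rV d y \<le> c * (CW * (1 + \<bar>y\<bar>))" using CWx[OF y] c by (intro mult_left_mono) auto
        moreover have "0 \<le> ?p * sqrt (real n)" "0 \<le> c * rV d y" using p0 c V0 by auto
        ultimately have "?lhs \<le> 2 * Cp * (1 + \<bar>y\<bar>) + c * (CW * (1 + \<bar>y\<bar>))" by linarith
        thus ?thesis by (simp add: E0_def algebra_simps)
      qed
      consider "\<bar>y\<bar> \<le> sqrt (real ?m) / k" | "\<bar>y\<bar> > k * sqrt (real ?m)" | "sqrt (real ?m) / k < \<bar>y\<bar>" "\<bar>y\<bar> \<le> k * sqrt (real ?m)"
        by linarith
      thus ?thesis
      proof cases
        case 1
        have "E0 * (1 + \<bar>y\<bar>) \<le> ?A1" using 1 E0 by (intro mult_left_mono) auto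
        thus ?thesis using crude nonneg by linarith
      next
        case 2
        have ks: "k * sqrt (real ?m) > 0" using k2 sr0 by simp
        have "1 * 1 \<le> k * sqrt (real ?m)"
          by (rule mult_mono) (use k1 smk in linarith)+
        hence "1 + \<bar>y\<bar> \<le> 2 * \<bar>y\<bar>" using 2 by linarith
        also have "2 * \<bar>y\<bar> \<le> 2 * (y\<^sup>2 / (k * sqrt (real ?m)))"
        proof -
          have "\<bar>y\<bar> * (k * sqrt (real ?m)) \<le> \<bar>y\<bar> * \<bar>y\<bar>" using 2 by (intro mult_left_mono) auto
          hence "\<bar>y\<bar> * (k * sqrt (real ?m)) \<le> y\<^sup>2" by (simp add: power2_eq_square)
          thus ?thesis using ks by (simp add: pos_le_divide_eq)
        qed
        finally have "E0 * (1 + \<bar>y\<bar>) \<le> E0 * (2 * (y\<^sup>2 / (k * sqrt (real ?m))))" using E0 by (intro mult_left_mono) auto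
        also have "\<dots> = ?A2" by simp
        finally show ?thesis using crude nonneg by linarith
      next
        case 3
        define t where "t = \<bar>y\<bar> / (\<sigma> * sqrt (real ?r))"
        have t0: "t \<ge> 0" using sigma_pos by (simp add: t_def)
        have y0: "\<bar>y\<bar> > 0" using 3(1) k2 sr0 by (meson divide_nonneg_pos less_imp_le order_le_less_trans)
        have ykn: "\<bar>y\<bar> * k \<le> sqrt (real n)"
        proof -
          have "\<bar>y\<bar> * k \<le> k * sqrt (real ?m) * k" using 3(2) by (intro mult_right_mono) auto
          also have "\<dots> = sqrt (real ?m) * (real k)\<^sup>2" by (simp add: power2_eq_square)
          finally show ?thesis using sm1 by linarith
        qed
        have yn: "\<bar>y\<bar> \<le> 2 * sqrt (real ?r)"
        proof -
          have "\<bar>y\<bar> * 1 \<le> \<bar>y\<bar> * k" using k1 by (intro mult_left_mono) auto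
          thus ?thesis using ykn sr by linarith
        qed
        have nk: "sqrt (real n) \<le> 2 * real k ^ 3 * \<bar>y\<bar>"
        proof -
          have "sqrt (real ?m) \<le> k * \<bar>y\<bar>" using 3(1) k2(2) by (simp add: field_simps)
          hence "2 * (real k)\<^sup>2 * sqrt (real ?m) \<le> 2 * (real k)\<^sup>2 * (k * \<bar>y\<bar>)" by (intro mult_left_mono) auto
          also have "\<dots> = 2 * real k ^ 3 * \<bar>y\<bar>" by (simp add: power2_eq_square power3_eq_cube)
          finally show ?thesis using sm2 by linarith
        qed
        define b1 where "b1 = ?p - (2 * \<Phi> t - 1)"
        define b2 where "b2 = 2 * \<Phi> t - 1 - sqrt (2 / pi) * t"
        have b1: "\<bar>b1\<bar> \<le> \<delta>" unfolding b1_def t_def by (rule n1[OF rbig(3) y yn])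
        have b2: "\<bar>b2\<bar> \<le> t ^ 3" unfolding b2_def by (rule std_normal_cdf_approx[OF t0])
        have tsn: "t * sqrt (real n) \<le> 2 / \<sigma> * \<bar>y\<bar>"
        proof -
          have "t * sqrt (real n) \<le> t * (2 * sqrt (real ?r))" using sr t0 by (intro mult_left_mono)
          also have "\<dots> = 2 / \<sigma> * \<bar>y\<bar>" using sr0 sigma_pos by (simp add: t_def field_simps)
          finally show ?thesis .
        qed
        have tk: "t \<le> 2 / \<sigma> / k"
        proof -
          have "\<bar>y\<bar> * k \<le> 2 * sqrt (real ?r)" using ykn sr by linarith
          hence "\<bar>y\<bar> \<le> 2 * sqrt (real ?r) / k" using k2 by (simp add: pos_le_divide_eq)
          hence "\<bar>y\<bar> / (\<sigma> * sqrt (real ?r)) \<le> 2 * sqrt (real ?r) / k / (\<sigma> * sqrt (real ?r))"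
            using sigma_pos sr0 by (intro divide_right_mono) auto
          also have "\<dots> = 2 / \<sigma> / k" using sr0 by simp
          finally show ?thesis by (simp add: t_def)
        qed
        have T1: "\<bar>b1 * sqrt (real n)\<bar> \<le> \<bar>y\<bar> / k"
        proof -
          have "\<bar>b1 * sqrt (real n)\<bar> \<le> \<delta> * (2 * real k ^ 3 * \<bar>y\<bar>)"
            unfolding abs_mult using b1 nk \<delta> by (intro mult_mono) auto
          also have "\<dots> = \<bar>y\<bar> / k" using k2(2) by (simp add: \<delta>_def field_simps eval_nat_numeral)
          finally show ?thesis .
        qed
        have T2: "\<bar>b2 * sqrt (real n)\<bar> \<le> 8 / \<sigma> ^ 3 * (\<bar>y\<bar> / k)"
        proof -
          have "\<bar>b2 * sqrt (real n)\<bar> \<le> t ^ 3 * sqrt (real n)"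
            unfolding abs_mult using b2 t0 by (intro mult_mono) auto
          also have "\<dots> = t\<^sup>2 * (t * sqrt (real n))" by (simp add: eval_nat_numeral)
          also have "\<dots> \<le> (2 / \<sigma> / k)\<^sup>2 * (2 / \<sigma> * \<bar>y\<bar>)"
            by (rule mult_mono[OF power_mono[OF tk t0] tsn]) (use t0 in simp_all)
          also have "\<dots> = 8 / \<sigma> ^ 3 * (\<bar>y\<bar> / k) * (1 / k)"
            by (simp add: power_divide eval_nat_numeral)
          also have "\<dots> \<le> 8 / \<sigma> ^ 3 * (\<bar>y\<bar> / k) * 1"
            using k1 sigma_pos by (intro mult_left_mono) auto
          finally show ?thesis by simp
        qed
        have T3: "\<bar>sqrt (2 / pi) * t * sqrt (real n) - c * \<bar>y\<bar>\<bar> \<le> c * (\<bar>y\<bar> / k)"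
        proof -
          have eq: "sqrt (2 / pi) * t * sqrt (real n) - c * \<bar>y\<bar> = c * \<bar>y\<bar> * (sqrt (real n) / sqrt (real ?r) - 1)"
            using sr0 sigma_pos by (simp add: t_def c_def field_simps)
          have ge: "1 \<le> sqrt (real n) / sqrt (real ?r)" using sr0 rr mp by simp
          have le: "sqrt (real n) / sqrt (real ?r) - 1 \<le> 1 / k"
          proof -
            have "sqrt (real n) / sqrt (real ?r) = sqrt (real n / real ?r)" by (simp add: real_sqrt_divide)
            also have "\<dots> \<le> real n / real ?r"
            proof -
              have u1: "1 \<le> real n / real ?r" using rbig rr mp by simp
              hence "1 \<le> sqrt (real n / real ?r)" by simp
              hence "sqrt (real n / real ?r) * 1 \<le> sqrt (real n / real ?r) * sqrt (real n / real ?r)"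
                by (intro mult_left_mono) auto
              thus ?thesis using u1 by simp
            qed
            also have "\<dots> = 1 + real ?m / real ?r" using rbig(2) rr by (simp add: field_simps)
            also have "real ?m / real ?r \<le> 1 / k"
            proof -
              have "real ?m * (2 * real k) \<le> real ?m * real k ^ 4"
              proof (rule mult_left_mono)
                have "2 * real k \<le> real k * real k" using k1 by (intro mult_right_mono) auto
                also have "\<dots> = real k ^ 2" by (simp add: power2_eq_square)
                also have "\<dots> \<le> real k ^ 4" using k1 by (intro power_increasing) auto
                finally show "2 * real k \<le> real k ^ 4" .
              qed simp
              hence "real ?m * real k \<le> real n / 2" using m1 by simp
              also have "\<dots> \<le> real ?r" using rr m16 by simp
              finally show ?thesis using rbig(2) k2(2) by (simp add: field_simps)
            qed
            finally show ?thesis by simp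
          qed
          have "\<bar>c * \<bar>y\<bar> * (sqrt (real n) / sqrt (real ?r) - 1)\<bar> = c * \<bar>y\<bar> * (sqrt (real n) / sqrt (real ?r) - 1)"
            using ge c by simp
          also have "\<dots> \<le> c * \<bar>y\<bar> * (1 / k)" using le c by (intro mult_left_mono) auto
          finally show ?thesis unfolding eq by simp
        qed
        have Vy: "\<bar>rV d y - \<bar>y\<bar>\<bar> \<le> \<bar>y\<bar> / k"
        proof -
          have A: "2 * C2 + d \<le> \<bar>y\<bar> / (4 * k)"
          proof -
            have "4 * real k * (2 * C2 + d) * real k \<le> \<bar>y\<bar> * real k" using smC 3(1) k2(2) by (simp add: field_simps)
            hence "4 * real k * (2 * C2 + d) \<le> \<bar>y\<bar>" using k2(2) by (simp add: mult_le_cancel_right)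
            thus ?thesis using k2(2) by (simp add: field_simps)
          qed
          have yk: "0 \<le> \<bar>y\<bar> / real k" by simp
          have th: "2 * (\<theta> * \<bar>y\<bar>) = (\<bar>y\<bar> / k) / 2" using k2(2) by (simp add: \<theta>_def field_simps)
          have A': "2 * C2 + d \<le> (\<bar>y\<bar> / k) / 4" using A by simp
          have lin: "\<bar>v - Y\<bar> \<le> b" if "v \<le> Y + 2 * E" "Y - d \<le> v" "E \<le> A + C2" "2 * A = b / 2"
              "2 * C2 + d \<le> b / 4" "0 \<le> b" for v Y E A b :: real
          proof (rule abs_leI)
            have "2 * E \<le> b / 2 + 2 * C2" using that(3,4) by linarith
            hence "v - Y \<le> b / 2 + 2 * C2" using that(1) by linarith
            thus "v - Y \<le> b" using that(5,6) d by linarith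
            have "- (v - Y) \<le> d" using that(2) by linarith
            thus "- (v - Y) \<le> b" using that(5,6) C2(1) by linarith
          qed
          show ?thesis
            by (rule lin[OF e(3)[OF order_refl yM(1)] e(4)[OF order_refl yM(1)] C2(2)[of y] th A' yk])
        qed
        have yV: "\<bar>y\<bar> \<le> 2 * rV d y"
        proof -
          have "\<bar>y\<bar> / k \<le> \<bar>y\<bar> / 2" using k1 by (intro divide_left_mono) auto
          thus ?thesis using Vy by linarith
        qed
        have T4: "\<bar>c * (\<bar>y\<bar> - rV d y)\<bar> \<le> c * (\<bar>y\<bar> / k)"
        proof -
          have "\<bar>\<bar>y\<bar> - rV d y\<bar> \<le> \<bar>y\<bar> / k" using Vy by (simp only: abs_minus_commute)
          hence "c * \<bar>\<bar>y\<bar> - rV d y\<bar> \<le> c * (\<bar>y\<bar> / k)" by (rule mult_left_mono) (use c in simp)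
          thus ?thesis using c by (simp only: abs_mult abs_of_pos)
        qed
        have "?p * sqrt (real n) - c * rV d y
            = b1 * sqrt (real n) + b2 * sqrt (real n) + (sqrt (2 / pi) * t * sqrt (real n) - c * \<bar>y\<bar>) + c * (\<bar>y\<bar> - rV d y)"
          by (simp add: b1_def b2_def algebra_simps)
        hence "?lhs \<le> \<bar>b1 * sqrt (real n)\<bar> + \<bar>b2 * sqrt (real n)\<bar> + \<bar>sqrt (2 / pi) * t * sqrt (real n) - c * \<bar>y\<bar>\<bar> + \<bar>c * (\<bar>y\<bar> - rV d y)\<bar>"
        proof -
          have "\<bar>u1 + u2 + u3 + u4\<bar> \<le> \<bar>u1\<bar> + \<bar>u2\<bar> + \<bar>u3\<bar> + \<bar>u4\<bar>" for u1 u2 u3 u4 :: real by linarith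
          moreover assume "?p * sqrt (real n) - c * rV d y
            = b1 * sqrt (real n) + b2 * sqrt (real n) + (sqrt (2 / pi) * t * sqrt (real n) - c * \<bar>y\<bar>) + c * (\<bar>y\<bar> - rV d y)"
          ultimately show ?thesis by (simp only:)
        qed
        also have "\<dots> \<le> \<bar>y\<bar> / k + 8 / \<sigma> ^ 3 * (\<bar>y\<bar> / k) + c * (\<bar>y\<bar> / k) + c * (\<bar>y\<bar> / k)"
          using T1 T2 T3 T4 by (intro add_mono)
        also have "\<dots> = Q / k * \<bar>y\<bar>" by (simp add: Q_def add_divide_distrib distrib_right)
        also have "\<dots> \<le> Q / k * (2 * rV d y)" using Q yV by (intro mult_left_mono) auto
        also have "\<dots> = ?A3" by simp
        finally show ?thesis using nonneg by linarith
      qed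
    qed
    show ?case
    proof (intro ballI impI)
      fix x assume x: "x \<in> alive d" and xa: "\<bar>x\<bar> \<le> a n * sqrt (real n)"
      have V0: "0 \<le> rV d x" by (rule rV_nonneg)
      let ?P = "\<lambda>j. killed (alive d) j (\<lambda>_. 1)"
      let ?B = "\<lambda>y. E0 * (1 + sqrt (real ?m) / k) * 1 + 2 * E0 / (k * sqrt (real ?m)) * y\<^sup>2 + 2 * Q / k * rVM d y"
      have qB: "quad_bdd ?B" using quad_bdd_rVM[OF d] by (intro quad_bdd_add quad_bdd_cmult quad_bdd_const quad_bdd_simps)
      have rVM_alive: "rVM d y = rV d y" if "y \<in> alive d" for y using that by (simp add: rVM_def alive_def)
      have kV: "killed (alive d) ?m (rVM d) x = rV d x" using killed_rVM[OF d, of ?m x] x by simp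
      have Pn: "?P n x = killed (alive d) ?m (?P ?r) x"
        using killed_add[of "alive d" ?m ?r "\<lambda>_. 1"] m16 by simp
      have qP: "quad_bdd (?P j)" for j by (rule quad_bdd_killed) auto
      have eq: "?P n x * sqrt (real n) - c * rV d x = killed (alive d) ?m (\<lambda>y. sqrt (real n) * ?P ?r y + (- c) * rVM d y) x"
        using killed_lin[OF qP quad_bdd_rVM[OF d] sets_alive, of d ?m "sqrt (real n)" ?r "- c" x] unfolding Pn[symmetric] kV by simp
      have "\<bar>?P n x * sqrt (real n) - c * rV d x\<bar> \<le> killed (alive d) ?m ?B x"
        unfolding eq
      proof (rule killed_abs[OF _ qB sets_alive])
        show "quad_bdd (\<lambda>y. sqrt (real n) * ?P ?r y + (- c) * rVM d y)"
          using quad_bdd_rVM[OF d] qP by (intro quad_bdd_add quad_bdd_cmult)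
        show "\<bar>sqrt (real n) * ?P ?r y + (- c) * rVM d y\<bar> \<le> ?B y" if "y \<in> alive d" for y
          using point[OF that] rVM_alive[OF that] by (simp add: mult.commute)
      qed
      also have "\<dots> = E0 * (1 + sqrt (real ?m) / k) * ?P ?m x + 2 * E0 / (k * sqrt (real ?m)) * killed (alive d) ?m (\<lambda>y. y\<^sup>2) x + 2 * Q / k * rV d x"
        unfolding kV[symmetric] by (rule killed_lin3[OF quad_bdd_const quad_bdd_simps(3) quad_bdd_rVM[OF d] sets_alive])
      also have "\<dots> \<le> 2 * E0 * Cp * CV / k * rV d x + 2 * E0 * CV * (1 + 2 * \<sigma>\<^sup>2 * Cp) / k * rV d x + 2 * Q / k * rV d x"
      proof (intro add_mono order_refl)
        have P0: "0 \<le> ?P ?m x" by (rule killed_nonneg) auto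
        have "?P ?m x \<le> Cp * (1 + \<bar>x\<bar>) / sqrt (real (Suc ?m))" by (rule Cp(2))
        also have "\<dots> \<le> Cp * (CV * rV d x) / sqrt (real ?m)"
          using Cp(1) CV(2)[OF x] sr0 CV(1) V0 by (intro frac_le mult_left_mono) auto
        finally have Pm: "?P ?m x \<le> Cp * CV * rV d x / sqrt (real ?m)" by (simp add: mult.assoc)
        have mk: "1 + sqrt (real ?m) / k \<le> 2 * (sqrt (real ?m) / k)" using smk k2(2) by (simp add: field_simps)
        have "E0 * (1 + sqrt (real ?m) / k) * ?P ?m x \<le> E0 * (2 * (sqrt (real ?m) / k)) * (Cp * CV * rV d x / sqrt (real ?m))"
          using E0 mk Pm P0 by (intro mult_mono) auto
        also have "\<dots> = 2 * E0 * Cp * CV / k * rV d x" using sr0 by simp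
        finally show "E0 * (1 + sqrt (real ?m) / k) * ?P ?m x \<le> 2 * E0 * Cp * CV / k * rV d x" .
        have "killed (alive d) ?m (\<lambda>y. y\<^sup>2) x \<le> x\<^sup>2 + \<sigma>\<^sup>2 * (Cp * (1 + \<bar>x\<bar>) * (2 * sqrt (real ?m)))"
          by (rule second_moment_bound[OF d Cp(2,1)])
        also have "\<dots> \<le> sqrt (real ?m) * (CV * rV d x) + \<sigma>\<^sup>2 * (Cp * (CV * rV d x) * (2 * sqrt (real ?m)))"
        proof (intro add_mono mult_left_mono mult_right_mono)
          \<comment> \<open>Here the null sequence enters: once \<open>a n\<close> is below
            \<open>1 / (2 * k^2)\<close>, the start is within \<open>sqrt m\<close> of zero and its
            square is at most \<open>sqrt m\<close> times a multiple of \<open>V(x)\<close>.\<close>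
          have "\<bar>x\<bar> \<le> sqrt (real ?m)"
          proof -
            have "a n * sqrt (real n) \<le> 1 / (2 * (real k)\<^sup>2) * sqrt (real n)" using elim(1) by (intro mult_right_mono) auto
            also have "\<dots> \<le> sqrt (real ?m)" using sm2 k2(2) by (simp add: field_simps)
            finally show ?thesis using xa by linarith
          qed
          moreover have "\<bar>x\<bar> \<le> CV * rV d x" using CV(2)[OF x] by linarith
          ultimately have "\<bar>x\<bar> * \<bar>x\<bar> \<le> sqrt (real ?m) * (CV * rV d x)" by (intro mult_mono) auto
          thus "x\<^sup>2 \<le> sqrt (real ?m) * (CV * rV d x)" by (simp add: power2_eq_square)
        qed (use Cp CV(2)[OF x] in auto)
        also have "\<dots> = sqrt (real ?m) * (CV * (1 + 2 * \<sigma>\<^sup>2 * Cp) * rV d x)" by (simp add: algebra_simps)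
        finally have "2 * E0 / (k * sqrt (real ?m)) * killed (alive d) ?m (\<lambda>y. y\<^sup>2) x
            \<le> 2 * E0 / (k * sqrt (real ?m)) * (sqrt (real ?m) * (CV * (1 + 2 * \<sigma>\<^sup>2 * Cp) * rV d x))"
          using E0 by (intro mult_left_mono) auto
        also have "\<dots> = 2 * E0 * CV * (1 + 2 * \<sigma>\<^sup>2 * Cp) / k * rV d x" using sr0 by simp
        finally show "2 * E0 / (k * sqrt (real ?m)) * killed (alive d) ?m (\<lambda>y. y\<^sup>2) x
            \<le> 2 * E0 * CV * (1 + 2 * \<sigma>\<^sup>2 * Cp) / k * rV d x" .
      qed
      also have "\<dots> = W / k * rV d x" by (simp add: W_def add_divide_distrib distrib_right)
      also have "\<dots> \<le> \<epsilon> * rV d x" using W\<epsilon> V0 by (rule mult_right_mono)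
      finally show "\<bar>?P n x * sqrt (real n) - sqrt (2 / pi) / \<sigma> * rV d x\<bar> \<le> \<epsilon> * rV d x"
        by (simp add: c_def)
    qed
  qed
qed

end

section \<open>The first crossing\<close>

lemma hits_at_Suc: "hits_at d s (Suc M) \<Longrightarrow> hits_at d (\<lambda>n. s (Suc n)) M"
  by (auto simp: hits_at_def)

text \<open>All jumps that follow the first crossing if this crossing leaps over
  \<open>(-d, d)\<close> at step \<open>j + 1\<close>; it vanishes for all \<open>j\<close> but at
  most one. Splitting by \<open>j\<close> permits the Markov property at a fixed time.\<close>

definition far_jump :: "real \<Rightarrow> real \<Rightarrow> (nat \<Rightarrow> real) \<Rightarrow> nat \<Rightarrow> ennreal" where
  "far_jump w d s j = (if (\<forall>i\<le>j. d \<le> w * s i) \<and> w * s (Suc j) \<le> - d then jumps d (\<lambda>k. s (Suc j + k)) else 0)"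

text \<open>If the first crossing lands in \<open>(-d, d)\<close>, nothing remains; otherwise the
  rest is the sum of jumps of the path restarted at the landing point. In the induction on the
  hitting time a step without crossing shifts the index of \<open>far_jump\<close> by one.\<close>

lemma jumps_le_first_jump:
  assumes d: "d > 0" and h: "hits_at d s N" and s0: "d \<le> \<bar>s 0\<bar>"
  shows "jumps d s \<le> ennreal \<bar>cross_pos d s 1 - s 0\<bar> + (\<Sum>j. far_jump (sgn (s 0)) d s j)"
  using h s0
proof (induction N arbitrary: s)
  case 0 thus ?case by (simp add: hits_at_def)
next
  case (Suc M)
  let ?s = "\<lambda>n. s (Suc n)" and ?w = "sgn (s 0)"
  have h': "hits_at d ?s M" using Suc.prems(1) by (rule hits_at_Suc)
  have w: "?w = 1 \<or> ?w = -1" using Suc.prems(2) d by (auto simp: sgn_if)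
  have J: "jumps d s = ennreal (?w * (s 0 - s 1) + excursion_sum ?s M)"
    unfolding jumps_eq[OF d Suc.prems(1)] excursion_sum_Suc ..
  show ?case
  proof (cases "crossing d s 1")
    case True
    have H1: "cross_pos d s 1 = s 1" using cross_pos_crossing[OF True, of 0] by simp
    have sg: "?w * s 1 < d" using True Suc.prems(2) d by (auto simp: crossing_def sgn_if abs_if split: if_splits)
    have ab: "?w * (s 0 - s 1) = \<bar>s 1 - s 0\<bar>"
      using sg Suc.prems(2) d by (auto simp: sgn_if abs_if split: if_splits)
    have "jumps d s = ennreal \<bar>s 1 - s 0\<bar> + jumps d ?s"
      unfolding J ab jumps_eq[OF d h'] using excursion_sum_ge(2)[OF d h'] by (simp add: ennreal_plus)
    also have "jumps d ?s \<le> (\<Sum>j. far_jump ?w d s j)"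
    proof (cases "\<bar>s 1\<bar> < d")
      case True
      thus ?thesis using jumps_inside[of ?s d] by simp
    next
      case False
      have "?w * s 1 \<le> - d" using False sg w by (auto simp: abs_if split: if_splits)
      moreover have "d \<le> ?w * s 0" using Suc.prems(2) by (auto simp: sgn_if abs_if split: if_splits)
      ultimately have "jumps d ?s = far_jump ?w d s 0" by (simp add: far_jump_def)
      also have "\<dots> \<le> (\<Sum>j. far_jump ?w d s j)"
        using sum_le_suminf[of "far_jump ?w d s" "{0}"] by simp
      finally show ?thesis .
    qed
    finally show ?thesis using H1 by (simp add: add_left_mono)
  next
    case False
    have s1: "d \<le> \<bar>s 1\<bar>" using False Suc.prems(2) by (auto simp: crossing_def abs_if split: if_splits)
    have same: "sgn (s 1) = ?w" using False Suc.prems(2) s1 d by (auto simp: crossing_def sgn_if abs_if split: if_splits)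
    define h where "h = cross_pos d ?s 1"
    have H1: "cross_pos d s 1 = h" using cross_pos_no_crossing[OF False, of 0] by (simp add: h_def)
    have hs: "?w * h < d" using sgn_cross_pos_1[OF d h'] s1 same by (simp add: h_def)
    have rel: "\<bar>h - s 0\<bar> = \<bar>h - s 1\<bar> + ?w * (s 0 - s 1)"
    proof -
      have "\<bar>h - s 1\<bar> = ?w * (s 1 - h)"
        using hs s1 d unfolding same[symmetric] by (auto simp: sgn_if abs_if split: if_splits)
      moreover have "\<bar>h - s 0\<bar> = ?w * (s 0 - h)"
        using hs Suc.prems(2) d by (auto simp: sgn_if abs_if split: if_splits)
      ultimately show ?thesis by (simp add: algebra_simps)
    qed
    have IH: "jumps d ?s \<le> ennreal \<bar>h - s 1\<bar> + (\<Sum>j. far_jump ?w d ?s j)"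
      using Suc.IH[OF h'] s1 same by (simp add: h_def)
    have ws: "d \<le> ?w * s 0" "\<not> ?w * s 1 \<le> - d"
      using Suc.prems(2) s1 d unfolding same[symmetric]
      by (auto simp: sgn_if abs_if same[symmetric] split: if_splits) (use same in \<open>auto simp: sgn_if split: if_splits\<close>)
    have "far_jump ?w d s (Suc j) = far_jump ?w d ?s j" for j
    proof -
      have c: "(\<forall>i\<le>Suc j. d \<le> ?w * s i) \<longleftrightarrow> (\<forall>i\<le>j. d \<le> ?w * s (Suc i))"
      proof (intro iffI allI impI)
        fix i assume "\<forall>i\<le>j. d \<le> ?w * s (Suc i)" "i \<le> Suc j"
        thus "d \<le> ?w * s i" using ws(1) by (cases i) auto
      qed auto
      show ?thesis unfolding far_jump_def c by auto
    qed
    moreover have "far_jump ?w d s 0 = 0" using ws(2) by (simp add: far_jump_def)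
    ultimately have S: "(\<Sum>j. far_jump ?w d s j) = (\<Sum>j. far_jump ?w d ?s j)"
      by (subst suminf_ennreal_Suc) simp
    show ?thesis
    proof (cases "(\<Sum>j. far_jump ?w d ?s j)")
      case (real r)
      have "ennreal (excursion_sum ?s M) \<le> ennreal (\<bar>h - s 1\<bar> + r)"
        using IH real(1) unfolding jumps_eq[OF d h'] real(2) by (simp add: ennreal_plus)
      hence "excursion_sum ?s M \<le> \<bar>h - s 1\<bar> + r" using real(1) by (subst (asm) ennreal_le_iff) auto
      hence "jumps d s \<le> ennreal (\<bar>h - s 0\<bar> + r)" unfolding J rel by (intro ennreal_leI) simp
      also have "\<dots> = ennreal \<bar>h - s 0\<bar> + ennreal r" using real(1) by (intro ennreal_plus) auto
      finally show ?thesis unfolding H1 S real(2) .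
    qed (simp add: S)
  qed
qed

lemma far_jump_measurable [measurable]: "(\<lambda>s. far_jump w d s j) \<in> borel_measurable path_space"
proof -
  have "(\<lambda>s k. s (Suc j + k)) \<in> measurable path_space path_space" by (rule measurable_shift)
  note [measurable] = measurable_compose[OF this jumps_measurable[of d]]
  show ?thesis unfolding far_jump_def by measurable
qed

section \<open>Comparison of the harmonic function with the mean first jump\<close>

context centred_walk
begin

definition rU :: "real \<Rightarrow> real \<Rightarrow> real" where
  "rU d x = \<bar>x - (\<integral>s. cross_pos d (wpath x s) 1 \<partial>incr)\<bar>"

lemma wpath_meas: "wpath x \<in> measurable incr path_space"
proof -
  have "(\<lambda>s. wpath x s) \<in> measurable path_space path_space" by measurable
  thus ?thesis by measurable
qed

lemma cross_pos_wpath_measurable [measurable]: "(\<lambda>s. cross_pos d (wpath x s) 1) \<in> borel_measurable incr"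
  by (rule measurable_compose[OF wpath_meas cross_pos_measurable])

lemmas [measurable] = cross_pos_wpath_measurable[unfolded One_nat_def]

text \<open>The distance to \<open>H\<^sub>1\<close> is the first summand in the sum defining
  \<open>V\<close>, hence integrable and of mean at most \<open>V\<close>. Since
  \<open>sgn x * H\<^sub>1 < d \<le> \<bar>x\<bar>\<close>, the difference
  \<open>x - H\<^sub>1\<close> has a constant strict sign, so the absolute value may be taken
  outside of the expectation, and \<open>U > 0\<close>.\<close>

lemma rU_facts:
  assumes d: "d > 0" and x: "x \<in> alive d"
  shows "integrable incr (\<lambda>s. cross_pos d (wpath x s) 1)"
    and "ennreal (rU d x) = (\<integral>\<^sup>+s. ennreal \<bar>cross_pos d (wpath x s) 1 - x\<bar> \<partial>incr)"
    and "0 < rU d x" "rU d x \<le> rV d x"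
proof -
  have xM: "x \<in> state_space \<mu>" "d \<le> \<bar>x\<bar>" using x by (auto simp: alive_def)
  interpret I: prob_space incr by (rule prob_space_incr)
  let ?H = "\<lambda>s. cross_pos d (wpath x s) 1"
  obtain e where eq: "\<And>d' x. d \<le> d' \<Longrightarrow> x \<in> state_space \<mu> \<Longrightarrow> nnV d' x = ennreal (rV d' x)"
    by (rule rV_bounds[OF d]) blast
  have ae: "AE s in incr. sgn x * ?H s < d \<and> ennreal \<bar>?H s - x\<bar> \<le> jumps d (wpath x s)"
    using AE_hits[OF d xM(1)]
  proof eventually_elim
    case (elim s)
    then obtain N where N: "hits_at d (wpath x s) N" by blast
    have s0: "d \<le> \<bar>wpath x s 0\<bar>" using xM by simp
    have "jump d (wpath x s) 0 \<le> jump_sum d (wpath x s)"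
      unfolding jump_sum_eq using sum_le_suminf[of "jump d (wpath x s)" "{0}"] by simp
    moreover have "jump d (wpath x s) 0 = ennreal \<bar>?H s - x\<bar>" by (simp add: jump_def)
    ultimately show ?case using sgn_cross_pos_1[OF d N s0] s0 by (simp add: jumps_def)
  qed
  have le: "(\<integral>\<^sup>+s. ennreal \<bar>?H s - x\<bar> \<partial>incr) \<le> nnV d x"
    unfolding nnV_def by (rule nn_integral_mono_AE) (use ae in \<open>auto elim!: eventually_mono\<close>)
  have int1: "integrable incr (\<lambda>s. ?H s - x)"
  proof (rule integrableI_bounded)
    show "(\<integral>\<^sup>+s. ennreal (norm (?H s - x)) \<partial>incr) < \<infinity>"
      using le_less_trans[OF le] eq[of d x] xM by simp
  qed measurable
  have "integrable incr (\<lambda>s. (?H s - x) + x)" using int1 by (intro Bochner_Integration.integrable_add) auto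
  thus int: "integrable incr ?H" by simp
  have pos: "AE s in incr. \<bar>?H s - x\<bar> = sgn x * (x - ?H s) \<and> 0 < sgn x * (x - ?H s)"
    using ae
  proof eventually_elim
    case (elim s)
    thus ?case using xM(2) d by (auto simp: sgn_if abs_if split: if_splits)
  qed
  have i2: "(\<integral>s. \<bar>?H s - x\<bar> \<partial>incr) = sgn x * (x - (\<integral>s. ?H s \<partial>incr))"
  proof -
    have "(\<integral>s. \<bar>?H s - x\<bar> \<partial>incr) = (\<integral>s. sgn x * (x - ?H s) \<partial>incr)"
      by (rule integral_cong_AE) (use pos in \<open>auto elim!: eventually_mono\<close>)
    also have "\<dots> = sgn x * (x - (\<integral>s. ?H s \<partial>incr))" using int I.prob_space by simp
    finally show ?thesis .
  qed
  have i0: "0 \<le> (\<integral>s. \<bar>?H s - x\<bar> \<partial>incr)" by (rule Bochner_Integration.integral_nonneg) simp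
  have U: "rU d x = (\<integral>s. \<bar>?H s - x\<bar> \<partial>incr)"
  proof -
    have "\<bar>sgn x\<bar> = 1" using xM d by (auto simp: sgn_if)
    hence "rU d x = \<bar>sgn x * (x - (\<integral>s. ?H s \<partial>incr))\<bar>" unfolding rU_def abs_mult by simp
    thus ?thesis unfolding i2[symmetric] using i0 by simp
  qed
  show Ue: "ennreal (rU d x) = (\<integral>\<^sup>+s. ennreal \<bar>?H s - x\<bar> \<partial>incr)"
    unfolding U using int1 by (intro nn_integral_eq_integral[symmetric]) auto
  show "rU d x \<le> rV d x"
    using le unfolding Ue[symmetric] using eq[of d x] xM rV_nonneg[of d x] by (simp add: ennreal_le_iff)
  have "rU d x \<noteq> 0"
  proof
    assume "rU d x = 0"
    hence "AE s in incr. \<bar>?H s - x\<bar> = 0"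
      using int1 unfolding U by (subst (asm) integral_nonneg_eq_0_iff_AE) auto
    hence "AE s in incr. False" using pos by eventually_elim auto
    thus False by simp
  qed
  thus "0 < rU d x" using i0 U by linarith
qed

text \<open>As the walk stays in the state space, integrands under \<open>nn_killed\<close> may be
  compared there instead of on the whole line.\<close>

lemma nn_killed_restrict:
  assumes "x \<in> state_space \<mu>"
  shows "nn_killed A n f x = nn_killed (A \<inter> state_space \<mu>) n f x"
  using assms
proof (induction n arbitrary: x)
  case 0 thus ?case by (simp add: nn_killed_0 indicator_def)
next
  case (Suc n)
  have "(\<integral>\<^sup>+y. nn_killed A n f (x + y) \<partial>\<mu>) = (\<integral>\<^sup>+y. nn_killed (A \<inter> state_space \<mu>) n f (x + y) \<partial>\<mu>)"
    by (rule nn_integral_cong_AE) (use AE_state_space[OF Suc.prems] Suc.IH in \<open>auto elim!: eventually_mono\<close>)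
  thus ?case using Suc.prems by (simp add: nn_killed_Suc nn_step_def indicator_def)
qed

text \<open>
  In the coordinates \<open>w S\<^sub>n - d\<close> the first jump out of \<open>[0, \<infinity>)\<close> does not depend on \<open>d\<close>:
  \<open>undershoot w y D s\<close> is its overshoot below \<open>0\<close>, restricted to overshoots of size at least \<open>D\<close>.
\<close>

definition undershoot :: "real \<Rightarrow> real \<Rightarrow> real \<Rightarrow> (nat \<Rightarrow> real) \<Rightarrow> nat \<Rightarrow> ennreal" where
  "undershoot w y D s j = (if (\<forall>i\<le>j. 0 \<le> y + w * wpath 0 s i) \<and> y + w * wpath 0 s (Suc j) \<le> - D
     then ennreal (- (y + w * wpath 0 s (Suc j))) else 0)"

lemma undershoot_measurable [measurable]: "(\<lambda>s. undershoot w y D s j) \<in> borel_measurable incr"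
proof -
  have "(\<lambda>s. undershoot w y D s j) \<in> borel_measurable path_space"
    unfolding undershoot_def by measurable
  thus ?thesis by measurable
qed

lemma wpath_shift: "w * w = 1 \<Longrightarrow> w * wpath (w * (d + y)) s n = d + (y + w * wpath 0 s n)"
  by (simp add: wpath_def algebra_simps)

lemma undershoot_antimono: "D \<le> D' \<Longrightarrow> undershoot w y D' s j \<le> undershoot w y D s j"
  by (auto simp: undershoot_def)

text \<open>An undershoot of size at least \<open>2 * d\<close> below level \<open>d\<close> is a
  jump from above \<open>d\<close> to \<open>-d\<close> or lower. It crosses zero, and at least half
  of it lies beyond zero, so it is dominated by twice the backjump.\<close>

lemma undershoot_finite:
  assumes d: "d > 0" and y: "y \<ge> 0" and w: "w = 1 \<or> w = -1" and x: "w * (d + y) \<in> state_space \<mu>"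
  shows "(\<integral>\<^sup>+s. (\<Sum>j. undershoot w y (2 * d) s j) \<partial>incr) < \<infinity>"
proof -
  let ?x = "w * (d + y)"
  have ww: "w * w = 1" using w by auto
  obtain e where e: "\<And>n x. (\<Sum>j<n. killed (alive d) j (\<lambda>y. excess \<bar>y\<bar>) x) \<le> e x"
    by (rule rV_bounds[OF d]) blast
  have le: "undershoot w y (2 * d) s j \<le> 2 * backjump d (wpath ?x s) j" for s j
  proof (cases "(\<forall>i\<le>j. 0 \<le> y + w * wpath 0 s i) \<and> y + w * wpath 0 s (Suc j) \<le> - (2 * d)")
    case True
    have 1: "d \<le> w * wpath ?x s i" if "i \<le> j" for i using True that unfolding wpath_shift[OF ww] by simp
    have 2: "w * wpath ?x s (Suc j) \<le> - d" using True unfolding wpath_shift[OF ww] by simp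
    have abs: "d \<le> \<bar>wpath ?x s i\<bar>" if "i \<le> j" for i
      using 1[OF that] w by (auto simp: abs_if)
    have sg: "sgn (wpath ?x s j) = w" using 1[of j] w d by (auto simp: sgn_if)
    have "- (y + w * wpath 0 s (Suc j)) = d - w * wpath ?x s (Suc j)" unfolding wpath_shift[OF ww] by simp
    also have "\<dots> \<le> 2 * max 0 (- (w * wpath ?x s (Suc j)))" using 2 by simp
    finally have "ennreal (- (y + w * wpath 0 s (Suc j))) \<le> ennreal (2 * max 0 (- (w * wpath ?x s (Suc j))))"
      by (rule ennreal_leI)
    also have "\<dots> = 2 * ennreal (max 0 (- (w * wpath ?x s (Suc j))))" by (subst ennreal_mult) simp_all
    finally show ?thesis using True abs sg by (simp add: undershoot_def backjump_def)
  next
    case False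
    show ?thesis unfolding undershoot_def if_not_P[OF False] by simp
  qed
  have "(\<integral>\<^sup>+s. (\<Sum>j. undershoot w y (2 * d) s j) \<partial>incr) = (\<Sum>j. \<integral>\<^sup>+s. undershoot w y (2 * d) s j \<partial>incr)"
    by (rule nn_integral_suminf) measurable
  also have "\<dots> \<le> (\<Sum>j. \<integral>\<^sup>+s. 2 * backjump d (wpath ?x s) j \<partial>incr)"
    by (intro suminf_le nn_integral_mono le summableI)
  also have "\<dots> = 2 * (\<Sum>j. \<integral>\<^sup>+s. backjump d (wpath ?x s) j \<partial>incr)"
    by (simp add: nn_integral_cmult)
  also have "\<dots> \<le> 2 * ennreal (e ?x)"
    by (intro mult_left_mono suminf_backjump_le[OF d x] e) simp
  also have "\<dots> < \<infinity>" by (simp add: ennreal_mult_less_top)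
  finally show ?thesis .
qed

text \<open>Dominated convergence in the threshold. A single path first steps below zero at most
  once, so its undershoot is one finite number, which every larger threshold excludes.\<close>

lemma undershoot_vanishes:
  assumes fin: "(\<integral>\<^sup>+s. (\<Sum>j. undershoot w y D s j) \<partial>incr) < \<infinity>" and D: "D > 0" and \<epsilon>: "\<epsilon> > 0"
  obtains D' where "D' \<ge> D" "(\<integral>\<^sup>+s. (\<Sum>j. undershoot w y D' s j) \<partial>incr) < ennreal \<epsilon>"
proof -
  let ?u = "\<lambda>i s. \<Sum>j. undershoot w y (D + real i) s j"
  have "(\<lambda>i. \<integral>\<^sup>+s. ?u i s \<partial>incr) \<longlonglongrightarrow> (\<integral>\<^sup>+s. 0 \<partial>incr)"
  proof (rule nn_integral_dominated_convergence[where w="\<lambda>s. \<Sum>j. undershoot w y D s j"])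
    show "AE s in incr. ?u i s \<le> (\<Sum>j. undershoot w y D s j)" for i
      by (intro AE_I2 suminf_le undershoot_antimono summableI) simp
    show "AE s in incr. (\<lambda>i. ?u i s) \<longlonglongrightarrow> 0"
    proof (rule AE_I2)
      fix s
      let ?P = "\<lambda>j. (\<forall>i\<le>j. 0 \<le> y + w * wpath 0 s i) \<and> y + w * wpath 0 s (Suc j) < 0"
      have uniq: "j = j'" if "?P j" "?P j'" for j j'
        using that by (metis linorder_neqE_nat not_less Suc_leI)
      have "\<exists>K. \<forall>j. ?P j \<longrightarrow> - (y + w * wpath 0 s (Suc j)) < K"
      proof (cases "\<exists>j. ?P j")
        case True
        then obtain j0 where j0: "?P j0" by blast
        have "- (y + w * wpath 0 s (Suc j)) < - (y + w * wpath 0 s (Suc j0)) + 1" if "?P j" for j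
          using uniq[OF that j0] by simp
        thus ?thesis by blast
      qed blast
      then obtain K where K: "\<And>j. ?P j \<Longrightarrow> - (y + w * wpath 0 s (Suc j)) < K" by blast
      have "undershoot w y (D + real i) s j = 0" if "K \<le> real i" for i j
        using K[of j] that D by (auto simp: undershoot_def)
      hence z: "?u i s = 0" if "K \<le> real i" for i using that by simp
      obtain i0 where "K \<le> real i0" using real_arch_simple by blast
      hence "\<forall>\<^sub>F i in sequentially. ?u i s = 0"
        using z by (auto simp: eventually_sequentially intro!: exI[of _ i0] dest: order_trans of_nat_mono[where 'a=real])
      thus "(\<lambda>i. ?u i s) \<longlonglongrightarrow> 0" by (rule tendsto_eventually)
    qed
  qed (use fin in auto)
  hence "(\<lambda>i. \<integral>\<^sup>+s. ?u i s \<partial>incr) \<longlonglongrightarrow> 0" by simp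
  hence "\<forall>\<^sub>F i in sequentially. (\<integral>\<^sup>+s. ?u i s \<partial>incr) < ennreal \<epsilon>"
    by (rule order_tendstoD(2)) (use \<epsilon> in simp)
  then obtain i where "(\<integral>\<^sup>+s. ?u i s \<partial>incr) < ennreal \<epsilon>" by (auto simp: eventually_sequentially)
  thus ?thesis by (intro that[of "D + real i"]) auto
qed

text \<open>Restarting at the landing point \<open>z\<close> replaces the remaining jumps by
  \<open>V(z) \<le> C * \<bar>z\<bar>\<close>, and \<open>\<bar>z\<bar>\<close> is smaller than the
  undershoot, which is measured from level \<open>d\<close> instead of zero. The passage through the
  state space is made because the bound on \<open>V\<close> is assumed there.\<close>

lemma nn_integral_far_jump_le:
  assumes d: "d > 0" and w: "w = 1 \<or> w = -1" and x: "w * (d + y) \<in> state_space \<mu>" and C: "C \<ge> 0"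
    and V: "\<And>z. z \<in> state_space \<mu> \<Longrightarrow> d \<le> \<bar>z\<bar> \<Longrightarrow> nnV d z \<le> ennreal (C * \<bar>z\<bar>)"
  shows "(\<integral>\<^sup>+s. far_jump w d (wpath (w * (d + y)) s) j \<partial>incr) \<le> ennreal C * (\<integral>\<^sup>+s. undershoot w y (2 * d) s j \<partial>incr)"
proof -
  let ?x = "w * (d + y)" and ?A = "{z. d \<le> w * z} :: real set"
  have ww: "w * w = 1" using w by auto
  have A [measurable]: "?A \<in> sets borel" by measurable
  let ?\<Psi> = "\<lambda>t :: nat \<Rightarrow> real. if w * t (Suc 0) \<le> - d then jumps d (\<lambda>k. t (Suc 0 + k)) else 0"
  let ?\<Psi>' = "\<lambda>t :: nat \<Rightarrow> real. if w * t (Suc 0) \<le> - d then ennreal (C * \<bar>t (Suc 0)\<bar>) else 0"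
  note [measurable] = measurable_compose[OF measurable_shift[of "Suc 0"] jumps_measurable[of d]]
  have \<Psi>m: "?\<Psi> \<in> borel_measurable path_space" by measurable
  have \<Psi>'m: "?\<Psi>' \<in> borel_measurable path_space" by measurable
  have "(\<integral>\<^sup>+s. far_jump w d (wpath ?x s) j \<partial>incr)
      = (\<integral>\<^sup>+s. (if \<forall>k\<le>j. wpath ?x s k \<in> ?A then ?\<Psi> (\<lambda>k. wpath ?x s (j + k)) else 0) \<partial>incr)"
    by (intro nn_integral_cong) (auto simp: far_jump_def)
  also have "\<dots> = nn_killed ?A j (\<lambda>z. \<integral>\<^sup>+s. ?\<Psi> (wpath z s) \<partial>incr) ?x"
    by (rule nn_integral_killed_path[OF \<Psi>m A])
  also have "\<dots> = nn_killed (?A \<inter> state_space \<mu>) j (\<lambda>z. \<integral>\<^sup>+s. ?\<Psi> (wpath z s) \<partial>incr) ?x"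
    by (rule nn_killed_restrict[OF x])
  also have "\<dots> \<le> nn_killed (?A \<inter> state_space \<mu>) j (\<lambda>z. \<integral>\<^sup>+s. ?\<Psi>' (wpath z s) \<partial>incr) ?x"
  proof (rule nn_killed_mono)
    fix z assume "z \<in> ?A \<inter> state_space \<mu>"
    hence zM: "z \<in> state_space \<mu>" by simp
    have "(\<integral>\<^sup>+s. ?\<Psi> (wpath z s) \<partial>incr) = (\<integral>\<^sup>+u. (\<integral>\<^sup>+s. ?\<Psi> (wpath z (case_nat u s)) \<partial>incr) \<partial>\<mu>)"
    proof (rule nn_integral_incr_step)
      have "wpath z \<in> measurable path_space path_space" by measurable
      from measurable_compose[OF this \<Psi>m] show "(\<lambda>s. ?\<Psi> (wpath z s)) \<in> borel_measurable path_space" .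
    qed
    also have "\<dots> = (\<integral>\<^sup>+u. (if w * (z + u) \<le> - d then nnV d (z + u) else 0) \<partial>\<mu>)"
      by (intro nn_integral_cong) (simp add: wpath_case_nat nnV_def)
    also have "\<dots> \<le> (\<integral>\<^sup>+u. (if w * (z + u) \<le> - d then ennreal (C * \<bar>z + u\<bar>) else 0) \<partial>\<mu>)"
    proof (rule nn_integral_mono_AE)
      show "AE u in \<mu>. (if w * (z + u) \<le> - d then nnV d (z + u) else 0)
          \<le> (if w * (z + u) \<le> - d then ennreal (C * \<bar>z + u\<bar>) else 0)"
        using AE_state_space[OF zM]
      proof eventually_elim
        case (elim u)
        moreover have "d \<le> \<bar>z + u\<bar>" if "w * (z + u) \<le> - d" using that w by auto
        ultimately show ?case using V[of "z + u"] by auto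
      qed
    qed
    also have "\<dots> = (\<integral>\<^sup>+s. ?\<Psi>' (wpath z s) \<partial>incr)"
      by (rule nn_integral_wpath_1[symmetric]) measurable
    finally show "(\<integral>\<^sup>+s. ?\<Psi> (wpath z s) \<partial>incr) \<le> (\<integral>\<^sup>+s. ?\<Psi>' (wpath z s) \<partial>incr)" .
  qed
  also have "\<dots> = nn_killed ?A j (\<lambda>z. \<integral>\<^sup>+s. ?\<Psi>' (wpath z s) \<partial>incr) ?x"
    by (rule nn_killed_restrict[OF x, symmetric])
  also have "\<dots> = (\<integral>\<^sup>+s. (if \<forall>k\<le>j. wpath ?x s k \<in> ?A then ?\<Psi>' (\<lambda>k. wpath ?x s (j + k)) else 0) \<partial>incr)"
    by (rule nn_integral_killed_path[OF \<Psi>'m A, symmetric])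
  also have "\<dots> \<le> (\<integral>\<^sup>+s. ennreal C * undershoot w y (2 * d) s j \<partial>incr)"
  proof (rule nn_integral_mono)
    fix s
    show "(if \<forall>k\<le>j. wpath ?x s k \<in> ?A then ?\<Psi>' (\<lambda>k. wpath ?x s (j + k)) else 0) \<le> ennreal C * undershoot w y (2 * d) s j"
    proof (cases "(\<forall>k\<le>j. d \<le> w * wpath ?x s k) \<and> w * wpath ?x s (Suc j) \<le> - d")
      case True
      have u: "undershoot w y (2 * d) s j = ennreal (- (y + w * wpath 0 s (Suc j)))"
        using True unfolding wpath_shift[OF ww] by (simp add: undershoot_def)
      have "\<bar>wpath ?x s (Suc j)\<bar> = - (w * wpath ?x s (Suc j))" using True w d by auto
      also have "\<dots> \<le> - (y + w * wpath 0 s (Suc j))" unfolding wpath_shift[OF ww] using d by simp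
      finally have "ennreal (C * \<bar>wpath ?x s (Suc j)\<bar>) \<le> ennreal (C * - (y + w * wpath 0 s (Suc j)))"
        using C by (intro ennreal_leI mult_left_mono) auto
      also have "\<dots> = ennreal C * undershoot w y (2 * d) s j"
        unfolding u using True d C unfolding wpath_shift[OF ww] by (intro ennreal_mult) auto
      finally show ?thesis using True by simp
    next
      case False
      thus ?thesis by auto
    qed
  qed
  also have "\<dots> = ennreal C * (\<integral>\<^sup>+s. undershoot w y (2 * d) s j \<partial>incr)"
    by (rule nn_integral_cmult) measurable
  finally show ?thesis .
qed

text \<open>\<open>V - U\<close> is at most \<open>C\<close> times the mean undershoot of size at
  least \<open>2 * d\<close>. The law of the undershoot depends on \<open>y\<close> and the side
  \<open>w\<close> but not on \<open>d\<close>, so only the threshold moves as \<open>d\<close>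
  grows; the error function at level \<open>1\<close> makes \<open>C\<close> uniform in
  \<open>d\<close>.\<close>

lemma rV_minus_rU:
  assumes y: "y \<ge> 0" and w: "w = 1 \<or> w = -1" and \<epsilon>: "\<epsilon> > 0"
  shows "\<exists>D. \<forall>d\<ge>D. d + y \<in> state_space \<mu> \<longrightarrow> \<bar>rV d (w * (d + y)) - rU d (w * (d + y))\<bar> \<le> \<epsilon>"
proof (cases "\<exists>d\<ge>1. d + y \<in> state_space \<mu>")
  case False thus ?thesis by blast
next
  case True
  then obtain d0 where d0: "d0 \<ge> 1" "d0 + y \<in> state_space \<mu>" by blast
  have wM: "w * z \<in> state_space \<mu>" if "z \<in> state_space \<mu>" for z
    using w state_space_uminus[OF that] that by auto
  obtain e where e: "\<And>x. 0 \<le> e x" "\<And>\<epsilon>. \<epsilon> > 0 \<Longrightarrow> \<exists>C\<ge>0. \<forall>x. e x \<le> \<epsilon> * \<bar>x\<bar> + C"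
    "\<And>d' x. 1 \<le> d' \<Longrightarrow> x \<in> state_space \<mu> \<Longrightarrow> nnV d' x = ennreal (rV d' x)"
    "\<And>d' x. 1 \<le> d' \<Longrightarrow> x \<in> state_space \<mu> \<Longrightarrow> rV d' x \<le> \<bar>x\<bar> + 2 * e x"
    by (rule rV_bounds[of 1]) (simp, blast)
  obtain C1 where C1: "C1 \<ge> 0" "\<And>x. e x \<le> 1 * \<bar>x\<bar> + C1" using e(2)[of 1] by auto
  define C where "C = 3 + 2 * C1"
  have C: "C > 0" using C1 by (simp add: C_def)
  have V: "nnV d z \<le> ennreal (C * \<bar>z\<bar>)" if "1 \<le> d" "z \<in> state_space \<mu>" "d \<le> \<bar>z\<bar>" for d z
  proof -
    have "C1 * 1 \<le> C1 * \<bar>z\<bar>" using that C1 by (intro mult_left_mono) auto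
    hence "rV d z \<le> C * \<bar>z\<bar>" using e(4)[OF that(1,2)] C1(2)[of z] by (simp add: C_def distrib_right)
    thus ?thesis unfolding e(3)[OF that(1,2)] by (rule ennreal_leI)
  qed
  have fin: "(\<integral>\<^sup>+s. (\<Sum>j. undershoot w y (2 * d0) s j) \<partial>incr) < \<infinity>"
    using d0 by (intro undershoot_finite y w wM) auto
  obtain D' where D': "D' \<ge> 2 * d0" "(\<integral>\<^sup>+s. (\<Sum>j. undershoot w y D' s j) \<partial>incr) < ennreal (\<epsilon> / C)"
    by (rule undershoot_vanishes[OF fin, of "\<epsilon> / C"]) (use d0 \<epsilon> C in auto)
  have "\<bar>rV d (w * (d + y)) - rU d (w * (d + y))\<bar> \<le> \<epsilon>" if dD: "d \<ge> D'" and M: "d + y \<in> state_space \<mu>" for d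
  proof -
    let ?x = "w * (d + y)"
    have d1: "1 \<le> d" using dD D'(1) d0(1) by linarith
    have d: "d > 0" using d1 by simp
    have xM: "?x \<in> state_space \<mu>" by (rule wM[OF M])
    have ax: "\<bar>?x\<bar> = d + y" using w d y by (auto simp: abs_mult)
    have xa: "?x \<in> alive d" using xM ax y by (simp add: alive_def)
    have sg: "sgn ?x = w" using w d y by (auto simp: sgn_if)
    have "ennreal (rV d ?x) = nnV d ?x" using e(3)[OF d1 xM] by simp
    also have "\<dots> \<le> (\<integral>\<^sup>+s. ennreal \<bar>cross_pos d (wpath ?x s) 1 - ?x\<bar> + (\<Sum>j. far_jump w d (wpath ?x s) j) \<partial>incr)"
      unfolding nnV_def
    proof (rule nn_integral_mono_AE)
      show "AE s in incr. jumps d (wpath ?x s) \<le> ennreal \<bar>cross_pos d (wpath ?x s) 1 - ?x\<bar> + (\<Sum>j. far_jump w d (wpath ?x s) j)"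
        using AE_hits[OF d xM]
      proof eventually_elim
        case (elim s)
        then obtain N where N: "hits_at d (wpath ?x s) N" by blast
        have s0: "d \<le> \<bar>wpath ?x s 0\<bar>" using ax y by simp
        show ?case using jumps_le_first_jump[OF d N s0] unfolding wpath_0 sg .
      qed
    qed
    also have "\<dots> = ennreal (rU d ?x) + (\<Sum>j. \<integral>\<^sup>+s. far_jump w d (wpath ?x s) j \<partial>incr)"
    proof -
      have fm: "(\<lambda>s. far_jump w d (wpath ?x s) j) \<in> borel_measurable incr" for j
        by (rule measurable_compose[OF wpath_meas far_jump_measurable])
      show ?thesis unfolding rU_facts(2)[OF d xa] nn_integral_suminf[OF fm, symmetric]
        using fm by (intro nn_integral_add) auto
    qed
    also have "(\<Sum>j. \<integral>\<^sup>+s. far_jump w d (wpath ?x s) j \<partial>incr) \<le> (\<Sum>j. ennreal C * (\<integral>\<^sup>+s. undershoot w y (2 * d) s j \<partial>incr))"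
      using C V[OF d1] by (intro suminf_le summableI nn_integral_far_jump_le[OF d w xM]) auto
    also have "\<dots> = ennreal C * (\<integral>\<^sup>+s. (\<Sum>j. undershoot w y (2 * d) s j) \<partial>incr)"
      by (simp add: nn_integral_suminf)
    also have "\<dots> \<le> ennreal C * (\<integral>\<^sup>+s. (\<Sum>j. undershoot w y D' s j) \<partial>incr)"
      using dD d by (intro mult_left_mono nn_integral_mono suminf_le undershoot_antimono summableI) auto
    also have "\<dots> \<le> ennreal C * ennreal (\<epsilon> / C)"
      using D'(2) by (intro mult_left_mono) auto
    also have "\<dots> = ennreal \<epsilon>" using C \<epsilon> by (simp add: ennreal_mult[symmetric])
    finally have "ennreal (rV d ?x) \<le> ennreal (rU d ?x) + ennreal \<epsilon>" by (simp add: add_left_mono)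
    also have "\<dots> = ennreal (rU d ?x + \<epsilon>)" using rU_facts(3)[OF d xa] \<epsilon> by (intro ennreal_plus[symmetric]) auto
    finally have "rV d ?x \<le> rU d ?x + \<epsilon>" using rU_facts(3)[OF d xa] \<epsilon> by (subst (asm) ennreal_le_iff) auto
    thus ?thesis using rU_facts(4)[OF d xa] by simp
  qed
  thus ?thesis by blast
qed

end

section \<open>Random walks on a probability space\<close>

locale iid_walk = prob_space P for P :: "'a measure" +
  fixes X :: "nat \<Rightarrow> 'a \<Rightarrow> real" and \<sigma> :: real
  assumes indep: "indep_vars (\<lambda>_. borel) X UNIV"
    and ident: "\<And>i. distr P borel (X i) = distr P borel (X 0)"
    and square: "integrable P (\<lambda>\<omega>. (X 0 \<omega>)\<^sup>2)"
    and centred: "expectation (X 0) = 0"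
    and var: "variance (X 0) = \<sigma>\<^sup>2"
    and sigma: "\<sigma> > 0"
begin

abbreviation "step_law \<equiv> distr P borel (X 0)"

lemma X_measurable [measurable]: "X i \<in> borel_measurable P"
  using indep by (auto simp: indep_vars_def)

sublocale W: centred_walk step_law \<sigma>
proof -
  interpret D: prob_space step_law by (rule prob_space_distr) measurable
  show "centred_walk step_law \<sigma>"
  proof
    show "sets step_law = sets borel" by simp
    show "integrable step_law (\<lambda>y. y\<^sup>2)" using square by (subst integrable_distr_eq) auto
    show "(\<integral>y. y \<partial>step_law) = 0" using centred by (subst integral_distr) auto
    show "(\<integral>y. y\<^sup>2 \<partial>step_law) = \<sigma>\<^sup>2" using var centred by (subst integral_distr) auto
    show "\<sigma> > 0" by (rule sigma)
  qed
qed

lemma incr_measurable [measurable]: "(\<lambda>\<omega> i. X i \<omega>) \<in> measurable P path_space"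
  by (rule measurable_PiM_single') auto

lemma distr_incr: "distr P path_space (\<lambda>\<omega> i. X i \<omega>) = W.incr"
proof -
  have e: "(\<lambda>i. distr P borel (X i)) = (\<lambda>_. step_law)" by (rule ext) (rule ident)
  have "distr P path_space (\<lambda>x. \<lambda>i\<in>UNIV. X i x) = PiM UNIV (\<lambda>i. distr P borel (X i))"
    by (rule iffD1[OF indep_vars_iff_distr_eq_PiM indep]) auto
  thus ?thesis unfolding e restrict_UNIV .
qed

lemma walk_eq: "walk X x \<omega> = wpath x (\<lambda>i. X i \<omega>)"
  by (rule walk_eq_wpath)

lemma tail_prob_eq:
  assumes x: "x \<in> state_space step_law"
  shows "tail_prob P X d x n = W.killed (W.alive d) n (\<lambda>_. 1) x"
proof -
  let ?S = "{s. \<forall>k\<le>n. wpath x s k \<in> {y. d \<le> \<bar>y\<bar>}}"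
  have S: "?S \<in> sets path_space"
  proof -
    have "{s \<in> space path_space. \<forall>k\<le>n. d \<le> \<bar>wpath x s k\<bar>} \<in> sets path_space" by measurable
    thus ?thesis by (simp add: space_PiM PiE_UNIV_domain)
  qed
  have hit: "hit_time d s > enat n \<longleftrightarrow> (\<forall>k\<le>n. d \<le> \<bar>s k\<bar>)" for s
  proof -
    have "hit_time d s > enat n \<longleftrightarrow> (\<forall>j<Suc n. s j \<notin> {-d<..<d})"
      unfolding hit_time_def Suc_ile_eq[symmetric] le_first_time_iff ..
    also have "\<dots> \<longleftrightarrow> (\<forall>k\<le>n. d \<le> \<bar>s k\<bar>)"
    proof -
      have "u \<notin> {-d<..<d} \<longleftrightarrow> d \<le> \<bar>u\<bar>" for u by (auto simp: abs_if not_less)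
      thus ?thesis by (simp only: less_Suc_eq_le)
    qed
    finally show ?thesis .
  qed
  have "tail_prob P X d x n = measure P ((\<lambda>\<omega> i. X i \<omega>) -` ?S \<inter> space P)"
    unfolding tail_prob_def hit walk_eq by (rule arg_cong[where f="measure P"]) auto
  also have "\<dots> = measure W.incr ?S"
    unfolding distr_incr[symmetric] by (rule measure_distr[OF incr_measurable S, symmetric])
  also have "\<dots> = W.killed {y. d \<le> \<bar>y\<bar>} n (\<lambda>_. 1) x" by (rule W.prob_path_killed) measurable
  also have "\<dots> = W.killed (W.alive d) n (\<lambda>_. 1) x" by (rule W.killed_alive_eq[OF _ x]) simp
  finally show ?thesis .
qed

lemma V_ext_eq: "V_ext P X d x = W.nnV d x"
proof (cases "\<bar>x\<bar> < d")
  case True thus ?thesis by (simp add: V_ext_def W.nnV_inside)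
next
  case False
  have m: "(\<lambda>s. jump_sum d (wpath x s)) \<in> borel_measurable path_space" by measurable
  have "(\<integral>\<^sup>+\<omega>. jump_sum d (wpath x (\<lambda>i. X i \<omega>)) \<partial>P) = (\<integral>\<^sup>+s. jump_sum d (wpath x s) \<partial>W.incr)"
    unfolding distr_incr[symmetric] by (subst nn_integral_distr[OF incr_measurable]) (use m in simp_all)
  thus ?thesis using False
    unfolding V_ext_def walk_eq jump_sum_def[symmetric] by (simp add: W.nnV_def jumps_def)
qed

lemma V_eq: "V P X d x = W.rV d x"
  by (simp add: V_def W.rV_def V_ext_eq)

lemma U_eq: "U P X d x = W.rU d x"
proof -
  have m: "(\<lambda>s. cross_pos d (wpath x s) 1) \<in> borel_measurable path_space" by measurable
  show ?thesis unfolding U_def W.rU_def walk_eq distr_incr[symmetric]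
    by (subst integral_distr[OF incr_measurable m]) simp
qed

lemma V_ext_finite: "d > 0 \<Longrightarrow> x \<in> state_space step_law \<Longrightarrow> V_ext P X d x < \<infinity>"
  by (rule W.rV_bounds[of d]) (auto simp: V_ext_eq)

lemma integrable_cross_pos:
  assumes d: "d > 0" and x: "x \<in> W.alive d"
  shows "integrable P (\<lambda>\<omega>. cross_pos d (walk X x \<omega>) 1)"
proof -
  have m: "(\<lambda>s. cross_pos d (wpath x s) 1) \<in> borel_measurable path_space" by measurable
  show ?thesis unfolding walk_eq using W.rU_facts(1)[OF d x] unfolding distr_incr[symmetric]
    by (subst (asm) integrable_distr_eq[OF incr_measurable m])
qed

lemma V_harmonic:
  assumes d: "d > 0" and x: "x \<in> W.alive d"
  shows "has_bochner_integral P (\<lambda>\<omega>. V P X d (walk X x \<omega> 1)) (V P X d x)"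
proof -
  have w: "walk X x \<omega> 1 = x + X 0 \<omega>" for \<omega> by (simp add: walk_def)
  show ?thesis unfolding w V_eq has_bochner_integral_iff
  proof
    show "integrable P (\<lambda>\<omega>. W.rV d (x + X 0 \<omega>))"
      using W.integral_rV(1)[OF d x] by (subst (asm) integrable_distr_eq) auto
    show "(\<integral>\<omega>. W.rV d (x + X 0 \<omega>) \<partial>P) = W.rV d x"
      using W.integral_rV(2)[OF d x] by (subst (asm) integral_distr) auto
  qed
qed

text \<open>Positivity of \<open>V\<close> on \<open>alive d\<close> allows division of the estimate
  by \<open>c * V\<close>; the accuracy is halved beforehand to obtain a strict inequality.\<close>

lemma asymptotics_ratio:
  assumes d: "d > 0" and a: "a \<longlonglongrightarrow> 0" and \<epsilon>: "\<epsilon> > 0"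
  shows "\<forall>\<^sub>F n in sequentially. \<forall>x\<in>W.alive d. \<bar>x\<bar> \<le> a n * sqrt (real n) \<longrightarrow>
    \<bar>tail_prob P X d x n / (sqrt 2 * V P X d x / (\<sigma> * sqrt (pi * real n))) - 1\<bar> < \<epsilon>"
proof -
  let ?c = "sqrt (2 / pi) / \<sigma>"
  have c: "?c > 0" using sigma by simp
  have "\<epsilon> * ?c / 2 > 0" using \<epsilon> sigma by simp
  from W.survival_asymptotics[OF d a this] show ?thesis using eventually_gt_at_top[of 0]
  proof eventually_elim
    case (elim n)
    show ?case
    proof (intro ballI impI)
      fix x assume x: "x \<in> W.alive d" and xa: "\<bar>x\<bar> \<le> a n * sqrt (real n)"
      have xM: "x \<in> state_space step_law" using x by (simp add: W.alive_def)
      let ?p = "W.killed (W.alive d) n (\<lambda>_. 1) x" and ?v = "W.rV d x"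
      have v: "?v > 0" using W.rV_ge_mean_pos[OF d x] W.mean_pos_pos by linarith
      have sn: "sqrt (real n) > 0" using elim(2) by simp
      have g: "sqrt 2 * ?v / (\<sigma> * sqrt (pi * real n)) = ?c * ?v / sqrt (real n)"
        by (simp add: real_sqrt_mult real_sqrt_divide)
      have "\<bar>?p * sqrt (real n) - ?c * ?v\<bar> \<le> \<epsilon> * ?c / 2 * ?v" using elim(1) x xa by blast
      also have "\<dots> = \<epsilon> * (?c * ?v) / 2" by simp
      also have "\<dots> < \<epsilon> * (?c * ?v)"
      proof -
        have "t / 2 < t" if "0 < t" for t :: real using that by simp
        from this[OF mult_pos_pos[OF \<epsilon> mult_pos_pos[OF c v]]] show ?thesis .
      qed
      finally have lt: "\<bar>?p * sqrt (real n) - ?c * ?v\<bar> < \<epsilon> * (?c * ?v)" .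
      have cv: "?c * ?v > 0" using c v by (rule mult_pos_pos)
      have "?p / (?c * ?v / sqrt (real n)) - 1 = (?p * sqrt (real n) - ?c * ?v) / (?c * ?v)"
      proof -
        have "p / (A / s) - 1 = (p * s - A) / A" if "A > 0" for p A s :: real
          using that by (simp add: diff_divide_distrib)
        from this[OF cv] show ?thesis .
      qed
      hence "\<bar>?p / (?c * ?v / sqrt (real n)) - 1\<bar> = \<bar>?p * sqrt (real n) - ?c * ?v\<bar> / (?c * ?v)"
        using cv by (simp only: abs_divide abs_of_pos)
      also have "\<dots> < \<epsilon>" using lt cv by (simp only: pos_divide_less_eq)
      finally show "\<bar>tail_prob P X d x n / (sqrt 2 * V P X d x / (\<sigma> * sqrt (pi * real n))) - 1\<bar> < \<epsilon>"
        unfolding tail_prob_eq[OF xM] V_eq g .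
    qed
  qed
qed

lemma zero_inside:
  assumes "d > 0" "x \<in> state_space step_law" "\<bar>x\<bar> < d"
  shows "tail_prob P X d x n = 0" "V P X d x = 0"
proof -
  have "x \<notin> W.alive d" using assms(3) by (simp add: W.alive_def)
  thus "tail_prob P X d x n = 0" using tail_prob_eq[OF assms(2)] by (simp add: W.killed_outside)
  show "V P X d x = 0" using V_eq W.rV_inside[OF assms(3)] by simp
qed

lemma tail_prob_asymp_equiv:
  assumes d: "d > 0" and x: "x \<in> state_space step_law"
  shows "tail_prob P X d x \<sim>[sequentially] (\<lambda>n. sqrt 2 * V P X d x / (\<sigma> * sqrt (pi * real n)))"
proof (cases "\<bar>x\<bar> < d")
  case True
  have "tail_prob P X d x = (\<lambda>_. 0)" using zero_inside(1)[OF d x True] by auto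
  thus ?thesis using zero_inside(2)[OF d x True] by simp
next
  case False
  hence xa: "x \<in> W.alive d" using x by (simp add: W.alive_def)
  \<comment> \<open>A fixed starting point has the form \<open>a n * sqrt n\<close> for this null
    sequence, so the pointwise claim is an instance of the uniform one.\<close>
  have a: "(\<lambda>n. \<bar>x\<bar> / sqrt (real n)) \<longlonglongrightarrow> 0"
    by (intro real_tendsto_divide_at_top[OF tendsto_const] filterlim_compose[OF sqrt_at_top filterlim_real_sequentially])
  show ?thesis
  proof (rule asymp_equivI', rule tendstoI)
    fix \<epsilon> :: real assume "\<epsilon> > 0"
    from asymptotics_ratio[OF d a this] show "\<forall>\<^sub>F n in sequentially.
        dist (tail_prob P X d x n / (sqrt 2 * V P X d x / (\<sigma> * sqrt (pi * real n)))) 1 < \<epsilon>"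
      using eventually_gt_at_top[of 0]
    proof eventually_elim
      case (elim n)
      have "\<bar>x\<bar> \<le> \<bar>x\<bar> / sqrt (real n) * sqrt (real n)" using elim(2) by simp
      thus ?case using elim(1) xa unfolding dist_real_def by blast
    qed
  qed
qed

lemma V_asymp_equiv:
  assumes d: "d > 0"
  shows "V P X d \<sim>[inf at_infinity (principal (state_space step_law))] (\<lambda>x. \<bar>x\<bar>)"
proof (rule asymp_equivI', rule tendstoI)
  fix \<epsilon> :: real assume \<epsilon>: "\<epsilon> > 0"
  obtain e where e: "\<And>\<epsilon>. \<epsilon> > 0 \<Longrightarrow> \<exists>C\<ge>0. \<forall>x. e x \<le> \<epsilon> * \<bar>x\<bar> + C"
    "\<And>d' x. d \<le> d' \<Longrightarrow> x \<in> state_space step_law \<Longrightarrow> W.rV d' x \<le> \<bar>x\<bar> + 2 * e x"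
    "\<And>d' x. d \<le> d' \<Longrightarrow> x \<in> state_space step_law \<Longrightarrow> \<bar>x\<bar> - d' \<le> W.rV d' x"
    by (rule W.rV_bounds[OF d]) blast
  have "\<epsilon> / 8 > 0" using \<epsilon> by simp
  then obtain C where C: "C \<ge> 0" "\<And>x. e x \<le> \<epsilon> / 8 * \<bar>x\<bar> + C" using e(1) by blast
  \<comment> \<open>Beyond \<open>B\<close> the constant \<open>2 * C + d\<close> is below
    \<open>\<epsilon> * \<bar>x\<bar> / 2\<close>, while the linear part of \<open>2 * e x\<close>
    contributes \<open>\<epsilon> * \<bar>x\<bar> / 4\<close>.\<close>
  define B where "B = (2 * C + d) * 2 / \<epsilon> + 1"
  have B: "B > 0" "(2 * C + d) * 2 / \<epsilon> < B" using C d \<epsilon> by (auto simp: B_def intro!: add_nonneg_pos)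
  have "dist (V P X d x / \<bar>x\<bar>) 1 < \<epsilon>" if xB: "B \<le> \<bar>x\<bar>" and xM: "x \<in> state_space step_law" for x
  proof -
    have x0: "\<bar>x\<bar> > 0" using xB B by linarith
    have "(2 * C + d) * 2 / \<epsilon> < \<bar>x\<bar>" using xB B by linarith
    hence s: "(2 * C + d) * 2 < \<epsilon> * \<bar>x\<bar>" using \<epsilon> by (simp add: pos_divide_less_eq mult.commute)
    have p: "0 < \<epsilon> * \<bar>x\<bar>" using \<epsilon> x0 by simp
    have "2 * e x \<le> \<epsilon> * \<bar>x\<bar> / 4 + 2 * C" using C(2)[of x] by simp
    moreover have "2 * C < \<epsilon> * \<bar>x\<bar> / 2" using s d by simp
    ultimately have "W.rV d x - \<bar>x\<bar> < \<epsilon> * \<bar>x\<bar>"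
      using e(2)[OF order_refl xM] p by linarith
    moreover have "- (W.rV d x - \<bar>x\<bar>) < \<epsilon> * \<bar>x\<bar>"
    proof -
      have "\<bar>x\<bar> - W.rV d x \<le> d" using e(3)[OF order_refl xM] by linarith
      also have "\<dots> \<le> (2 * C + d) * 2" using C(1) d by simp
      also note s
      finally show ?thesis by simp
    qed
    ultimately have "\<bar>W.rV d x - \<bar>x\<bar>\<bar> < \<epsilon> * \<bar>x\<bar>" by (rule abs_less_iff[THEN iffD2, OF conjI])
    moreover have "W.rV d x / \<bar>x\<bar> - 1 = (W.rV d x - \<bar>x\<bar>) / \<bar>x\<bar>" using x0 by (simp add: diff_divide_distrib)
    ultimately show ?thesis
      unfolding dist_real_def V_eq using x0 by (simp add: abs_divide pos_divide_less_eq)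
  qed
  thus "\<forall>\<^sub>F x in inf at_infinity (principal (state_space step_law)). dist (V P X d x / \<bar>x\<bar>) 1 < \<epsilon>"
    unfolding eventually_inf_principal eventually_at_infinity by auto
qed

lemma V_minus_U_tendsto:
  assumes y: "y \<ge> 0" and s: "s \<in> {1, -1}"
  shows "((\<lambda>d. V P X d (s * (d + y)) - U P X d (s * (d + y))) \<longlongrightarrow> 0)
    (inf at_top (principal {d. d + y \<in> state_space step_law}))"
proof (rule tendstoI)
  fix \<epsilon> :: real assume \<epsilon>: "\<epsilon> > 0"
  have w: "s = 1 \<or> s = -1" using s by auto
  have "\<epsilon> / 2 > 0" using \<epsilon> by simp
  from W.rV_minus_rU[OF y w this] obtain D where D: "\<And>d. d \<ge> D \<Longrightarrow> d + y \<in> state_space step_law \<Longrightarrow>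
    \<bar>W.rV d (s * (d + y)) - W.rU d (s * (d + y))\<bar> \<le> \<epsilon> / 2" by blast
  have "dist (V P X d (s * (d + y)) - U P X d (s * (d + y))) 0 < \<epsilon>"
    if d: "d \<ge> max D 1" and M: "d + y \<in> state_space step_law" for d
  proof -
    have "\<bar>W.rV d (s * (d + y)) - W.rU d (s * (d + y))\<bar> \<le> \<epsilon> / 2" using D d M by simp
    thus ?thesis using d \<epsilon> V_eq unfolding U_eq by (simp add: dist_real_def)
  qed
  thus "\<forall>\<^sub>F d in inf at_top (principal {d. d + y \<in> state_space step_law}).
      dist (V P X d (s * (d + y)) - U P X d (s * (d + y))) 0 < \<epsilon>"
    unfolding eventually_inf_principal eventually_at_top_linorder by (intro exI[of _ "max D 1"]) auto
qed

text \<open>Starting points in \<open>(-d, d)\<close> give \<open>0 / 0\<close>, which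
  \<open>ratio\<close> reads as \<open>1\<close>; at all others the denominator is positive once
  \<open>n > 0\<close>, and \<open>ratio\<close> is the true quotient.\<close>

lemma asymptotics_uniform:
  assumes d: "d > 0" and a: "a \<longlonglongrightarrow> 0" and \<epsilon>: "\<epsilon> > 0"
  shows "\<forall>\<^sub>F n in sequentially. \<forall>x \<in> {- (a n * sqrt (real n))..a n * sqrt (real n)} \<inter> state_space step_law.
    \<bar>ratio (tail_prob P X d x n) (sqrt 2 * V P X d x / (\<sigma> * sqrt (pi * real n))) - 1\<bar> < \<epsilon>"
  using asymptotics_ratio[OF assms] eventually_gt_at_top[of 0]
proof eventually_elim
  case (elim n)
  show ?case
  proof
    fix x assume x: "x \<in> {- (a n * sqrt (real n))..a n * sqrt (real n)} \<inter> state_space step_law"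
    show "\<bar>ratio (tail_prob P X d x n) (sqrt 2 * V P X d x / (\<sigma> * sqrt (pi * real n))) - 1\<bar> < \<epsilon>"
    proof (cases "\<bar>x\<bar> < d")
      case True
      thus ?thesis using zero_inside[OF d _ True] x \<epsilon> by (simp add: ratio_def)
    next
      case False
      hence xa: "x \<in> W.alive d" using x by (simp add: W.alive_def)
      have "V P X d x > 0"
        using W.rV_ge_mean_pos[OF d xa] W.mean_pos_pos V_eq[of d x] x by simp
      hence "sqrt 2 * V P X d x / (\<sigma> * sqrt (pi * real n)) \<noteq> 0" using elim(2) sigma by simp
      moreover have "\<bar>x\<bar> \<le> a n * sqrt (real n)" using x by (auto simp: abs_le_iff)
      ultimately show ?thesis using elim(1) xa unfolding ratio_def by auto
    qed
  qed
qed

end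

theorem theorem1:
  fixes P :: "'a measure" and X :: "nat \<Rightarrow> 'a \<Rightarrow> real" and \<sigma> :: real and M :: "real set"
  assumes "prob_space P"
    and "prob_space.indep_vars P (\<lambda>_. borel) X UNIV"
    and "\<And>i. distr P borel (X i) = distr P borel (X 0)"
    and "integrable P (\<lambda>\<omega>. (X 0 \<omega>)\<^sup>2)"
    and "prob_space.expectation P (X 0) = 0"
    and "prob_space.variance P (X 0) = \<sigma>\<^sup>2"
    and "\<sigma> > 0"
    and "M = state_space (distr P borel (X 0))"
  shows
    "(\<forall>d>0. \<forall>x\<in>M.
        tail_prob P X d x \<sim>[sequentially]
          (\<lambda>n. sqrt 2 * V P X d x / (\<sigma> * sqrt (pi * real n)))) \<and>
     (\<forall>d>0. \<forall>x\<in>M. \<bar>x\<bar> \<ge> d \<longrightarrow>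
        has_bochner_integral P (\<lambda>\<omega>. V P X d (walk X x \<omega> 1)) (V P X d x)) \<and>
     (\<forall>d>0. \<forall>x\<in>M. \<bar>x\<bar> \<ge> d \<longrightarrow>
        integrable P (\<lambda>\<omega>. cross_pos d (walk X x \<omega>) 1) \<and>
        0 < U P X d x \<and> U P X d x \<le> V P X d x \<and> V_ext P X d x < \<infinity>) \<and>
     (\<forall>d>0. V P X d \<sim>[inf at_infinity (principal M)] (\<lambda>x. \<bar>x\<bar>)) \<and>
     (\<forall>y\<ge>0. \<forall>s\<in>{1, -1}.
        ((\<lambda>d. V P X d (s * (d + y)) - U P X d (s * (d + y))) \<longlongrightarrow> 0)
          (inf at_top (principal {d. d + y \<in> M}))) \<and>
     (\<forall>d>0. \<forall>a :: nat \<Rightarrow> real.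
        a \<longlonglongrightarrow> 0 \<longrightarrow> filterlim (\<lambda>n. a n * sqrt (real n)) at_top sequentially \<longrightarrow>
        (\<forall>\<epsilon>>0. \<forall>\<^sub>F n in sequentially.
           \<forall>x \<in> {- (a n * sqrt (real n))..a n * sqrt (real n)} \<inter> M.
             \<bar>ratio (tail_prob P X d x n) (sqrt 2 * V P X d x / (\<sigma> * sqrt (pi * real n))) - 1\<bar> < \<epsilon>))"
proof -
  interpret iid_walk P X \<sigma>
    by (rule iid_walk.intro[OF assms(1)], rule iid_walk_axioms.intro) (fact assms)+
  have alive: "x \<in> W.alive d" if "x \<in> M" "d \<le> \<bar>x\<bar>" for x d
    using that assms(8) by (simp add: W.alive_def)
  show ?thesis
    unfolding assms(8)
  proof (intro conjI allI ballI impI)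
    fix d x :: real assume d: "d > 0" and x: "x \<in> state_space (distr P borel (X 0))" and xd: "d \<le> \<bar>x\<bar>"
    have xa: "x \<in> W.alive d" using alive x xd assms(8) by blast
    show "has_bochner_integral P (\<lambda>\<omega>. V P X d (walk X x \<omega> 1)) (V P X d x)"
      by (rule V_harmonic[OF d xa])
    show "integrable P (\<lambda>\<omega>. cross_pos d (walk X x \<omega>) 1)" by (rule integrable_cross_pos[OF d xa])
    show "0 < U P X d x" "U P X d x \<le> V P X d x"
      using W.rU_facts(3,4)[OF d xa] V_eq by (simp_all add: U_eq)
    show "V_ext P X d x < \<infinity>" by (rule V_ext_finite[OF d x])
  qed (simp_all only: tail_prob_asymp_equiv V_asymp_equiv V_minus_U_tendsto asymptotics_uniform)
qed

end
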